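(* Let $\varphi:\mathbb{D}\to\mathbb{D}$ be a holomorphic function such that there exists a hyperbolic semiflow $(\varphi_t)_{t\ge0}$ with $\varphi=\varphi_1$. Let $\Omega$ be its Koenigs domain and assume that $\operatorname{int}(\overline{\Omega})=\Omega$ and that $\mathbb{C}\setminus\overline{\Omega}$ has at most two connected components. Then $C_\varphi\in\mathcal{L}(H^p)$, $1\le p<\infty$, is strongly compact.
   Context: $\mathbb{D}$ is the open unit disc of $\mathbb{C}$ and $\mathbb{T}$ the unit circle. For $1\le p<\infty$, $H^p$ is the Banach space of holomorphic $f:\mathbb{D}\to\mathbb{C}$ with $\|f\|_{H^p}=\left(\sup_{0<r<1}\int_0^{2\pi}|f(re^{i\theta})|^p\,d\theta\right)^{1/p}<\infty$. For holomorphic $\varphi:\mathbb{D}\to\mathbb{D}$, $C_\varphi f=f\circ\varphi$, a bounded operator on $H^p$. For a complex Banach space $X$, $\mathcal{L}(X)$ is the algebra of bounded linear operators on $X$. An algebra $\mathcal{A}\subset\mathcal{L}(X)$ is strongly compact if every (norm-)bounded subset of $\mathcal{A}$ is relatively compact in the strong operator topology. An operator $T\in\mathcal{L}(X)$ is strongly compact if $\operatorname{alg}(T)=\{q(T): q \text{ a complex polynomial}\}$ is a strongly compact algebra. Semiflows. A holomorphic semiflow is a family $(\varphi_t)_{t\ge0}$ of holomorphic self-maps of $\mathbb{D}$ with $\varphi_0(z)=z$, $\varphi_{t+s}=\varphi_t\circ\varphi_s$ for all $t,s\geq 0$, and $\varphi_t\to\varphi_s$ uniformly on compact subsets of $\mathbb{D}$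 as $t\to s$. It is elliptic if $\varphi_{t_0}(z_0)=z_0$ for some $t_0>0$ and $z_0\in\mathbb{D}$. If it is not elliptic, there is a unique $\tau\in\mathbb{T}$ (the Denjoy–Wolff point) such that $\varphi_t\to\tau$ uniformly on compact subsets as $t\to\infty$, and there is $\alpha\le 0$ such that $\varphi_t'$ has non-tangential limit $e^{t\alpha}$ at $\tau$ for all $t\geq 0$; the semiflow is hyperbolic if $\alpha<0$ and parabolic if $\alpha=0$. For a non-elliptic semiflow there is a univalent function $h:\mathbb{D}\to\mathbb{C}$ (the Koenigs function), unique up to an additive constant, with $\varphi_t(z)=h^{-1}(h(z)+t)$ for all $z\in\mathbb{D}$, $t\ge0$. The Koenigs domain is $\Omega=h(\mathbb{D})$. Interior and closure are taken in $\mathbb{C}$. *)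

theory Defs
  imports "HOL-Complex_Analysis.Complex_Analysis" "HOL-Computational_Algebra.Polynomial"
begin

abbreviation unit_disc :: "complex set"
  where "unit_disc \<equiv> ball 0 1"


section \<open>Bounded operators and strong compactness\<close>

text \<open>
  The distribution has no class of complex normed spaces, and the spaces \<open>H\<^sup>p\<close> depend on a real
  parameter. A complex normed space is therefore given by a carrier \<open>X\<close>, a set of complex-valued
  functions with the pointwise vector space operations, and a norm \<open>N\<close> on \<open>X\<close>. Operators on \<open>X\<close>
  are taken extensional (\<^const>\<open>undefined\<close> outside \<open>X\<close>), so that they are equal iff they agree on \<open>X\<close>.
\<close>

definition norm_topology ::
  "('a \<Rightarrow> complex) set \<Rightarrow> (('a \<Rightarrow> complex) \<Rightarrow> real) \<Rightarrow> ('a \<Rightarrow> complex) topology"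
  where "norm_topology X N = Metric_space.mtopology X (\<lambda>f g. N (\<lambda>x. f x - g x))"

definition bounded_operators ::
  "('a \<Rightarrow> complex) set \<Rightarrow> (('a \<Rightarrow> complex) \<Rightarrow> real) \<Rightarrow> (('a \<Rightarrow> complex) \<Rightarrow> ('a \<Rightarrow> complex)) set"
  where "bounded_operators X N =
    {T \<in> X \<rightarrow>\<^sub>E X.
       (\<forall>f\<in>X. \<forall>g\<in>X. T (\<lambda>x. f x + g x) = (\<lambda>x. T f x + T g x)) \<and>
       (\<forall>c. \<forall>f\<in>X. T (\<lambda>x. c * f x) = (\<lambda>x. c * T f x)) \<and>
       (\<exists>K. \<forall>f\<in>X. N (T f) \<le> K * N f)}"

definition operator_norm ::
  "('a \<Rightarrow> complex) set \<Rightarrow> (('a \<Rightarrow> complex) \<Rightarrow> real) \<Rightarrow> (('a \<Rightarrow> complex) \<Rightarrow> ('a \<Rightarrow> complex)) \<Rightarrow> real"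
  where "operator_norm X N T = (SUP f\<in>{f \<in> X. N f \<le> 1}. N (T f))"

text \<open>
  The strong operator topology is the topology of pointwise convergence on \<open>X\<close>, that is, the
  topology induced by the product of copies of \<open>X\<close> indexed by the elements of \<open>X\<close>.
\<close>

definition strong_operator_topology ::
  "('a \<Rightarrow> complex) set \<Rightarrow> (('a \<Rightarrow> complex) \<Rightarrow> real) \<Rightarrow>
    (('a \<Rightarrow> complex) \<Rightarrow> ('a \<Rightarrow> complex)) topology"
  where "strong_operator_topology X N =
    subtopology (product_topology (\<lambda>_. norm_topology X N) X) (bounded_operators X N)"

definition strongly_compact_algebra ::
  "('a \<Rightarrow> complex) set \<Rightarrow> (('a \<Rightarrow> complex) \<Rightarrow> real) \<Rightarrow>
    (('a \<Rightarrow> complex) \<Rightarrow> ('a \<Rightarrow> complex)) set \<Rightarrow> bool"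
  where "strongly_compact_algebra X N \<A> \<longleftrightarrow>
    \<A> \<subseteq> bounded_operators X N \<and>
    (\<forall>\<B>\<subseteq>\<A>. (\<exists>M. \<forall>T\<in>\<B>. operator_norm X N T \<le> M) \<longrightarrow>
       compactin (strong_operator_topology X N) (strong_operator_topology X N closure_of \<B>))"

definition poly_operator ::
  "('a \<Rightarrow> complex) set \<Rightarrow> complex poly \<Rightarrow> (('a \<Rightarrow> complex) \<Rightarrow> ('a \<Rightarrow> complex)) \<Rightarrow>
    ('a \<Rightarrow> complex) \<Rightarrow> ('a \<Rightarrow> complex)"
  where "poly_operator X q T = (\<lambda>f\<in>X. \<lambda>x. \<Sum>k\<le>degree q. coeff q k * (T ^^ k) f x)"

definition operator_alg ::
  "('a \<Rightarrow> complex) set \<Rightarrow> (('a \<Rightarrow> complex) \<Rightarrow> ('a \<Rightarrow> complex)) \<Rightarrow>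
    (('a \<Rightarrow> complex) \<Rightarrow> ('a \<Rightarrow> complex)) set"
  where "operator_alg X T = range (\<lambda>q. poly_operator X q T)"

definition strongly_compact_operator ::
  "('a \<Rightarrow> complex) set \<Rightarrow> (('a \<Rightarrow> complex) \<Rightarrow> real) \<Rightarrow>
    (('a \<Rightarrow> complex) \<Rightarrow> ('a \<Rightarrow> complex)) \<Rightarrow> bool"
  where "strongly_compact_operator X N T \<longleftrightarrow>
    T \<in> bounded_operators X N \<and> strongly_compact_algebra X N (operator_alg X T)"


section \<open>Hardy spaces and composition operators\<close>

definition hardy_mean :: "real \<Rightarrow> (complex \<Rightarrow> complex) \<Rightarrow> real \<Rightarrow> real"
  where "hardy_mean p f r = integral {0..2*pi} (\<lambda>\<theta>. cmod (f (of_real r * cis \<theta>)) powr p)"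

text \<open>
  A function on the disc is represented by its extension by \<open>0\<close> to the whole plane, so that
  equality of elements of \<open>H\<^sup>p\<close> is equality on the disc.
\<close>

definition hardy_space :: "real \<Rightarrow> (complex \<Rightarrow> complex) set"
  where "hardy_space p =
    {f. f holomorphic_on unit_disc \<and> (\<forall>z. z \<notin> unit_disc \<longrightarrow> f z = 0) \<and>
        bdd_above (hardy_mean p f ` {0<..<1})}"

definition hardy_norm :: "real \<Rightarrow> (complex \<Rightarrow> complex) \<Rightarrow> real"
  where "hardy_norm p f = (SUP r\<in>{0<..<1}. hardy_mean p f r) powr (1 / p)"

definition composition_operator ::
  "real \<Rightarrow> (complex \<Rightarrow> complex) \<Rightarrow> (complex \<Rightarrow> complex) \<Rightarrow> (complex \<Rightarrow> complex)"
  where "composition_operator p \<phi> =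
    (\<lambda>f\<in>hardy_space p. \<lambda>z. if z \<in> unit_disc then f (\<phi> z) else 0)"


section \<open>Holomorphic semiflows\<close>

text \<open>Only the values \<open>\<Phi> t z\<close> with \<open>t \<ge> 0\<close> and \<open>z\<close> in the disc are relevant.\<close>

definition holomorphic_semiflow :: "(real \<Rightarrow> complex \<Rightarrow> complex) \<Rightarrow> bool"
  where "holomorphic_semiflow \<Phi> \<longleftrightarrow>
    (\<forall>t\<ge>0. \<Phi> t holomorphic_on unit_disc \<and> \<Phi> t \<in> unit_disc \<rightarrow> unit_disc) \<and>
    (\<forall>z\<in>unit_disc. \<Phi> 0 z = z) \<and>
    (\<forall>t\<ge>0. \<forall>s\<ge>0. \<forall>z\<in>unit_disc. \<Phi> (t + s) z = \<Phi> t (\<Phi> s z)) \<and>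
    (\<forall>s\<ge>0. \<forall>K. compact K \<and> K \<subseteq> unit_disc \<longrightarrow> uniform_limit K \<Phi> (\<Phi> s) (at s within {0..}))"

definition elliptic_semiflow :: "(real \<Rightarrow> complex \<Rightarrow> complex) \<Rightarrow> bool"
  where "elliptic_semiflow \<Phi> \<longleftrightarrow>
    holomorphic_semiflow \<Phi> \<and> (\<exists>t>0. \<exists>z\<in>unit_disc. \<Phi> t z = z)"

definition denjoy_wolff_point :: "(real \<Rightarrow> complex \<Rightarrow> complex) \<Rightarrow> complex \<Rightarrow> bool"
  where "denjoy_wolff_point \<Phi> \<tau> \<longleftrightarrow> \<tau> \<in> sphere 0 1 \<and>
    (\<forall>K. compact K \<and> K \<subseteq> unit_disc \<longrightarrow> uniform_limit K \<Phi> (\<lambda>_. \<tau>) at_top)"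

text \<open>A non-tangential limit is a limit within every Stolz region with vertex \<open>\<tau>\<close>.\<close>

definition nontangential_limit :: "(complex \<Rightarrow> complex) \<Rightarrow> complex \<Rightarrow> complex \<Rightarrow> bool"
  where "nontangential_limit f \<tau> l \<longleftrightarrow>
    (\<forall>M>1. (f \<longlongrightarrow> l) (at \<tau> within {z \<in> unit_disc. cmod (z - \<tau>) < M * (1 - cmod z)}))"

definition hyperbolic_semiflow :: "(real \<Rightarrow> complex \<Rightarrow> complex) \<Rightarrow> bool"
  where "hyperbolic_semiflow \<Phi> \<longleftrightarrow>
    holomorphic_semiflow \<Phi> \<and> \<not> elliptic_semiflow \<Phi> \<and>
    (\<exists>\<tau>. denjoy_wolff_point \<Phi> \<tau> \<and>
      (\<exists>\<alpha><0. \<forall>t\<ge>0. nontangential_limit (deriv (\<Phi> t)) \<tau> (of_real (exp (t * \<alpha>)))))"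

definition koenigs_function :: "(real \<Rightarrow> complex \<Rightarrow> complex) \<Rightarrow> (complex \<Rightarrow> complex) \<Rightarrow> bool"
  where "koenigs_function \<Phi> h \<longleftrightarrow>
    h holomorphic_on unit_disc \<and> inj_on h unit_disc \<and>
    (\<forall>t\<ge>0. \<forall>z\<in>unit_disc. h z + of_real t \<in> h ` unit_disc \<and>
       \<Phi> t z = inv_into unit_disc h (h z + of_real t))"

end

theory Submission
  imports Defs
begin

text \<open>
  An operator whose eigenvectors span a dense subspace is strongly compact: on an eigenvector a bounded
  family of polynomials \<open>q(T)\<close> acts by bounded scalars, so by approximation all orbits are totally bounded,
  and Tychonoff's theorem applies. The functions \<open>exp (\<i> s h)\<close> with real \<open>s\<close> are eigenvectors of \<open>C\<^sub>\<phi>\<close>. They lie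
  in \<open>H\<^sup>p\<close> because \<open>\<Omega>\<close> lies in a horizontal strip: by Julia's lemma \<open>1 - \<bar>\<phi>\<^sub>n(z)\<bar>\<close> decays geometrically at a fixed
  rate, which by the Schwarz-Pick lemma rules out large discs in \<open>\<Omega>\<close>.

  For the density of their span it is enough to reach the monomials \<open>z^k\<close>. Riemann maps \<open>u\<^sub>j\<close> of shrinking
  neighbourhoods of \<open>\<Omega>\<close> satisfy \<open>u\<^sub>j \<circ> h \<rightarrow> z\<close> since \<open>\<Omega>\<close> is the interior of its closure (kernel convergence), and
  the convergence is in norm by uniform convexity. A bounded holomorphic function on a neighbourhood of
  \<open>\<Omega>\<close> is a limit, uniformly with respect to the weight \<open>exp (\<epsilon> \<bar>Re w\<bar>)\<close>, of combinations of Cauchy kernels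
  with poles off the closure of \<open>\<Omega>\<close>. The hypothesis on components allows the poles to be pushed above or below
  the strip, where the kernels are superpositions of the exponentials \<open>exp (\<i> s w)\<close>.
\<close>

section \<open>Circular means and the Poisson kernel\<close>

text \<open>The main obstacle is the passage from estimates on \<open>\<Omega>\<close> to the norm:
  \<open>\<Omega>\<close> is unbounded, and a Cauchy integral along its whole boundary need not
  converge absolutely. The weight \<open>exp (\<epsilon> * \<bar>Re w\<bar>)\<close> serves both
  sides. It makes truncating the contour harmless, and composed with \<open>h\<close> it is
  dominated by a multiple of the modulus of
  \<open>exp (\<epsilon> h) + exp (- \<epsilon> h)\<close>, which lies in the Hardy space once
  \<open>\<epsilon> p b \<le> 1\<close> for a strip of half-width \<open>b\<close>. Boundary values
  of Hardy functions are avoided throughout: every estimate is made on circles of radius below 1 and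
  passed to the supremum. The form of Clarkson's inequality used here requires exponents at least 2.
  Smaller exponents are reached through \<open>2 * p\<close>: dilations are treated by factorising a
  function into two factors of that exponent, and Riemann maps by the inclusion of the space with
  exponent \<open>2 * p\<close> in the one with exponent \<open>p\<close>. Monomials suit the
  convexity argument because no function bounded by 1 has a larger norm.\<close>

lemma powr_tangent_le:
  fixes a m p :: real
  assumes "0 \<le> a" "0 < m" "1 \<le> p"
  shows "m powr p + p * m powr (p - 1) * (a - m) \<le> a powr p"
proof -
  \<comment> \<open>The tangent at 1 is Young's inequality for \<open>x powr p\<close> and 1 with
    weights \<open>1/p\<close> and \<open>1 - 1/p\<close>; homogeneity then moves the point of
    tangency to \<open>m\<close>.\<close>
  have *: "1 + p * (x - 1) \<le> x powr p" if "0 \<le> x" for x :: real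
  proof (cases "x = 0")
    case False
    then have "(x powr p) powr (1/p) * 1 powr (1 - 1/p) \<le> (1/p) * x powr p + (1 - 1/p) * 1"
      using assms that by (intro Youngs_inequality_0) (auto simp: field_simps)
    then have "x \<le> (1/p) * x powr p + (1 - 1/p)"
      using assms that False by (simp add: powr_powr)
    then have "p * x \<le> p * ((1/p) * x powr p + (1 - 1/p))"
      using assms by (intro mult_left_mono) auto
    then show ?thesis using assms by (simp add: algebra_simps)
  qed (use assms in auto)
  have "m powr p * (1 + p * (a/m - 1)) \<le> m powr p * (a/m) powr p"
    using assms by (intro mult_left_mono *) auto
  also have "\<dots> = a powr p" using assms by (simp add: powr_divide)
  finally show ?thesis
    using assms by (simp add: powr_diff field_simps)
qed

text \<open>Averaging the two tangent inequalities at the convex combination \<open>m\<close>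
  cancels the linear terms. The case \<open>m = 0\<close>, where the tangent lemma does not apply,
  is treated apart.\<close>

lemma powr_convex_combination_le:
  fixes a b t p :: real
  assumes "0 \<le> a" "0 \<le> b" "0 \<le> t" "t \<le> 1" "1 \<le> p"
  shows "(t * a + (1 - t) * b) powr p \<le> t * a powr p + (1 - t) * b powr p"
proof -
  define m where "m = t * a + (1 - t) * b"
  have "m \<ge> 0" using assms by (simp add: m_def)
  show ?thesis
  proof (cases "m = 0")
    case True
    then show ?thesis using assms unfolding m_def[symmetric] by (simp)
  next
    case False
    with \<open>m \<ge> 0\<close> have m: "m > 0" by simp
    have "t * (m powr p + p * m powr (p - 1) * (a - m)) + (1 - t) * (m powr p + p * m powr (p - 1) * (b - m))
      \<le> t * a powr p + (1 - t) * b powr p"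
      using assms m by (intro add_mono mult_left_mono powr_tangent_le) auto
    moreover have "t * (m powr p + p * m powr (p - 1) * (a - m)) + (1 - t) * (m powr p + p * m powr (p - 1) * (b - m))
      = m powr p + p * m powr (p - 1) * (t * a + (1 - t) * b - m)" by (simp add: algebra_simps)
    ultimately show ?thesis unfolding m_def[symmetric] by simp
  qed
qed

lemma circle_point_in_disc: "0 \<le> r \<Longrightarrow> r < 1 \<Longrightarrow> of_real r * cis t \<in> unit_disc"
  by (simp add: norm_mult)

lemma continuous_on_circle:
  assumes "continuous_on unit_disc f" "0 \<le> r" "r < 1"
  shows "continuous_on S (\<lambda>t. f (of_real r * cis t))"
  by (rule continuous_on_compose2[OF assms(1)])
     (use assms in \<open>auto intro!: continuous_intros simp: norm_mult\<close>)

lemma continuous_on_circle_powr: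
  assumes "continuous_on unit_disc f" "0 \<le> r" "r < 1" "0 < p"
  shows "continuous_on S (\<lambda>t. cmod (f (of_real r * cis t)) powr p)"
  using assms by (intro continuous_on_powr' continuous_intros continuous_on_circle) auto

lemma hardy_mean_integrable:
  assumes "continuous_on unit_disc f" "0 \<le> r" "r < 1" "0 < p"
  shows "(\<lambda>t. cmod (f (of_real r * cis t)) powr p) integrable_on {0..2*pi}"
  by (rule integrable_continuous_real[OF continuous_on_circle_powr[OF assms]])

lemma hardy_mean_nonneg:
  assumes "continuous_on unit_disc f" "0 \<le> r" "r < 1" "0 < p"
  shows "0 \<le> hardy_mean p f r"
  unfolding hardy_mean_def by (rule Henstock_Kurzweil_Integration.integral_nonneg[OF hardy_mean_integrable[OF assms]]) auto

text \<open>The factor \<open>1 / (2 * pi)\<close> is left out, so the total mass over a period is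
  \<open>2 * pi\<close>.\<close>

definition poisson_kernel :: "real \<Rightarrow> complex \<Rightarrow> real \<Rightarrow> real"
  where "poisson_kernel \<rho> w t = (\<rho>\<^sup>2 - (cmod w)\<^sup>2) / (cmod (of_real \<rho> * cis t - w))\<^sup>2"

lemma circle_point_neq:
  assumes "0 \<le> \<rho>" "cmod w < \<rho>"
  shows "of_real \<rho> * cis t \<noteq> w"
  using assms by (auto simp: norm_mult)

lemma poisson_kernel_pos:
  assumes "cmod w < \<rho>"
  shows "0 < poisson_kernel \<rho> w t"
proof -
  have "0 \<le> \<rho>" using assms norm_ge_zero[of w] by linarith
  moreover have "(cmod w)\<^sup>2 < \<rho>\<^sup>2" using assms by (intro power_strict_mono) auto
  ultimately show ?thesis using circle_point_neq[OF _ assms, of t] by (auto simp: poisson_kernel_def)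
qed

lemma continuous_on_poisson_kernel:
  assumes "cmod w < \<rho>"
  shows "continuous_on S (poisson_kernel \<rho> w)"
proof -
  have "0 \<le> \<rho>" using assms norm_ge_zero[of w] by linarith
  from circle_point_neq[OF this assms] show ?thesis
  unfolding poisson_kernel_def by (intro continuous_intros) auto
qed

text \<open>The quotient is the Herglotz kernel, holomorphic in \<open>w\<close>; it turns means of
  the kernel in the variable \<open>w\<close> into mean values of a holomorphic function.\<close>

lemma poisson_kernel_eq_Re:
  assumes "cmod w < \<rho>"
  shows "poisson_kernel \<rho> w t = Re ((of_real \<rho> * cis t + w) / (of_real \<rho> * cis t - w))"
proof -
  define z where "z = of_real \<rho> * cis t"
  have "0 \<le> \<rho>" using assms norm_ge_zero[of w] by linarith
  then have z: "(cmod z)\<^sup>2 = \<rho>\<^sup>2" by (simp add: z_def norm_mult)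
  have "Re ((z + w) / (z - w)) = Re ((z + w) * cnj (z - w)) / (cmod (z - w))\<^sup>2"
    by (simp add: Re_divide cmod_power2 field_simps)
  also have "Re ((z + w) * cnj (z - w)) = (cmod z)\<^sup>2 - (cmod w)\<^sup>2"
    by (simp only: cmod_power2) (simp add: power2_eq_square algebra_simps)
  finally show ?thesis using z by (simp add: poisson_kernel_def z_def)
qed

lemma poisson_formula:
  assumes f: "f holomorphic_on unit_disc" and w: "cmod w < \<rho>" and "\<rho> < 1"
  shows "((\<lambda>t. of_real (poisson_kernel \<rho> w t) * f (of_real \<rho> * cis t)) has_integral 2 * of_real pi * f w) {0..2*pi}"
proof -
  have \<rho>: "0 < \<rho>" using w norm_ge_zero[of w] by linarith
  \<comment> \<open>The extra factor is 1 at \<open>\<zeta> = w\<close>, so Cauchy's formula for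
    \<open>g\<close> still returns \<open>f w\<close>; on the circle, where
    \<open>\<rho>\<^sup>2\<close> equals \<open>z * cnj z\<close>, it turns the Cauchy kernel into
    the Poisson kernel.\<close>
  define g where "g \<zeta> = f \<zeta> * (of_real (\<rho>\<^sup>2 - (cmod w)\<^sup>2) / (of_real (\<rho>\<^sup>2) - cnj w * \<zeta>))" for \<zeta>
  have wlt: "(cmod w)\<^sup>2 < \<rho>\<^sup>2" using w by (intro power_strict_mono) auto
  have nz: "of_real (\<rho>\<^sup>2) - cnj w * \<zeta> \<noteq> 0" if "cmod \<zeta> \<le> \<rho>" for \<zeta>
  proof
    assume "of_real (\<rho>\<^sup>2) - cnj w * \<zeta> = 0"
    then have "cmod (of_real (\<rho>\<^sup>2)) = cmod (cnj w * \<zeta>)" by simp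
    moreover have "cmod w * cmod \<zeta> \<le> cmod w * \<rho>" using that by (intro mult_left_mono) auto
    moreover have "cmod w * \<rho> < \<rho> * \<rho>" using w \<rho> by auto
    ultimately show False by (simp add: norm_mult power2_eq_square)
  qed
  have "cball 0 \<rho> \<subseteq> unit_disc" using \<open>\<rho> < 1\<close> by auto
  then have "g holomorphic_on cball 0 \<rho>"
    unfolding g_def using nz by (intro holomorphic_intros holomorphic_on_subset[OF f]) auto
  from Cauchy_integral_circlepath_simple[OF this, of w] w
  have "((\<lambda>u. g u / (u - w)) has_contour_integral (2 * of_real pi * \<i> * g w)) (part_circlepath 0 \<rho> 0 (2*pi))"
    by (simp add: circlepath_def)
  then have "((\<lambda>t. g (of_real \<rho> * cis t) / (of_real \<rho> * cis t - w) * of_real \<rho> * \<i> * cis t) has_integral (2 * of_real pi * \<i> * g w)) {0..2*pi}"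
    by (subst (asm) has_contour_integral_part_circlepath_iff) auto
  then have "((\<lambda>t. - \<i> * (g (of_real \<rho> * cis t) / (of_real \<rho> * cis t - w) * of_real \<rho> * \<i> * cis t)) has_integral - \<i> * (2 * of_real pi * \<i> * g w)) {0..2*pi}"
    by (rule has_integral_mult_right)
  moreover have "g w = f w"
  proof -
    have "cnj w * w = of_real ((cmod w)\<^sup>2)" by (subst complex_norm_square) (rule mult.commute)
    then have "of_real (\<rho>\<^sup>2) - cnj w * w = of_real (\<rho>\<^sup>2 - (cmod w)\<^sup>2)" by (simp only: of_real_diff)
    then have "g w = f w * (of_real (\<rho>\<^sup>2 - (cmod w)\<^sup>2) / of_real (\<rho>\<^sup>2 - (cmod w)\<^sup>2))"
      unfolding g_def by (rule arg_cong)
    also have "\<dots> = f w" using wlt by (subst divide_self) (auto simp del: of_real_diff of_real_power)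
    finally show ?thesis .
  qed
  moreover have "- \<i> * (g (of_real \<rho> * cis t) / (of_real \<rho> * cis t - w) * of_real \<rho> * \<i> * cis t) =
     of_real (poisson_kernel \<rho> w t) * f (of_real \<rho> * cis t)" for t
  proof -
    define z where "z = of_real \<rho> * cis t"
    have zz: "of_real (\<rho>\<^sup>2) = z * cnj z"
      by (simp only: complex_norm_square[symmetric]) (simp add: z_def norm_mult)
    have "z \<noteq> w" using circle_point_neq[of \<rho> w t] \<rho> w by (simp add: z_def)
    have "z \<noteq> 0" using \<rho> by (simp add: z_def)
    have "- \<i> * (g z / (z - w) * z * \<i>) = g z * z / (z - w)" by (simp add: field_simps)
    also have "\<dots> = f z * of_real (\<rho>\<^sup>2 - (cmod w)\<^sup>2) / ((z - w) * cnj (z - w))"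
      unfolding g_def zz using \<open>z \<noteq> w\<close> \<open>z \<noteq> 0\<close>
      by (simp add: divide_simps) (simp add: algebra_simps)
    also have "(z - w) * cnj (z - w) = of_real ((cmod (z - w))\<^sup>2)" by (rule complex_norm_square[symmetric])
    finally show ?thesis by (simp add: z_def poisson_kernel_def algebra_simps)
  qed
  moreover have "- \<i> * (2 * of_real pi * \<i> * f w) = 2 * of_real pi * f w" by simp
  ultimately show ?thesis by (simp only:)
qed

lemma poisson_kernel_has_integral:
  assumes "cmod w < \<rho>" and "\<rho> < 1"
  shows "(poisson_kernel \<rho> w has_integral 2 * pi) {0..2*pi}"
  using has_integral_Re[OF poisson_formula[of "\<lambda>_. 1", OF _ assms]] by simp

text \<open>Jensen's inequality for the kernel as a measure: the tangent to the power at
  \<open>A = cmod (f w)\<close> is integrated, and its linear part has nonnegative integral because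
  \<open>A\<close> is at most the Poisson mean of the modulus.\<close>

lemma poisson_jensen:
  assumes f: "f holomorphic_on unit_disc" and w: "cmod w < \<rho>" and "\<rho> < 1" and p: "1 \<le> p"
  shows "2 * pi * cmod (f w) powr p \<le> integral {0..2*pi} (\<lambda>t. poisson_kernel \<rho> w t * cmod (f (of_real \<rho> * cis t)) powr p)"
proof -
  have \<rho>: "0 \<le> \<rho>" using w norm_ge_zero[of w] by linarith
  have cf: "continuous_on unit_disc f" using f by (rule holomorphic_on_imp_continuous_on)
  note ci = continuous_on_poisson_kernel[OF w] continuous_on_circle[OF cf \<rho> \<open>\<rho> < 1\<close>]
     continuous_on_circle_powr[OF cf \<rho> \<open>\<rho> < 1\<close>]
  have int1: "(\<lambda>t. poisson_kernel \<rho> w t * cmod (f (of_real \<rho> * cis t)) powr p) integrable_on {0..2*pi}"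
    using p by (intro integrable_continuous_real continuous_intros ci) auto
  have int2: "(\<lambda>t. poisson_kernel \<rho> w t * cmod (f (of_real \<rho> * cis t))) integrable_on {0..2*pi}"
    by (intro integrable_continuous_real continuous_intros ci)
  show ?thesis
  proof (cases "f w = 0")
    case True
    have "0 \<le> integral {0..2*pi} (\<lambda>t. poisson_kernel \<rho> w t * cmod (f (of_real \<rho> * cis t)) powr p)"
      using poisson_kernel_pos[OF w] by (intro Henstock_Kurzweil_Integration.integral_nonneg int1 mult_nonneg_nonneg) (auto intro: less_imp_le)
    then show ?thesis using True by simp
  next
    case False
    define A where "A = cmod (f w)"
    have A: "A > 0" using False by (simp add: A_def)
    have "norm (2 * of_real pi * f w) \<le> integral {0..2*pi} (\<lambda>t. poisson_kernel \<rho> w t * cmod (f (of_real \<rho> * cis t)))"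
      unfolding integral_unique[OF poisson_formula[OF f w \<open>\<rho> < 1\<close>], symmetric]
      using poisson_kernel_pos[OF w] less_imp_le
      by (intro integral_norm_bound_integral int2 has_integral_integrable[OF poisson_formula[OF f w \<open>\<rho> < 1\<close>]])
        (auto simp: norm_mult abs_of_pos)
    then have *: "2 * pi * A \<le> integral {0..2*pi} (\<lambda>t. poisson_kernel \<rho> w t * cmod (f (of_real \<rho> * cis t)))"
      by (simp add: norm_mult A_def)
    let ?B = "integral {0..2*pi} (\<lambda>t. poisson_kernel \<rho> w t * cmod (f (of_real \<rho> * cis t)))"
    let ?c = "p * A powr (p - 1)"
    have "((\<lambda>t. (A powr p - ?c * A) * poisson_kernel \<rho> w t + ?c * (poisson_kernel \<rho> w t * cmod (f (of_real \<rho> * cis t))))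
       has_integral (A powr p - ?c * A) * (2 * pi) + ?c * ?B) {0..2*pi}"
      by (intro has_integral_add has_integral_mult_right poisson_kernel_has_integral[OF w \<open>\<rho> < 1\<close>] integrable_integral int2)
    then have "(A powr p - ?c * A) * (2 * pi) + ?c * ?B \<le> integral {0..2*pi} (\<lambda>t. poisson_kernel \<rho> w t * cmod (f (of_real \<rho> * cis t)) powr p)"
    proof (rule has_integral_le[OF _ integrable_integral[OF int1]])
      fix t
      have "poisson_kernel \<rho> w t * (A powr p + ?c * (cmod (f (of_real \<rho> * cis t)) - A)) \<le>
        poisson_kernel \<rho> w t * cmod (f (of_real \<rho> * cis t)) powr p"
        using poisson_kernel_pos[OF w, of t] A p by (intro mult_left_mono powr_tangent_le) auto
      then show "(A powr p - ?c * A) * poisson_kernel \<rho> w t + ?c * (poisson_kernel \<rho> w t * cmod (f (of_real \<rho> * cis t)))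
        \<le> poisson_kernel \<rho> w t * cmod (f (of_real \<rho> * cis t)) powr p" by (simp add: algebra_simps)
    qed
    moreover have "?c * (2 * pi * A) \<le> ?c * ?B" using * p by (intro mult_left_mono) auto
    ultimately show ?thesis unfolding A_def[symmetric] by (simp add: algebra_simps)
  qed
qed


lemma poisson_kernel_le:
  assumes "cmod w < \<rho>"
  shows "poisson_kernel \<rho> w t \<le> (\<rho> + cmod w) / (\<rho> - cmod w)"
proof -
  have \<rho>: "0 \<le> \<rho>" using assms norm_ge_zero[of w] by linarith
  have "\<rho> - cmod w \<le> cmod (of_real \<rho> * cis t - w)"
    using norm_triangle_ineq2[of "of_real \<rho> * cis t" w] \<rho> by (simp add: norm_mult)
  then have "(\<rho> - cmod w)\<^sup>2 \<le> (cmod (of_real \<rho> * cis t - w))\<^sup>2"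
    using assms by (intro power_mono) auto
  then have "poisson_kernel \<rho> w t \<le> (\<rho>\<^sup>2 - (cmod w)\<^sup>2) / (\<rho> - cmod w)\<^sup>2"
    unfolding poisson_kernel_def using assms \<rho> by (intro divide_left_mono) (auto intro!: power_mono mult_pos_pos simp: circle_point_neq)
  also have "\<dots> = (\<rho> + cmod w) / (\<rho> - cmod w)"
  proof -
    have "\<rho>\<^sup>2 - (cmod w)\<^sup>2 = (\<rho> - cmod w) * (\<rho> + cmod w)"
      by (simp only: power2_eq_square) (simp only: algebra_simps)
    then show ?thesis using assms by (simp add: power2_eq_square)
  qed
  finally show ?thesis .
qed

lemma cmod_powr_le_hardy_mean:
  assumes f: "f holomorphic_on unit_disc" and w: "cmod w < \<rho>" and "\<rho> < 1" and p: "1 \<le> p"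
  shows "2 * pi * cmod (f w) powr p \<le> (\<rho> + cmod w) / (\<rho> - cmod w) * hardy_mean p f \<rho>"
proof -
  have \<rho>: "0 \<le> \<rho>" using w norm_ge_zero[of w] by linarith
  have cf: "continuous_on unit_disc f" using f by (rule holomorphic_on_imp_continuous_on)
  have "2 * pi * cmod (f w) powr p \<le> integral {0..2*pi} (\<lambda>t. poisson_kernel \<rho> w t * cmod (f (of_real \<rho> * cis t)) powr p)"
    by (rule poisson_jensen[OF f w \<open>\<rho> < 1\<close> p])
  also have "\<dots> \<le> integral {0..2*pi} (\<lambda>t. (\<rho> + cmod w) / (\<rho> - cmod w) * cmod (f (of_real \<rho> * cis t)) powr p)"
    using p by (intro integral_le integrable_continuous_real continuous_intros continuous_on_poisson_kernel[OF w]
       continuous_on_circle_powr[OF cf \<rho> \<open>\<rho> < 1\<close>] mult_right_mono poisson_kernel_le[OF w]) auto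
  also have "\<dots> = (\<rho> + cmod w) / (\<rho> - cmod w) * hardy_mean p f \<rho>"
    by (simp add: hardy_mean_def)
  finally show ?thesis .
qed

lemma Re_of_real_mult_left: "Re (of_real x * z) = x * Re z"
  by simp

text \<open>Littlewood subordination: for fixed \<open>t\<close> the Poisson kernel is the real part of a holomorphic
  function of \<open>w\<close>, so its mean over the circle of radius \<open>r\<close>, taken along \<open>\<phi>\<close>, is its value at \<open>\<phi> 0\<close>.\<close>

lemma hardy_mean_comp_le:
  assumes f: "f holomorphic_on unit_disc" and phi: "\<phi> holomorphic_on unit_disc"
    and r: "0 < r" and r\<phi>: "\<And>z. cmod z \<le> r \<Longrightarrow> cmod (\<phi> z) < \<rho>" and "r < 1" "\<rho> < 1" and p: "1 \<le> p"
  shows "hardy_mean p (f \<circ> \<phi>) r \<le> (\<rho> + cmod (\<phi> 0)) / (\<rho> - cmod (\<phi> 0)) * hardy_mean p f \<rho>"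
proof -
  have \<phi>0: "cmod (\<phi> 0) < \<rho>" using r\<phi>[of 0] r by simp
  then have \<rho>: "0 < \<rho>" using norm_ge_zero[of "\<phi> 0"] by linarith
  have cf: "continuous_on unit_disc f" using f by (rule holomorphic_on_imp_continuous_on)
  have c\<phi>: "continuous_on unit_disc \<phi>" using phi by (rule holomorphic_on_imp_continuous_on)
  define u where "u s = of_real r * cis s" for s
  have u: "cmod (u s) \<le> r" for s using r by (simp add: u_def norm_mult)
  have cu: "continuous_on S (\<lambda>s. \<phi> (u s))" for S
    unfolding u_def using r \<open>r < 1\<close> by (intro continuous_on_circle c\<phi>) auto
  have cP: "continuous_on S (\<lambda>x. poisson_kernel \<rho> (\<phi> (u (g x))) (k x))"
    if "continuous_on S g" "continuous_on S k" for S :: "'b::topological_space set" and g k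
  proof -
    have "of_real \<rho> * cis (k x) - \<phi> (u (g x)) \<noteq> 0" for x
      using circle_point_neq[OF _ r\<phi>[OF u]] \<rho> by auto
    moreover have "continuous_on S (\<lambda>x. \<phi> (u (g x)))"
      by (rule continuous_on_compose2[OF cu that(1)]) auto
    ultimately show ?thesis unfolding poisson_kernel_def using that
      by (intro continuous_intros) auto
  qed
  have cF: "continuous_on S (\<lambda>x. cmod (f (of_real \<rho> * cis (k x))) powr p)"
    if "continuous_on S k" for S :: "'b::topological_space set" and k
    by (rule continuous_on_compose2[OF continuous_on_circle_powr[OF cf _ \<open>\<rho> < 1\<close>, of p UNIV] that])
      (use \<rho> p in auto)
  have meanP: "((\<lambda>s. poisson_kernel \<rho> (\<phi> (u s)) t) has_integral 2 * pi * poisson_kernel \<rho> (\<phi> 0) t) {0..2*pi}" for t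
  proof -
    define G where "G w = (of_real \<rho> * cis t + w) / (of_real \<rho> * cis t - w)" for w :: complex
    have "G \<circ> \<phi> holomorphic_on cball 0 r"
    proof -
      have "\<phi> holomorphic_on cball 0 r" by (rule holomorphic_on_subset[OF phi]) (use \<open>r < 1\<close> in auto)
      moreover have "of_real \<rho> * cis t - \<phi> z \<noteq> 0" if "z \<in> cball 0 r" for z
        using circle_point_neq[OF _ r\<phi>, of z t] \<rho> that by auto
      ultimately show ?thesis unfolding o_def G_def by (intro holomorphic_intros) auto
    qed
    from Cauchy_integral_circlepath_simple[OF this, of 0] r
    have "((\<lambda>u. (G \<circ> \<phi>) u / (u - 0)) has_contour_integral (2 * of_real pi * \<i> * (G \<circ> \<phi>) 0)) (part_circlepath 0 r 0 (2*pi))"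
      by (simp add: circlepath_def)
    then have "((\<lambda>s. G (\<phi> (u s)) / (u s) * of_real r * \<i> * cis s) has_integral (2 * of_real pi * \<i> * G (\<phi> 0))) {0..2*pi}"
      by (subst (asm) has_contour_integral_part_circlepath_iff) (auto simp: u_def)
    then have "((\<lambda>s. - \<i> * (G (\<phi> (u s)) / (u s) * of_real r * \<i> * cis s)) has_integral - \<i> * (2 * of_real pi * \<i> * G (\<phi> 0))) {0..2*pi}"
      by (rule has_integral_mult_right)
    then have "((\<lambda>s. G (\<phi> (u s))) has_integral (of_real (2 * pi) * G (\<phi> 0))) {0..2*pi}"
      using r by (simp add: u_def field_simps)
    from has_integral_Re[OF this] have "((\<lambda>s. Re (G (\<phi> (u s)))) has_integral (2 * pi * Re (G (\<phi> 0)))) {0..2*pi}"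
      by (simp only: Re_of_real_mult_left)
    then show ?thesis
      using r\<phi>[OF u] \<phi>0 by (simp add: poisson_kernel_eq_Re G_def)
  qed
  have "2 * pi * hardy_mean p (f \<circ> \<phi>) r = integral {0..2*pi} (\<lambda>s. 2 * pi * cmod (f (\<phi> (u s))) powr p)"
    by (simp add: hardy_mean_def u_def)
  also have "\<dots> \<le> integral {0..2*pi} (\<lambda>s. integral {0..2*pi} (\<lambda>t. poisson_kernel \<rho> (\<phi> (u s)) t * cmod (f (of_real \<rho> * cis t)) powr p))"
  proof (intro integral_le poisson_jensen f r\<phi> u \<open>\<rho> < 1\<close> p)
    have "cmod (\<phi> (u s)) < 1" for s using r\<phi>[OF u, of s] \<open>\<rho> < 1\<close> by simp
    then show "(\<lambda>s. 2 * pi * cmod (f (\<phi> (u s))) powr p) integrable_on {0..2*pi}"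
      using p by (intro integrable_continuous_real continuous_intros continuous_on_powr' continuous_on_compose2[OF cf cu]) auto
    have "continuous_on (cbox 0 (2*pi)) (\<lambda>s. integral (cbox 0 (2*pi)) (\<lambda>t. poisson_kernel \<rho> (\<phi> (u s)) t * cmod (f (of_real \<rho> * cis t)) powr p))"
      by (rule integral_continuous_on_param) (auto intro!: continuous_intros cP cF simp: case_prod_beta)
    then show "(\<lambda>s. integral {0..2*pi} (\<lambda>t. poisson_kernel \<rho> (\<phi> (u s)) t * cmod (f (of_real \<rho> * cis t)) powr p)) integrable_on {0..2*pi}"
      by (intro integrable_continuous_real) (simp add: cbox_interval)
  qed
  \<comment> \<open>After the exchange the inner integral is the mean of the kernel along
    \<open>\<phi>\<close>, evaluated by \<open>meanP\<close>.\<close>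
  also have "\<dots> = integral {0..2*pi} (\<lambda>t. integral {0..2*pi} (\<lambda>s. poisson_kernel \<rho> (\<phi> (u s)) t * cmod (f (of_real \<rho> * cis t)) powr p))"
    unfolding cbox_interval[symmetric]
    by (rule integral_swap_continuous) (auto intro!: continuous_intros cP cF simp: case_prod_beta)
  also have "\<dots> = integral {0..2*pi} (\<lambda>t. 2 * pi * poisson_kernel \<rho> (\<phi> 0) t * cmod (f (of_real \<rho> * cis t)) powr p)"
    using integral_unique[OF meanP] by simp
  also have "\<dots> \<le> integral {0..2*pi} (\<lambda>t. 2 * pi * ((\<rho> + cmod (\<phi> 0)) / (\<rho> - cmod (\<phi> 0))) * cmod (f (of_real \<rho> * cis t)) powr p)"
  proof (rule integral_le)
    show "(\<lambda>t. 2 * pi * poisson_kernel \<rho> (\<phi> 0) t * cmod (f (of_real \<rho> * cis t)) powr p) integrable_on {0..2*pi}"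
      by (intro integrable_continuous_real continuous_on_mult continuous_on_const continuous_on_poisson_kernel[OF \<phi>0] cF continuous_on_id)
    show "(\<lambda>t. 2 * pi * ((\<rho> + cmod (\<phi> 0)) / (\<rho> - cmod (\<phi> 0))) * cmod (f (of_real \<rho> * cis t)) powr p) integrable_on {0..2*pi}"
      by (intro integrable_continuous_real continuous_on_mult continuous_on_const cF continuous_on_id)
  qed (intro mult_right_mono mult_left_mono poisson_kernel_le[OF \<phi>0], auto)
  also have "\<dots> = 2 * pi * ((\<rho> + cmod (\<phi> 0)) / (\<rho> - cmod (\<phi> 0)) * hardy_mean p f \<rho>)"
    by (simp add: hardy_mean_def)
  finally show ?thesis by (subst (asm) mult_le_cancel_left_pos) auto
qed

text \<open>Subordination to the identity map, whose value 0 at 0 makes the factor equal to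
  1.\<close>

lemma hardy_mean_mono:
  assumes f: "f holomorphic_on unit_disc" and "0 < r" "r \<le> \<rho>" "\<rho> < 1" and p: "1 \<le> p"
  shows "hardy_mean p f r \<le> hardy_mean p f \<rho>"
proof (cases "r = \<rho>")
  case False
  then show ?thesis
    using hardy_mean_comp_le[of f "\<lambda>z. z" r \<rho> p] assms by (auto simp: o_def)
qed simp

section \<open>The Banach space structure of Hardy spaces\<close>

lemma hardy_spaceD:
  assumes "f \<in> hardy_space p"
  shows "f holomorphic_on unit_disc" "z \<notin> unit_disc \<Longrightarrow> f z = 0" "bdd_above (hardy_mean p f ` {0<..<1})"
    "continuous_on unit_disc f"
  using assms unfolding hardy_space_def by (auto intro: holomorphic_on_imp_continuous_on)

lemma hardy_norm_nonneg: "0 \<le> hardy_norm p f"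
  by (simp add: hardy_norm_def)

lemma hardy_mean_le_norm:
  assumes "f \<in> hardy_space p" "1 \<le> p" "0 < r" "r < 1"
  shows "hardy_mean p f r \<le> hardy_norm p f powr p"
proof -
  have "hardy_mean p f r \<le> (SUP r\<in>{0<..<1}. hardy_mean p f r)"
    using assms hardy_spaceD(3)[OF assms(1)] by (intro cSUP_upper) auto
  moreover have "0 \<le> hardy_mean p f r"
    using assms hardy_spaceD(4)[OF assms(1)] by (intro hardy_mean_nonneg) auto
  ultimately show ?thesis using assms unfolding hardy_norm_def by (simp add: powr_powr)
qed

lemma hardy_norm_le:
  assumes "\<And>r. 0 < r \<Longrightarrow> r < 1 \<Longrightarrow> hardy_mean p f r \<le> a powr p" "0 \<le> a" "1 \<le> p"
    and f: "f holomorphic_on unit_disc"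
  shows "hardy_norm p f \<le> a"
proof -
  have "bdd_above (hardy_mean p f ` {0<..<1})" using assms(1) by (intro bdd_aboveI[of _ "a powr p"]) auto
  \<comment> \<open>The radius 1/2 only serves to show that the supremum is nonnegative, as
    monotonicity of \<open>powr\<close> requires.\<close>
  then have "hardy_mean p f (1/2) \<le> (SUP r\<in>{0<..<1}. hardy_mean p f r)"
    by (intro cSUP_upper) auto
  moreover have "0 \<le> hardy_mean p f (1/2)"
    using assms holomorphic_on_imp_continuous_on[OF f] by (intro hardy_mean_nonneg) auto
  ultimately have "0 \<le> (SUP r\<in>{0<..<1}. hardy_mean p f r)" by linarith
  moreover have "(SUP r\<in>{0<..<1}. hardy_mean p f r) \<le> a powr p"
    using assms(1) by (intro cSUP_least) auto
  ultimately have "hardy_norm p f \<le> (a powr p) powr (1/p)"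
    unfolding hardy_norm_def using \<open>1 \<le> p\<close> by (intro powr_mono2) auto
  then show ?thesis using assms by (simp add: powr_powr)
qed

lemma hardy_space_memI:
  assumes "f holomorphic_on unit_disc" "\<And>z. z \<notin> unit_disc \<Longrightarrow> f z = 0"
    "\<And>r. 0 < r \<Longrightarrow> r < 1 \<Longrightarrow> hardy_mean p f r \<le> K"
  shows "f \<in> hardy_space p"
  using assms unfolding hardy_space_def by (auto intro!: bdd_aboveI[of _ K])

text \<open>Minkowski's inequality by convexity: the sum divided by \<open>a + b\<close> is bounded
  by the combination of \<open>\<bar>f\<bar> / a\<close> and \<open>\<bar>g\<bar> / b\<close> with
  weights \<open>a / (a + b)\<close> and \<open>b / (a + b)\<close>. Dividing by the bounds is why
  they have to be positive.\<close>

lemma hardy_mean_add_le: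
  assumes f: "continuous_on unit_disc f" and g: "continuous_on unit_disc g" and r: "0 \<le> r" "r < 1"
    and p: "1 \<le> p"
    and a: "hardy_mean p f r \<le> a powr p" "0 < a" and b: "hardy_mean p g r \<le> b powr p" "0 < b"
  shows "hardy_mean p (\<lambda>z. f z + g z) r \<le> (a + b) powr p"
proof -
  define t where "t = a / (a + b)"
  have t: "0 \<le> t" "t \<le> 1" "1 - t = b / (a + b)" using a b by (auto simp: t_def field_simps)
  let ?z = "\<lambda>s. of_real r * cis s"
  have p0: "0 < p" using p by simp
  note F = hardy_mean_integrable[OF f r p0] and G = hardy_mean_integrable[OF g r p0]
  have "hardy_mean p (\<lambda>z. f z + g z) r \<le> integral {0..2*pi} (\<lambda>s. (a + b) powr p * (t / a powr p * cmod (f (?z s)) powr p + (1 - t) / b powr p * cmod (g (?z s)) powr p))"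
    unfolding hardy_mean_def
  proof (rule integral_le)
    show "(\<lambda>s. cmod (f (?z s) + g (?z s)) powr p) integrable_on {0..2*pi}"
      by (rule hardy_mean_integrable[OF continuous_on_add[OF f g] r p0])
    show "(\<lambda>s. (a + b) powr p * (t / a powr p * cmod (f (?z s)) powr p + (1 - t) / b powr p * cmod (g (?z s)) powr p)) integrable_on {0..2*pi}"
      using integrable_on_mult_right[OF integrable_add[OF integrable_on_mult_right[OF F] integrable_on_mult_right[OF G]]] .
    fix s
    let ?x = "cmod (f (?z s))" and ?y = "cmod (g (?z s))"
    have "cmod (f (?z s) + g (?z s)) powr p \<le> (?x + ?y) powr p"
      using p by (intro powr_mono2 norm_triangle_ineq) auto
    also have "?x + ?y = (a + b) * (t * (?x / a) + (1 - t) * (?y / b))"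
    proof -
      have "(a + b) * t = a" "(a + b) * (1 - t) = b" using a b unfolding t(3) by (auto simp: t_def)
      moreover have "(a + b) * (t * (?x / a) + (1 - t) * (?y / b)) = ((a + b) * t) * (?x / a) + ((a + b) * (1 - t)) * (?y / b)"
        by (simp only: distrib_left mult.assoc)
      ultimately show ?thesis using a b by simp
    qed
    also have "\<dots> powr p = (a + b) powr p * (t * (?x / a) + (1 - t) * (?y / b)) powr p"
      by (rule powr_mult)
    also have "\<dots> \<le> (a + b) powr p * (t * (?x / a) powr p + (1 - t) * (?y / b) powr p)"
      using a b t p by (intro mult_left_mono powr_convex_combination_le) auto
    finally show "cmod (f (?z s) + g (?z s)) powr p \<le> (a + b) powr p * (t / a powr p * ?x powr p + (1 - t) / b powr p * ?y powr p)"
      using a b by (simp add: powr_divide)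
  qed
  also have "\<dots> = (a + b) powr p * (t / a powr p * hardy_mean p f r + (1 - t) / b powr p * hardy_mean p g r)"
    unfolding hardy_mean_def
    by (rule integral_unique[OF has_integral_mult_right[OF has_integral_add[OF
          has_integral_mult_right[OF integrable_integral[OF F]] has_integral_mult_right[OF integrable_integral[OF G]]]]])
  also have "\<dots> \<le> (a + b) powr p * (t / a powr p * a powr p + (1 - t) / b powr p * b powr p)"
    using a b t by (intro mult_left_mono add_mono) auto
  also have "\<dots> = (a + b) powr p" using a b by simp
  finally show ?thesis .
qed

lemma hardy_add:
  assumes f: "f \<in> hardy_space p" and g: "g \<in> hardy_space p" and p: "1 \<le> p"
  shows "(\<lambda>z. f z + g z) \<in> hardy_space p"
    and "hardy_norm p (\<lambda>z. f z + g z) \<le> hardy_norm p f + hardy_norm p g"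
proof -
  have hol: "(\<lambda>z. f z + g z) holomorphic_on unit_disc"
    by (intro holomorphic_intros hardy_spaceD[OF f] hardy_spaceD[OF g])
  \<comment> \<open>The slack \<open>e\<close> keeps both bounds positive when a norm is 0; it is
    removed at the end.\<close>
  have *: "hardy_mean p (\<lambda>z. f z + g z) r \<le> ((hardy_norm p f + e) + (hardy_norm p g + e)) powr p"
    if "0 < r" "r < 1" "0 < e" for r e
  proof (rule hardy_mean_add_le)
    have "hardy_norm p f powr p \<le> (hardy_norm p f + e) powr p" "hardy_norm p g powr p \<le> (hardy_norm p g + e) powr p"
      using p that hardy_norm_nonneg[of p f] hardy_norm_nonneg[of p g] by (auto intro!: powr_mono2)
    then show "hardy_mean p f r \<le> (hardy_norm p f + e) powr p" "hardy_mean p g r \<le> (hardy_norm p g + e) powr p"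
      using hardy_mean_le_norm[OF f p that(1,2)] hardy_mean_le_norm[OF g p that(1,2)] by linarith+
  qed (use that p hardy_norm_nonneg[of p f] hardy_norm_nonneg[of p g] hardy_spaceD[OF f] hardy_spaceD[OF g] in auto)
  show "(\<lambda>z. f z + g z) \<in> hardy_space p"
    by (rule hardy_space_memI[OF hol _ *[where e=1]]) (auto simp: hardy_spaceD(2)[OF f] hardy_spaceD(2)[OF g])
  show "hardy_norm p (\<lambda>z. f z + g z) \<le> hardy_norm p f + hardy_norm p g"
  proof (rule field_le_epsilon)
    fix e :: real assume "0 < e"
    then show "hardy_norm p (\<lambda>z. f z + g z) \<le> hardy_norm p f + hardy_norm p g + e"
      using *[where e="e/2"] p hol hardy_norm_nonneg[of p f] hardy_norm_nonneg[of p g]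
      by (intro hardy_norm_le) (auto simp: algebra_simps)
  qed
qed

lemma hardy_mean_mult_const:
  "hardy_mean p (\<lambda>z. c * f z) r = cmod c powr p * hardy_mean p f r"
  by (simp add: hardy_mean_def norm_mult powr_mult)

lemma hardy_scale:
  assumes f: "f \<in> hardy_space p" and p: "1 \<le> p"
  shows "(\<lambda>z. c * f z) \<in> hardy_space p"
    and "hardy_norm p (\<lambda>z. c * f z) = cmod c * hardy_norm p f"
proof -
  have hol: "(\<lambda>z. c * f z) holomorphic_on unit_disc" for c
    by (intro holomorphic_intros hardy_spaceD[OF f])
  have *: "hardy_mean p (\<lambda>z. c * f z) r \<le> (cmod c * hardy_norm p f) powr p" if "0 < r" "r < 1" for r c
    using hardy_mean_le_norm[OF f p that] hardy_norm_nonneg[of p f]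
    by (simp add: hardy_mean_mult_const powr_mult mult_left_mono)
  show mem: "(\<lambda>z. c * f z) \<in> hardy_space p" for c
    by (rule hardy_space_memI[OF hol _ *]) (auto simp: hardy_spaceD(2)[OF f])
  have "hardy_norm p (\<lambda>z. c * f z) \<le> cmod c * hardy_norm p f" for c
    using * p hol hardy_norm_nonneg[of p f] by (intro hardy_norm_le) auto
  moreover have "cmod c * hardy_norm p f \<le> hardy_norm p (\<lambda>z. c * f z)"
  proof (cases "c = 0")
    case True then show ?thesis by (simp add: hardy_norm_nonneg)
  next
    case False
    have "hardy_mean p f r \<le> (hardy_norm p (\<lambda>z. c * f z) / cmod c) powr p" if "0 < r" "r < 1" for r
      using hardy_mean_le_norm[OF mem[of c] p that] hardy_norm_nonneg[of p "\<lambda>z. c * f z"] False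
      by (simp add: hardy_mean_mult_const powr_divide field_simps)
    then have "hardy_norm p f \<le> hardy_norm p (\<lambda>z. c * f z) / cmod c"
      using p hardy_spaceD(1)[OF f] hardy_norm_nonneg by (intro hardy_norm_le) auto
    then show ?thesis using False by (simp add: field_simps)
  qed
  ultimately show "hardy_norm p (\<lambda>z. c * f z) = cmod c * hardy_norm p f" by (metis order_antisym)
qed

lemma hardy_diff:
  assumes f: "f \<in> hardy_space p" and g: "g \<in> hardy_space p" and p: "1 \<le> p"
  shows "(\<lambda>z. f z - g z) \<in> hardy_space p"
    and "hardy_norm p (\<lambda>z. f z - g z) \<le> hardy_norm p f + hardy_norm p g"
  using hardy_add[OF f hardy_scale(1)[OF g p, of "-1"] p] hardy_scale(2)[OF g p, of "-1"] by simp_all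

lemma zero_in_hardy_space: "1 \<le> p \<Longrightarrow> (\<lambda>_. 0) \<in> hardy_space p"
  by (rule hardy_space_memI[where K=0]) (auto simp: hardy_mean_def)

lemma hardy_norm_zero: "1 \<le> p \<Longrightarrow> hardy_norm p (\<lambda>_. 0) = 0"
  using hardy_scale(2)[of "\<lambda>_. 0" p 0] zero_in_hardy_space by simp

text \<open>Evaluation at points is bounded, uniformly on compact subsets of the disc; this makes
  norm-bounded sets normal families.\<close>

lemma cmod_le_hardy_norm:
  assumes f: "f \<in> hardy_space p" and p: "1 \<le> p" and w: "cmod w \<le> s" "s < 1"
  shows "cmod (f w) \<le> (2 / (1 - s)) powr (1/p) * hardy_norm p f"
proof -
  have s: "0 \<le> s" using w norm_ge_zero[of w] by linarith
  \<comment> \<open>Halfway between \<open>s\<close> and 1, so that \<open>\<rho> - s\<close> is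
    \<open>(1 - s) / 2\<close> and the circle still lies inside the disc.\<close>
  define \<rho> where "\<rho> = (1 + s) / 2"
  have \<rho>: "cmod w < \<rho>" "\<rho> < 1" "0 < \<rho>" using w s by (auto simp: \<rho>_def)
  have "(\<rho> + cmod w) / (\<rho> - cmod w) \<le> 2 / (\<rho> - s)"
  proof (rule frac_le)
    show "\<rho> + cmod w \<le> 2" "\<rho> - s \<le> \<rho> - cmod w" using \<rho> w by linarith+
    show "0 < \<rho> - s" using w by (simp add: \<rho>_def field_simps)
  qed auto
  also have "\<dots> = 4 / (1 - s)" by (simp add: \<rho>_def field_simps)
  finally have "2 * pi * cmod (f w) powr p \<le> 4 / (1 - s) * hardy_norm p f powr p"
    using cmod_powr_le_hardy_mean[OF hardy_spaceD(1)[OF f] \<rho>(1,2) p] hardy_mean_le_norm[OF f p \<rho>(3,2)]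
      hardy_mean_nonneg[OF hardy_spaceD(4)[OF f] _ \<rho>(2), of p] \<rho> p w
    by (elim order_trans) (intro mult_mono, auto)
  then have "pi * cmod (f w) powr p \<le> 2 / (1 - s) * hardy_norm p f powr p" by simp
  moreover have "1 * cmod (f w) powr p \<le> pi * cmod (f w) powr p"
    using pi_ge_two by (intro mult_right_mono) auto
  ultimately have "cmod (f w) powr p \<le> 2 / (1 - s) * hardy_norm p f powr p" by linarith
  then have "(cmod (f w) powr p) powr (1/p) \<le> (2 / (1 - s) * hardy_norm p f powr p) powr (1/p)"
    using p by (intro powr_mono2) auto
  also have "\<dots> = (2 / (1 - s)) powr (1/p) * (hardy_norm p f powr p) powr (1/p)" by (rule powr_mult)
  finally show ?thesis using p hardy_norm_nonneg[of p f] by (simp add: powr_powr)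
qed

lemma hardy_norm_eq_0:
  assumes f: "f \<in> hardy_space p" and p: "1 \<le> p"
  shows "hardy_norm p f = 0 \<longleftrightarrow> f = (\<lambda>_. 0)"
proof
  assume "hardy_norm p f = 0"
  then have "f z = 0" for z
    using cmod_le_hardy_norm[OF f p order_refl, of z] hardy_spaceD(2)[OF f, of z]
    by (cases "z \<in> unit_disc") auto
  then show "f = (\<lambda>_. 0)" by auto
qed (use p hardy_norm_zero in auto)

lemma hardy_metric_space:
  assumes p: "1 \<le> p"
  shows "Metric_space (hardy_space p) (\<lambda>f g. hardy_norm p (\<lambda>x. f x - g x))"
proof
  fix f g h
  show "0 \<le> hardy_norm p (\<lambda>x. f x - g x)" by (rule hardy_norm_nonneg)
  have *: "cmod (-1) * hardy_norm p k = hardy_norm p (\<lambda>x. - k x)" if "k \<in> hardy_space p" for k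
    using hardy_scale(2)[OF that p, of "-1"] by simp
  have **: "hardy_mean p (\<lambda>x. f x - g x) r = hardy_mean p (\<lambda>x. g x - f x) r" for r
    by (simp add: hardy_mean_def norm_minus_commute)
  show "hardy_norm p (\<lambda>x. f x - g x) = hardy_norm p (\<lambda>x. g x - f x)"
    unfolding hardy_norm_def ** ..
  assume f: "f \<in> hardy_space p" and g: "g \<in> hardy_space p"
  show "hardy_norm p (\<lambda>x. f x - g x) = 0 \<longleftrightarrow> f = g"
    unfolding hardy_norm_eq_0[OF hardy_diff(1)[OF f g p] p] by (auto simp: fun_eq_iff)
  assume h: "h \<in> hardy_space p"
  show "hardy_norm p (\<lambda>x. f x - h x) \<le> hardy_norm p (\<lambda>x. f x - g x) + hardy_norm p (\<lambda>x. g x - h x)"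
    using hardy_add(2)[OF hardy_diff(1)[OF f g p] hardy_diff(1)[OF g h p] p] by simp
qed

section \<open>Pointwise limits, normal families and completeness\<close>

lemma hardy_mean_tendsto:
  assumes f: "\<And>n. continuous_on unit_disc (f n)" and g: "continuous_on unit_disc g"
    and r: "0 \<le> r" "r < 1" and p: "0 < p"
    and B: "\<And>n z. cmod z = r \<Longrightarrow> cmod (f n z) \<le> B"
    and lim: "\<And>z. z \<in> unit_disc \<Longrightarrow> (\<lambda>n. f n z) \<longlonglongrightarrow> g z"
  shows "(\<lambda>n. hardy_mean p (f n) r) \<longlonglongrightarrow> hardy_mean p g r"
  unfolding hardy_mean_def
proof (rule dominated_convergence(2))
  show "(\<lambda>t. cmod (f n (of_real r * cis t)) powr p) integrable_on {0..2*pi}" for n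
    by (rule hardy_mean_integrable[OF f r p])
  show "(\<lambda>t. B powr p) integrable_on {0..2*pi}" by (intro integrable_continuous_real continuous_intros)
  show "norm (cmod (f n (of_real r * cis t)) powr p) \<le> B powr p" for n t
    using B[of "of_real r * cis t" n] r p by (auto simp: norm_mult intro!: powr_mono2)
  show "(\<lambda>n. cmod (f n (of_real r * cis t)) powr p) \<longlonglongrightarrow> cmod (g (of_real r * cis t)) powr p" for t
    using p by (intro tendsto_powr2[OF tendsto_norm[OF lim] tendsto_const] circle_point_in_disc r) auto
qed

text \<open>On a fixed circle the evaluation bound dominates the sequence, so the means converge and
  inherit the bound before the supremum over radii is taken.\<close>

lemma hardy_fatou:
  assumes f: "\<And>n. f n \<in> hardy_space p" and N: "\<And>n. hardy_norm p (f n) \<le> K" and p: "1 \<le> p"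
    and g: "g holomorphic_on unit_disc" "\<And>z. z \<notin> unit_disc \<Longrightarrow> g z = 0"
    and lim: "\<And>z. z \<in> unit_disc \<Longrightarrow> (\<lambda>n. f n z) \<longlonglongrightarrow> g z"
  shows "g \<in> hardy_space p" "hardy_norm p g \<le> K"
proof -
  have K: "0 \<le> K" using N[of 0] hardy_norm_nonneg[of p "f 0"] by linarith
  have *: "hardy_mean p g r \<le> K powr p" if r: "0 < r" "r < 1" for r
  proof (rule LIMSEQ_le_const2[OF hardy_mean_tendsto[OF hardy_spaceD(4)[OF f] _ _ r(2) _ _ lim]])
    show "continuous_on unit_disc g" using g by (intro holomorphic_on_imp_continuous_on)
    show "cmod (f n z) \<le> (2 / (1 - r)) powr (1/p) * K" if "cmod z = r" for n z
    proof -
      have "cmod (f n z) \<le> (2 / (1 - r)) powr (1/p) * hardy_norm p (f n)"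
        using that r by (intro cmod_le_hardy_norm f p) auto
      also have "\<dots> \<le> (2 / (1 - r)) powr (1/p) * K" by (intro mult_left_mono N) auto
      finally show ?thesis .
    qed
    have "hardy_mean p (f n) r \<le> K powr p" for n
    proof -
      have "hardy_norm p (f n) powr p \<le> K powr p" using p by (intro powr_mono2 N hardy_norm_nonneg) auto
      then show ?thesis using hardy_mean_le_norm[OF f[of n] p r] by linarith
    qed
    then show "\<exists>N. \<forall>n\<ge>N. hardy_mean p (f n) r \<le> K powr p" by blast
  qed (use r p in auto)
  show "g \<in> hardy_space p" by (rule hardy_space_memI[OF g *])
  show "hardy_norm p g \<le> K" by (rule hardy_norm_le[OF * K p g(1)])
qed

lemma hardy_montel:
  fixes f :: "nat \<Rightarrow> complex \<Rightarrow> complex"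
  assumes f: "\<And>n. f n \<in> hardy_space p" and N: "\<And>n. hardy_norm p (f n) \<le> K" and p: "1 \<le> p"
  obtains g r where "g \<in> hardy_space p" "hardy_norm p g \<le> K" "strict_mono (r :: nat \<Rightarrow> nat)"
    "\<And>z. (\<lambda>n. f (r n) z) \<longlonglongrightarrow> g z"
proof -
  obtain g r where g: "g holomorphic_on unit_disc" and r: "strict_mono (r :: nat \<Rightarrow> nat)"
      and lim: "\<And>x. x \<in> unit_disc \<Longrightarrow> ((\<lambda>n. f (r n) x) \<longlongrightarrow> g x) sequentially"
  proof (rule Montel[of unit_disc "range f" f])
    show "h holomorphic_on unit_disc" if "h \<in> range f" for h using that hardy_spaceD(1)[OF f] by auto
    fix C :: "complex set" assume C: "compact C" "C \<subseteq> unit_disc"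
    show "\<exists>B. \<forall>h\<in>range f. \<forall>z\<in>C. cmod (h z) \<le> B"
    proof (cases "C = {}")
      case False
      obtain z0 where z0: "z0 \<in> C" "\<And>z. z \<in> C \<Longrightarrow> cmod z \<le> cmod z0"
        using continuous_attains_sup[OF C(1) False continuous_on_norm_id] by auto
      have "cmod z0 < 1" using z0 C by auto
      have "cmod (f n z) \<le> (2 / (1 - cmod z0)) powr (1/p) * K" if "z \<in> C" for n z
      proof -
        have "cmod (f n z) \<le> (2 / (1 - cmod z0)) powr (1/p) * hardy_norm p (f n)"
          using that \<open>cmod z0 < 1\<close> z0 by (intro cmod_le_hardy_norm f p) auto
        also have "\<dots> \<le> (2 / (1 - cmod z0)) powr (1/p) * K" by (intro mult_left_mono N) auto
        finally show ?thesis .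
      qed
      then show ?thesis by blast
    qed auto
  qed auto
  \<comment> \<open>Montel's theorem gives no values outside the disc, where elements of the space
    are 0 by convention.\<close>
  define g' where "g' z = (if z \<in> unit_disc then g z else 0)" for z
  have lim': "(\<lambda>n. f (r n) z) \<longlonglongrightarrow> g' z" for z
    using lim[of z] hardy_spaceD(2)[OF f] by (auto simp: g'_def)
  have g': "g' holomorphic_on unit_disc" by (rule holomorphic_transform[OF g]) (auto simp: g'_def)
  have "g' \<in> hardy_space p" "hardy_norm p g' \<le> K"
    by (rule hardy_fatou[of "\<lambda>n. f (r n)", OF f N p g' _ lim']; simp add: g'_def)+
  with that r lim' show ?thesis by blast
qed

text \<open>A Cauchy sequence is bounded, so a subsequence converges pointwise; Fatou's argument for
  the differences with the tail of this subsequence turns that into norm convergence of the whole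
  sequence.\<close>

lemma hardy_mcomplete:
  assumes p: "1 \<le> p"
  shows "Metric_space.mcomplete (hardy_space p) (\<lambda>f g. hardy_norm p (\<lambda>x. f x - g x))"
proof -
  interpret Metric_space "hardy_space p" "\<lambda>f g. hardy_norm p (\<lambda>x. f x - g x)"
    by (rule hardy_metric_space[OF p])
  show ?thesis unfolding mcomplete_def
  proof (intro allI impI)
    fix s assume s: "MCauchy s"
    then have mem: "s n \<in> hardy_space p" for n by (auto simp: MCauchy_def)
    obtain K where K: "\<And>n m. hardy_norm p (\<lambda>x. s n x - s m x) \<le> K"
      using MCauchy_imp_mbounded[OF s] unfolding mbounded_alt by (metis rangeI)
    have "hardy_norm p (s n) \<le> K + hardy_norm p (s 0)" for n
      using hardy_add(2)[OF hardy_diff(1)[OF mem[of n] mem[of 0] p] mem[of 0] p] K[of n 0] by simp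
    then obtain g r where g: "g \<in> hardy_space p" and r: "strict_mono (r :: nat \<Rightarrow> nat)"
      and lim: "\<And>z. (\<lambda>n. s (r n) z) \<longlonglongrightarrow> g z"
      using hardy_montel[of s p "K + hardy_norm p (s 0)", OF mem _ p] by metis
    have "\<exists>N. \<forall>n\<ge>N. hardy_norm p (\<lambda>x. s n x - g x) < e" if "0 < e" for e
    proof -
      obtain N where N: "\<And>n m. N \<le> n \<Longrightarrow> N \<le> m \<Longrightarrow> hardy_norm p (\<lambda>x. s n x - s m x) < e / 2"
        using s \<open>0 < e\<close> unfolding MCauchy_def by (meson half_gt_zero)
      have "hardy_norm p (\<lambda>x. s n x - g x) \<le> e / 2" if "N \<le> n" for n
      proof (rule hardy_fatou(2)[of "\<lambda>m x. s n x - s (r (m + N)) x"])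
        show "hardy_norm p (\<lambda>x. s n x - s (r (m + N)) x) \<le> e / 2" for m
          using N[OF that, of "r (m + N)"] seq_suble[OF r, of "m + N"] by simp
        show "(\<lambda>m. s n z - s (r (m + N)) z) \<longlonglongrightarrow> s n z - g z" for z
          by (intro tendsto_intros LIMSEQ_ignore_initial_segment[OF lim])
      qed (use p hardy_diff(1)[OF mem mem p] hardy_spaceD[OF hardy_diff(1)[OF mem g p]] in auto)
      then show ?thesis using \<open>0 < e\<close> by (intro exI[of _ N]) force
    qed
    then have "limitin mtopology s g sequentially"
      unfolding limit_metric_sequentially using g mem by auto
    then show "\<exists>x. limitin mtopology s x sequentially" by blast
  qed
qed

text \<open>Hoelder's inequality for two equal exponents, from \<open>2 x y \<le> x^2 + y^2\<close>
  after normalising the factors by \<open>a\<close> and \<open>b\<close>.\<close>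

lemma hardy_mean_mult_le:
  assumes u: "continuous_on unit_disc u" and v: "continuous_on unit_disc v" and r: "0 \<le> r" "r < 1"
    and p: "0 < p"
    and a: "hardy_mean (2*p) u r \<le> a powr (2*p)" "0 < a" and b: "hardy_mean (2*p) v r \<le> b powr (2*p)" "0 < b"
  shows "hardy_mean p (\<lambda>z. u z * v z) r \<le> (a * b) powr p"
proof -
  let ?z = "\<lambda>s. of_real r * cis s" and ?c = "(a * b) powr p / 2"
  have p2: "0 < 2 * p" using p by simp
  note F = hardy_mean_integrable[OF u r p2] and G = hardy_mean_integrable[OF v r p2]
  have I: "((\<lambda>s. ?c * (1 / a powr (2*p) * cmod (u (?z s)) powr (2*p) + 1 / b powr (2*p) * cmod (v (?z s)) powr (2*p)))
    has_integral ?c * (1 / a powr (2*p) * hardy_mean (2*p) u r + 1 / b powr (2*p) * hardy_mean (2*p) v r)) {0..2*pi}"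
    unfolding hardy_mean_def
    by (intro has_integral_mult_right has_integral_add integrable_integral F G)
  have "hardy_mean p (\<lambda>z. u z * v z) r \<le> ?c * (1 / a powr (2*p) * hardy_mean (2*p) u r + 1 / b powr (2*p) * hardy_mean (2*p) v r)"
    unfolding hardy_mean_def[of p]
  proof (rule has_integral_le[OF integrable_integral I])
    show "(\<lambda>s. cmod (u (?z s) * v (?z s)) powr p) integrable_on {0..2*pi}"
      by (rule hardy_mean_integrable[OF continuous_on_mult[OF u v] r p])
    fix s
    define x y where "x = (cmod (u (?z s)) / a) powr p" and "y = (cmod (v (?z s)) / b) powr p"
    have "cmod (u (?z s) * v (?z s)) = a * b * ((cmod (u (?z s)) / a) * (cmod (v (?z s)) / b))"
      using a b by (simp add: norm_mult)
    then have "cmod (u (?z s) * v (?z s)) powr p = (a * b) powr p * (x * y)"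
      unfolding x_def y_def by (simp only: powr_mult)
    also have "\<dots> \<le> (a * b) powr p * ((x\<^sup>2 + y\<^sup>2) / 2)"
      using sum_squares_bound[of x y] by (intro mult_left_mono) auto
    also have "x\<^sup>2 = 1 / a powr (2*p) * cmod (u (?z s)) powr (2*p)"
      unfolding x_def power2_eq_square powr_add[symmetric] mult_2[symmetric] by (simp only: powr_divide) simp
    also have "y\<^sup>2 = 1 / b powr (2*p) * cmod (v (?z s)) powr (2*p)"
      unfolding y_def power2_eq_square powr_add[symmetric] mult_2[symmetric] by (simp only: powr_divide) simp
    finally show "cmod (u (?z s) * v (?z s)) powr p \<le> ?c * (1 / a powr (2*p) * cmod (u (?z s)) powr (2*p) + 1 / b powr (2*p) * cmod (v (?z s)) powr (2*p))"
      by (simp add: field_simps)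
  qed
  also have "\<dots> \<le> ?c * (1 / a powr (2*p) * a powr (2*p) + 1 / b powr (2*p) * b powr (2*p))"
    using a b by (intro mult_left_mono add_mono) auto
  also have "\<dots> = (a * b) powr p" using a b by simp
  finally show ?thesis .
qed

lemma hardy_mult:
  assumes u: "u \<in> hardy_space (2*p)" and v: "v \<in> hardy_space (2*p)" and p: "1 \<le> p"
  shows "(\<lambda>z. u z * v z) \<in> hardy_space p"
    and "hardy_norm p (\<lambda>z. u z * v z) \<le> hardy_norm (2*p) u * hardy_norm (2*p) v"
proof -
  let ?a = "hardy_norm (2*p) u" and ?b = "hardy_norm (2*p) v"
  have hol: "(\<lambda>z. u z * v z) holomorphic_on unit_disc"
    by (intro holomorphic_intros hardy_spaceD[OF u] hardy_spaceD[OF v])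
  have *: "hardy_mean p (\<lambda>z. u z * v z) r \<le> ((?a + e) * (?b + e)) powr p"
    if "0 < r" "r < 1" "0 < e" for r e
  proof (rule hardy_mean_mult_le)
    have "?a powr (2*p) \<le> (?a + e) powr (2*p)" "?b powr (2*p) \<le> (?b + e) powr (2*p)"
      using p that hardy_norm_nonneg[of "2*p"] by (auto intro!: powr_mono2)
    moreover have "hardy_mean (2*p) u r \<le> ?a powr (2*p)" "hardy_mean (2*p) v r \<le> ?b powr (2*p)"
      using u v p that by (auto intro!: hardy_mean_le_norm)
    ultimately show "hardy_mean (2*p) u r \<le> (?a + e) powr (2*p)" "hardy_mean (2*p) v r \<le> (?b + e) powr (2*p)"
      by linarith+
  qed (use that p hardy_norm_nonneg[of "2*p" u] hardy_norm_nonneg[of "2*p" v] hardy_spaceD[OF u] hardy_spaceD[OF v] in auto)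
  show "(\<lambda>z. u z * v z) \<in> hardy_space p"
    by (rule hardy_space_memI[OF hol _ *[where e=1]]) (auto simp: hardy_spaceD(2)[OF u])
  have "hardy_norm p (\<lambda>z. u z * v z) \<le> (?a + e) * (?b + e)" if "0 < e" for e
    using * that p hol hardy_norm_nonneg[of "2*p"] by (intro hardy_norm_le) auto
  moreover have "((\<lambda>e. (?a + e) * (?b + e)) \<longlongrightarrow> (?a + 0) * (?b + 0)) (at_right 0)"
    by (intro tendsto_intros)
  ultimately show "hardy_norm p (\<lambda>z. u z * v z) \<le> ?a * ?b"
    by (intro tendsto_lowerbound[where F="at_right 0"]) (auto simp: eventually_at_filter)
qed

section \<open>Uniform convexity, factorisation and density of polynomials\<close>

text \<open>Each term \<open>x powr k\<close> is at most \<open>x * (s + t) powr (k - 1)\<close>,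
  and these two bounds add up to the right-hand side.\<close>

lemma powr_superadditive:
  fixes s t k :: real
  assumes "0 \<le> s" "0 \<le> t" "1 \<le> k"
  shows "s powr k + t powr k \<le> (s + t) powr k"
proof -
  have *: "x powr k \<le> x * (s + t) powr (k - 1)" if "0 \<le> x" "x \<le> s + t" for x
  proof (cases "x = 0")
    case False
    then have "x powr k = x powr 1 * x powr (k - 1)" by (subst powr_add[symmetric]) simp
    also have "\<dots> \<le> x * (s + t) powr (k - 1)"
      using that assms False by (auto intro!: mult_left_mono powr_mono2)
    finally show ?thesis .
  qed (use assms in auto)
  show ?thesis
  proof (cases "s + t = 0")
    case False
    have "s powr k + t powr k \<le> s * (s + t) powr (k - 1) + t * (s + t) powr (k - 1)"
      using assms by (intro add_mono *) auto
    also have "\<dots> = (s + t) powr 1 * (s + t) powr (k - 1)" using assms by (simp add: distrib_right)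
    also have "\<dots> = (s + t) powr k" by (subst powr_add[symmetric]) simp
    finally show ?thesis .
  next
    case True
    then have "s = 0" "t = 0" using assms by linarith+
    then show ?thesis by simp
  qed
qed

text \<open>The parallelogram law, placed between superadditivity and convexity of the power
  \<open>q/2\<close>; both use \<open>1 \<le> q/2\<close>.\<close>

lemma clarkson_inequality:
  fixes x y :: complex
  assumes "2 \<le> q"
  shows "cmod ((x + y) / 2) powr q + cmod ((x - y) / 2) powr q \<le> (cmod x powr q + cmod y powr q) / 2"
proof -
  have sq: "(cmod z)\<^sup>2 powr (q/2) = cmod z powr q" for z
  proof (cases "z = 0")
    case False
    have "(cmod z)\<^sup>2 = cmod z powr 2" using False by simp
    then show ?thesis by (simp only: powr_powr) simp
  qed (use assms in auto)
  have "cmod ((x + y) / 2) powr q + cmod ((x - y) / 2) powr q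
    \<le> ((cmod ((x + y) / 2))\<^sup>2 + (cmod ((x - y) / 2))\<^sup>2) powr (q/2)"
    unfolding sq[symmetric] using assms by (intro powr_superadditive) auto
  also have "(cmod ((x + y) / 2))\<^sup>2 + (cmod ((x - y) / 2))\<^sup>2 = 1/2 * (cmod x)\<^sup>2 + (1 - 1/2) * (cmod y)\<^sup>2"
    unfolding cmod_power2 by (simp add: power2_eq_square field_simps)
  also have "\<dots> powr (q/2) \<le> 1/2 * (cmod x)\<^sup>2 powr (q/2) + (1 - 1/2) * (cmod y)\<^sup>2 powr (q/2)"
    using assms by (intro powr_convex_combination_le) auto
  finally show ?thesis unfolding sq by simp
qed

lemma hardy_mean_clarkson:
  assumes f: "continuous_on unit_disc f" and g: "continuous_on unit_disc g" and r: "0 \<le> r" "r < 1" and q: "2 \<le> q"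
  shows "hardy_mean q (\<lambda>z. (f z + g z) / 2) r + hardy_mean q (\<lambda>z. (f z - g z) / 2) r
    \<le> (hardy_mean q f r + hardy_mean q g r) / 2"
proof -
  have q0: "0 < q" using q by simp
  have c: "continuous_on unit_disc (\<lambda>z. (f z + g z) / 2)" "continuous_on unit_disc (\<lambda>z. (f z - g z) / 2)"
    using f g by (intro continuous_intros; simp)+
  show ?thesis unfolding hardy_mean_def
  proof (rule has_integral_le)
    show "((\<lambda>t. cmod ((f (of_real r * cis t) + g (of_real r * cis t)) / 2) powr q + cmod ((f (of_real r * cis t) - g (of_real r * cis t)) / 2) powr q)
      has_integral integral {0..2*pi} (\<lambda>t. cmod ((f (of_real r * cis t) + g (of_real r * cis t)) / 2) powr q) + integral {0..2*pi} (\<lambda>t. cmod ((f (of_real r * cis t) - g (of_real r * cis t)) / 2) powr q)) {0..2*pi}"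
      by (intro has_integral_add integrable_integral hardy_mean_integrable[OF c(1) r q0] hardy_mean_integrable[OF c(2) r q0])
    show "((\<lambda>t. (cmod (f (of_real r * cis t)) powr q + cmod (g (of_real r * cis t)) powr q) / 2)
      has_integral (integral {0..2*pi} (\<lambda>t. cmod (f (of_real r * cis t)) powr q) + integral {0..2*pi} (\<lambda>t. cmod (g (of_real r * cis t)) powr q)) / 2) {0..2*pi}"
      by (intro has_integral_divide has_integral_add integrable_integral hardy_mean_integrable[OF f r q0] hardy_mean_integrable[OF g r q0])
  qed (intro clarkson_inequality q)
qed

text \<open>Uniform convexity: the means of \<open>(f n + g) / 2\<close> approach \<open>hardy_norm q g powr q\<close> by pointwise
  convergence, so Clarkson's inequality forces those of \<open>(f n - g) / 2\<close> to vanish.\<close>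

lemma hardy_norm_convergence:
  assumes f: "\<And>n. f n \<in> hardy_space q" and g: "g \<in> hardy_space q" and q: "2 \<le> q"
    and le: "\<And>n. hardy_norm q (f n) \<le> hardy_norm q g"
    and lim: "\<And>z. z \<in> unit_disc \<Longrightarrow> (\<lambda>n. f n z) \<longlonglongrightarrow> g z"
  shows "(\<lambda>n. hardy_norm q (\<lambda>z. f n z - g z)) \<longlonglongrightarrow> 0"
proof (rule LIMSEQ_I)
  fix e :: real assume e: "0 < e"
  have q1: "1 \<le> q" using q by simp
  \<comment> \<open>A mean of at most \<open>d\<close> for the half difference bounds its norm by
    \<open>e/4\<close>, hence that of the full difference by \<open>e/2\<close>.\<close>
  define d where "d = (e/4) powr q"
  have d: "0 < d" using e by (simp add: d_def)
  define S where "S = hardy_norm q g powr q"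
  have cont: "continuous_on unit_disc (f n)" "continuous_on unit_disc g" for n
    using hardy_spaceD(4)[OF f] hardy_spaceD(4)[OF g] by auto
  have hol: "f n holomorphic_on unit_disc" "g holomorphic_on unit_disc" for n
    using hardy_spaceD(1)[OF f] hardy_spaceD(1)[OF g] by auto
  have fS: "hardy_mean q (f n) r \<le> S" and gS: "hardy_mean q g r \<le> S" if "0 < r" "r < 1" for n r
  proof -
    have "hardy_norm q (f n) powr q \<le> S" unfolding S_def using q by (intro powr_mono2 le hardy_norm_nonneg) auto
    then show "hardy_mean q (f n) r \<le> S" using hardy_mean_le_norm[OF f q1 that, of n] by linarith
    show "hardy_mean q g r \<le> S" unfolding S_def by (rule hardy_mean_le_norm[OF g q1 that])
  qed
  \<comment> \<open>A circle on which the mean of \<open>g\<close> almost exhausts the norm, since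
    otherwise the supremum would be at most \<open>S - d\<close>. Convergence of the means is needed
    on this one circle only.\<close>
  have "\<exists>\<rho>>0. \<rho> < 1 \<and> S - d < hardy_mean q g \<rho>"
  proof (rule ccontr)
    assume "\<not> ?thesis"
    then have *: "hardy_mean q g r \<le> S - d" if "0 < r" "r < 1" for r using that by force
    have "0 \<le> hardy_mean q g (1/2)" using q by (intro hardy_mean_nonneg cont) auto
    then have Sd: "0 \<le> S - d" using *[of "1/2"] by simp
    have "hardy_norm q g \<le> (S - d) powr (1/q)"
      using * hol q Sd by (intro hardy_norm_le) (auto simp: powr_powr)
    then have "hardy_norm q g powr q \<le> ((S - d) powr (1/q)) powr q"
      using q by (intro powr_mono2 hardy_norm_nonneg) auto
    then show False using q Sd d by (simp add: powr_powr flip: S_def)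
  qed
  then obtain \<rho> where \<rho>: "0 < \<rho>" "\<rho> < 1" "S - d < hardy_mean q g \<rho>" by blast
  have "(\<lambda>n. hardy_mean q (\<lambda>z. (f n z + g z) / 2) \<rho>) \<longlonglongrightarrow> hardy_mean q (\<lambda>z. (g z + g z) / 2) \<rho>"
  proof (rule hardy_mean_tendsto)
    show "continuous_on unit_disc (\<lambda>z. (f n z + g z) / 2)" "continuous_on unit_disc (\<lambda>z. (g z + g z) / 2)" for n
      using cont by (intro continuous_intros; simp)+
    fix n z assume z: "cmod z = \<rho>"
    let ?C = "(2 / (1 - \<rho>)) powr (1/q) * hardy_norm q g"
    have "cmod (f n z) \<le> (2 / (1 - \<rho>)) powr (1/q) * hardy_norm q (f n)" "cmod (g z) \<le> ?C"
      using z \<rho> by (intro cmod_le_hardy_norm f g q1; simp)+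
    moreover have "(2 / (1 - \<rho>)) powr (1/q) * hardy_norm q (f n) \<le> ?C" by (intro mult_left_mono le) auto
    ultimately have "cmod (f n z) \<le> ?C" "cmod (g z) \<le> ?C" by auto
    then show "cmod ((f n z + g z) / 2) \<le> ?C" using norm_triangle_ineq[of "f n z" "g z"] by simp
  next
    show "(\<lambda>n. (f n z + g z) / 2) \<longlonglongrightarrow> (g z + g z) / 2" if "z \<in> unit_disc" for z
      by (intro tendsto_intros lim that) simp
  qed (use \<rho> q in auto)
  then have "\<forall>\<^sub>F n in sequentially. S - d < hardy_mean q (\<lambda>z. (f n z + g z) / 2) \<rho>"
    using \<rho>(3) by (intro order_tendstoD) auto
  then obtain N where N: "\<And>n. N \<le> n \<Longrightarrow> S - d < hardy_mean q (\<lambda>z. (f n z + g z) / 2) \<rho>"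
    unfolding eventually_sequentially by blast
  have "hardy_norm q (\<lambda>z. f n z - g z) \<le> e / 2" if n: "N \<le> n" for n
  proof -
    have hd: "(\<lambda>z. (f n z - g z) / 2) holomorphic_on unit_disc" "(\<lambda>z. (f n z + g z) / 2) holomorphic_on unit_disc"
      by (intro holomorphic_intros hol; simp)+
    \<comment> \<open>Monotonicity in the radius carries the lower bound \<open>S - d\<close> from
      \<open>\<rho>\<close> to \<open>r\<close>; Clarkson's inequality, with both means on its right
      at most \<open>S\<close>, leaves at most \<open>d\<close> for the half difference.\<close>
    have "hardy_mean q (\<lambda>z. (f n z - g z) / 2) r \<le> d" if r: "\<rho> \<le> r" "r < 1" for r
    proof -
      have r0: "0 < r" using r \<rho> by simp
      have "hardy_mean q (\<lambda>z. (f n z + g z) / 2) \<rho> \<le> hardy_mean q (\<lambda>z. (f n z + g z) / 2) r"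
        by (rule hardy_mean_mono[OF hd(2) \<rho>(1) r q1])
      moreover have "hardy_mean q (\<lambda>z. (f n z + g z) / 2) r + hardy_mean q (\<lambda>z. (f n z - g z) / 2) r
         \<le> (hardy_mean q (f n) r + hardy_mean q g r) / 2"
        using r0 r q by (intro hardy_mean_clarkson cont) auto
      ultimately show ?thesis using N[OF n] fS[OF r0 r(2), of n] gS[OF r0 r(2)] by argo
    qed
    then have "hardy_mean q (\<lambda>z. (f n z - g z) / 2) r \<le> d" if r: "0 < r" "r < 1" for r
      using hardy_mean_mono[OF hd(1) r(1), of \<rho> q] q1 \<rho> r by (cases "\<rho> \<le> r") force+
    then have "hardy_norm q (\<lambda>z. (f n z - g z) / 2) \<le> e / 4"
      using e q1 hd by (intro hardy_norm_le) (auto simp: d_def)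
    moreover have "hardy_norm q (\<lambda>z. (1/2) * (f n z - g z)) = cmod (1/2) * hardy_norm q (\<lambda>z. f n z - g z)"
      by (rule hardy_scale(2)[OF hardy_diff(1)[OF f g q1] q1])
    ultimately show ?thesis by simp
  qed
  then show "\<exists>N. \<forall>n\<ge>N. norm (hardy_norm q (\<lambda>z. f n z - g z) - 0) < e"
    using e hardy_norm_nonneg by (intro exI[of _ N]) force
qed

lemma hardy_mean_bounded:
  assumes f: "continuous_on unit_disc f" and C: "\<And>z. z \<in> unit_disc \<Longrightarrow> cmod (f z) \<le> C"
    and r: "0 \<le> r" "r < 1" and p: "0 < p"
  shows "hardy_mean p f r \<le> 2 * pi * C powr p"
proof -
  have "hardy_mean p f r \<le> integral {0..2*pi} (\<lambda>_. C powr p)"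
    unfolding hardy_mean_def
    using p by (intro integral_le hardy_mean_integrable[OF f r p] integrable_continuous_real continuous_intros powr_mono2 C
      circle_point_in_disc r) auto
  then show ?thesis by simp
qed

lemma hardy_bounded:
  assumes f: "f holomorphic_on unit_disc" "\<And>z. z \<notin> unit_disc \<Longrightarrow> f z = 0"
    and C: "\<And>z. z \<in> unit_disc \<Longrightarrow> cmod (f z) \<le> C" and p: "1 \<le> p"
  shows "f \<in> hardy_space p" "hardy_norm p f \<le> (2 * pi) powr (1/p) * C"
proof -
  have C0: "0 \<le> C" using order_trans[OF norm_ge_zero C[of 0]] by simp
  have c: "continuous_on unit_disc f" using f by (intro holomorphic_on_imp_continuous_on)
  have *: "hardy_mean p f r \<le> 2 * pi * C powr p" if "0 < r" "r < 1" for r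
    using that p by (intro hardy_mean_bounded c C) auto
  show "f \<in> hardy_space p" by (rule hardy_space_memI[OF f *])
  have "((2 * pi) powr (1/p) * C) powr p = 2 * pi * C powr p"
    using p by (simp add: powr_mult powr_powr)
  then show "hardy_norm p f \<le> (2 * pi) powr (1/p) * C"
    using * p C0 f by (intro hardy_norm_le) auto
qed

section \<open>Blaschke factors and the factorisation of Hardy functions\<close>

lemma blaschke_identity:
  "cmod (1 - cnj a * z) ^ 2 - cmod (z - a) ^ 2 = (1 - cmod a ^ 2) * (1 - cmod z ^ 2)"
  by (simp only: cmod_power2) (simp add: power2_eq_square algebra_simps)

lemma blaschke_denom_nonzero:
  assumes "cmod a < 1" "cmod z < 1"
  shows "1 - cnj a * z \<noteq> 0"
proof
  assume "1 - cnj a * z = 0"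
  then have "cmod (cnj a * z) = 1" by simp
  moreover have "cmod a * cmod z < 1 * 1" using assms by (intro mult_strict_mono) auto
  ultimately show False by (simp add: norm_mult)
qed

lemma blaschke_norm_less_1:
  assumes "cmod a < 1" "cmod z < 1"
  shows "cmod ((z - a) / (1 - cnj a * z)) < 1"
proof -
  have "0 < (1 - cmod a ^ 2) * (1 - cmod z ^ 2)"
    using assms by (intro mult_pos_pos) (auto simp: power_less_one_iff abs_square_less_1)
  then have "cmod (z - a) ^ 2 < cmod (1 - cnj a * z) ^ 2" using blaschke_identity[of a z] by simp
  then have "cmod (z - a) < cmod (1 - cnj a * z)" by (rule power_less_imp_less_base) simp
  then show ?thesis using blaschke_denom_nonzero[OF assms] by (simp add: norm_divide)
qed

text \<open>From \<open>blaschke_identity\<close> and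
  \<open>\<bar>1 - cnj a * z\<bar> \<ge> 1 - \<bar>a\<bar>\<close>. The bound is uniform on the
  circle and tends to 1 with \<open>r\<close>, so that division by the factor costs nothing in the
  limit.\<close>

lemma blaschke_norm_ge:
  assumes "cmod a < 1" "cmod z = r" "r < 1"
  shows "1 - (1 - r\<^sup>2) / (1 - cmod a)\<^sup>2 \<le> (cmod ((z - a) / (1 - cnj a * z)))\<^sup>2"
proof -
  have nz: "1 - cnj a * z \<noteq> 0" using assms by (intro blaschke_denom_nonzero) auto
  have r: "0 \<le> r" using assms by auto
  have "cmod a * r \<le> cmod a * 1" using assms by (intro mult_left_mono) auto
  then have "1 - cmod a \<le> cmod (1 - cnj a * z)"
    using norm_triangle_ineq2[of 1 "cnj a * z"] assms by (simp add: norm_mult)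
  then have "(1 - cmod a)\<^sup>2 \<le> (cmod (1 - cnj a * z))\<^sup>2" using assms by (intro power_mono) auto
  then have "(1 - cmod a ^ 2) * (1 - r ^ 2) / (cmod (1 - cnj a * z))\<^sup>2 \<le> (1 * (1 - r\<^sup>2)) / (1 - cmod a)\<^sup>2"
    using assms r by (intro frac_le mult_right_mono) (auto simp: power_le_one)
  moreover have "(cmod ((z - a) / (1 - cnj a * z)))\<^sup>2 = 1 - (1 - cmod a ^ 2) * (1 - r ^ 2) / (cmod (1 - cnj a * z))\<^sup>2"
    using blaschke_identity[of a z] nz assms by (simp add: norm_divide power_divide field_simps)
  ultimately show ?thesis by simp
qed

lemma blaschke_factor_holomorphic:
  assumes "cmod a < 1"
  shows "(\<lambda>z. (z - a) / (1 - cnj a * z)) holomorphic_on unit_disc"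
  using blaschke_denom_nonzero[OF assms] by (intro holomorphic_intros) auto

lemma hardy_divide_blaschke:
  assumes g: "g \<in> hardy_space p" and a: "cmod a < 1" "g a = 0" and p: "1 \<le> p"
  obtains k where "k \<in> hardy_space p" "hardy_norm p k \<le> hardy_norm p g"
    "\<And>z. z \<in> unit_disc \<Longrightarrow> g z = (z - a) / (1 - cnj a * z) * k z"
proof -
  \<comment> \<open>The difference quotient of \<open>g\<close> at its zero, filled in at the
    removable singularity.\<close>
  define k0 where "k0 z = (if z = a then deriv g a else (g z - g a) / (z - a))" for z
  have k0: "k0 holomorphic_on unit_disc"
    unfolding k0_def by (rule pole_lemma_open[OF hardy_spaceD(1)[OF g] open_ball])
  define k where "k z = (if z \<in> unit_disc then k0 z * (1 - cnj a * z) else 0)" for z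
  have "(\<lambda>z. k0 z * (1 - cnj a * z)) holomorphic_on unit_disc" by (intro holomorphic_intros k0)
  then have k: "k holomorphic_on unit_disc" by (rule holomorphic_transform) (simp add: k_def)
  have gk: "g z = (z - a) / (1 - cnj a * z) * k z" if "z \<in> unit_disc" for z
    using that blaschke_denom_nonzero[OF a(1), of z] a(2) by (auto simp: k_def k0_def)
  define c where "c r = 1 - (1 - r\<^sup>2) / (1 - cmod a)\<^sup>2" for r :: real
  have c1: "(c \<longlongrightarrow> c 1) (at_left 1)"
    unfolding c_def using a by (intro tendsto_intros) auto
  then have "\<forall>\<^sub>F r in at_left 1. 0 < c r" by (rule order_tendstoD) (simp add: c_def)
  moreover have "\<forall>\<^sub>F r in at_left 1. r < (1::real)" by (simp add: eventually_at_filter)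
  moreover have "\<forall>\<^sub>F r in at_left 1. s \<le> (r::real)" if "s < 1" for s
    using eventually_at_left_real[OF that] by eventually_elim auto
  moreover have bound: "hardy_mean p k r * c r powr (p/2) \<le> hardy_norm p g powr p" if r: "0 < r" "r < 1" and c: "0 < c r" for r
  proof -
    have "hardy_mean p (\<lambda>z. of_real (c r powr (1/2)) * k z) r \<le> hardy_mean p g r"
      unfolding hardy_mean_def
    proof (rule integral_le)
      show "(\<lambda>t. cmod (of_real (c r powr (1/2)) * k (of_real r * cis t)) powr p) integrable_on {0..2*pi}"
        using r p holomorphic_on_imp_continuous_on[OF k] by (intro hardy_mean_integrable continuous_intros) auto
      show "(\<lambda>t. cmod (g (of_real r * cis t)) powr p) integrable_on {0..2*pi}"
        using r p hardy_spaceD(4)[OF g] by (intro hardy_mean_integrable) auto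
      fix t
      let ?z = "of_real r * cis t"
      have z: "cmod ?z = r" using r by (simp add: norm_mult)
      have "(c r powr (1/2))\<^sup>2 = c r" using c by (simp add: powr_half_sqrt)
      then have "(c r powr (1/2))\<^sup>2 \<le> (cmod ((?z - a) / (1 - cnj a * ?z)))\<^sup>2"
        using blaschke_norm_ge[OF a(1) z r(2)] by (simp only: c_def)
      then have "c r powr (1/2) \<le> cmod ((?z - a) / (1 - cnj a * ?z))" by (rule power2_le_imp_le) simp
      then have "c r powr (1/2) * cmod (k ?z) \<le> cmod (g ?z)"
        using gk[of ?z] z r by (simp only: norm_mult mem_ball_0) (rule mult_right_mono, auto)
      then show "cmod (of_real (c r powr (1/2)) * k ?z) powr p \<le> cmod (g ?z) powr p"
        using p by (intro powr_mono2) (auto simp: norm_mult)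
    qed
    also have "\<dots> \<le> hardy_norm p g powr p" by (rule hardy_mean_le_norm[OF g p r])
    finally show ?thesis unfolding hardy_mean_mult_const by (simp add: powr_powr mult.commute)
  qed
  \<comment> \<open>The mean at the fixed radius \<open>s\<close> is at most the one at
    \<open>r\<close>, which is controlled up to a power of \<open>c r\<close>; then \<open>r\<close>
    tends to 1.\<close>
  have kmean: "hardy_mean p k s \<le> hardy_norm p g powr p" if s: "0 < s" "s < 1" for s
  proof (rule tendsto_upperbound)
    have "((\<lambda>r. hardy_mean p k s * c r powr (p/2)) \<longlongrightarrow> hardy_mean p k s * c 1 powr (p/2)) (at_left 1)"
      by (intro tendsto_intros c1) (simp add: c_def)
    then show "((\<lambda>r. hardy_mean p k s * c r powr (p/2)) \<longlongrightarrow> hardy_mean p k s) (at_left 1)" by (simp add: c_def)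
    show "\<forall>\<^sub>F r in at_left 1. hardy_mean p k s * c r powr (p/2) \<le> hardy_norm p g powr p"
      using calculation(1,2) calculation(3)[OF s(2)]
    proof eventually_elim
      case (elim r)
      have "hardy_mean p k s * c r powr (p/2) \<le> hardy_mean p k r * c r powr (p/2)"
        using elim by (intro mult_right_mono hardy_mean_mono k s p) auto
      also have "\<dots> \<le> hardy_norm p g powr p" using elim s by (intro bound) auto
      finally show ?case .
    qed
  qed auto
  have "k \<in> hardy_space p" by (rule hardy_space_memI[OF k _ kmean]) (auto simp: k_def)
  moreover have "hardy_norm p k \<le> hardy_norm p g" by (rule hardy_norm_le[OF kmean hardy_norm_nonneg p k])
  ultimately show ?thesis using that gk by blast
qed

text \<open>Among the factorisations \<open>f = B g\<close> with \<open>\<bar>B\<bar> \<le> 1\<close> and \<open>g\<close> no larger than \<open>f\<close> in norm, one that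
  maximises \<open>\<bar>g z0\<bar>\<close> has no zeros in \<open>g\<close>: dividing by a Blaschke factor would increase \<open>\<bar>g z0\<bar>\<close>.
  This avoids infinite Blaschke products.\<close>

lemma hardy_nonvanishing_factor:
  assumes f: "f \<in> hardy_space p" and p: "1 \<le> p" and z0: "z0 \<in> unit_disc" "f z0 \<noteq> 0"
  obtains B g where "g \<in> hardy_space p" "B holomorphic_on unit_disc"
    "\<And>z. z \<in> unit_disc \<Longrightarrow> cmod (B z) \<le> 1" "\<And>z. z \<in> unit_disc \<Longrightarrow> f z = B z * g z"
    "\<And>z. z \<in> unit_disc \<Longrightarrow> g z \<noteq> 0"
proof -
  define Q where "Q g B \<longleftrightarrow> g \<in> hardy_space p \<and> hardy_norm p g \<le> hardy_norm p f \<and>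
    B holomorphic_on unit_disc \<and> (\<forall>z\<in>unit_disc. cmod (B z) \<le> 1 \<and> f z = B z * g z)" for g B
  define A where "A = {cmod (g z0) | g B. Q g B}"
  have "Q f (\<lambda>_. 1)" using f by (simp add: Q_def)
  then have fA: "cmod (f z0) \<in> A" by (auto simp: A_def)
  have bdd: "bdd_above A"
  proof (rule bdd_aboveI)
    fix x assume "x \<in> A"
    then obtain g B where x: "x = cmod (g z0)" and "Q g B" by (auto simp: A_def)
    then have g: "g \<in> hardy_space p" "hardy_norm p g \<le> hardy_norm p f" by (auto simp: Q_def)
    have "cmod (g z0) \<le> (2 / (1 - cmod z0)) powr (1/p) * hardy_norm p g"
      using z0 by (intro cmod_le_hardy_norm g p) auto
    also have "\<dots> \<le> (2 / (1 - cmod z0)) powr (1/p) * hardy_norm p f" by (intro mult_left_mono g) auto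
    finally show "x \<le> (2 / (1 - cmod z0)) powr (1/p) * hardy_norm p f" using x by simp
  qed
  define L where "L = Sup A"
  have L: "x \<le> L" if "x \<in> A" for x unfolding L_def by (rule cSup_upper[OF that bdd])
  have Lpos: "0 < L" using L[OF fA] z0 by (meson less_le_trans zero_less_norm_iff)
  have "\<exists>g B. Q g B \<and> L - 1 / Suc n < cmod (g z0)" for n :: nat
  proof -
    have "L - 1 / Suc n < Sup A" by (simp add: L_def)
    then obtain x where "x \<in> A" "L - 1 / Suc n < x" using less_cSup_iff[OF _ bdd] fA by blast
    then show ?thesis by (auto simp: A_def)
  qed
  then obtain G B where GB: "\<And>n. Q (G n) (B n)" "\<And>n::nat. L - 1 / Suc n < cmod (G n z0)" by metis
  \<comment> \<open>The extremal pair is a limit of a maximising sequence: first the functions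
    \<open>G n\<close> converge along a subsequence, then the bounded factors \<open>B n\<close>
    along a further one.\<close>
  obtain g r where g: "g \<in> hardy_space p" "hardy_norm p g \<le> hardy_norm p f" and r: "strict_mono (r::nat \<Rightarrow> nat)"
    and glim: "\<And>z. (\<lambda>n. G (r n) z) \<longlonglongrightarrow> g z"
    using hardy_montel[of G p "hardy_norm p f"] GB(1) p unfolding Q_def by blast
  obtain b s where b: "b holomorphic_on unit_disc" and s: "strict_mono (s::nat \<Rightarrow> nat)"
      and blim: "\<And>x. x \<in> unit_disc \<Longrightarrow> ((\<lambda>n. B (r (s n)) x) \<longlongrightarrow> b x) sequentially"
  proof (rule Montel[of unit_disc "range B" "\<lambda>n. B (r n)"])
    fix C :: "complex set" assume C: "compact C" "C \<subseteq> unit_disc"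
    have "cmod (B n z) \<le> 1" if "z \<in> C" for n z using GB(1)[of n] that C by (auto simp: Q_def)
    then show "\<exists>M. \<forall>h\<in>range B. \<forall>z\<in>C. cmod (h z) \<le> M" by blast
  qed (use GB(1) in \<open>auto simp: Q_def\<close>)
  have glim': "(\<lambda>n. G (r (s n)) z) \<longlonglongrightarrow> g z" for z
    using LIMSEQ_subseq_LIMSEQ[OF glim s] by (simp add: o_def)
  have b1: "cmod (b z) \<le> 1" if z: "z \<in> unit_disc" for z
    by (rule LIMSEQ_le_const2[OF tendsto_norm[OF blim[OF z]]]) (use GB(1) z in \<open>auto simp: Q_def\<close>)
  have fbg: "f z = b z * g z" if z: "z \<in> unit_disc" for z
  proof (rule LIMSEQ_unique)
    show "(\<lambda>n. B (r (s n)) z * G (r (s n)) z) \<longlonglongrightarrow> b z * g z" by (intro tendsto_mult blim z glim')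
    have "B (r (s n)) z * G (r (s n)) z = f z" for n using GB(1)[of "r (s n)"] z by (auto simp: Q_def)
    then show "(\<lambda>n. B (r (s n)) z * G (r (s n)) z) \<longlonglongrightarrow> f z" by simp
  qed
  have "L \<le> cmod (g z0)"
  proof (rule LIMSEQ_le[OF _ tendsto_norm[OF glim]])
    have "(\<lambda>n. L - 1 / Suc n) \<longlonglongrightarrow> L - 0" by (intro tendsto_intros LIMSEQ_Suc[OF lim_1_over_n])
    then show "(\<lambda>n. L - 1 / Suc (r n)) \<longlonglongrightarrow> L" using LIMSEQ_subseq_LIMSEQ[OF _ r] by (auto simp: o_def)
    show "\<exists>N. \<forall>n\<ge>N. L - 1 / Suc (r n) \<le> cmod (G (r n) z0)" using GB(2) less_imp_le by blast
  qed
  have "g a \<noteq> 0" if a: "a \<in> unit_disc" for a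
  proof
    assume "g a = 0"
    have a1: "cmod a < 1" using a by simp
    obtain k where k: "k \<in> hardy_space p" "hardy_norm p k \<le> hardy_norm p g"
      and gk: "\<And>z. z \<in> unit_disc \<Longrightarrow> g z = (z - a) / (1 - cnj a * z) * k z"
      using hardy_divide_blaschke[OF g(1) a1 \<open>g a = 0\<close> p] by metis
    define B' where "B' z = b z * ((z - a) / (1 - cnj a * z))" for z
    have "Q k B'" unfolding Q_def
    proof (intro conjI ballI)
      show "B' holomorphic_on unit_disc" unfolding B'_def
        by (intro holomorphic_on_mult b blaschke_factor_holomorphic a1)
      fix z :: complex assume z: "z \<in> unit_disc"
      have "cmod (b z) * cmod ((z - a) / (1 - cnj a * z)) \<le> 1 * 1"
        using blaschke_norm_less_1[OF a1, of z] z by (intro mult_mono b1) auto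
      then show "cmod (B' z) \<le> 1" by (simp only: B'_def norm_mult mult_1)
      show "f z = B' z * k z" using fbg[OF z] gk[OF z] by (simp add: B'_def)
    qed (use k g in auto)
    then have "cmod (k z0) \<le> L" by (intro L) (auto simp: A_def)
    \<comment> \<open>Strict because the Blaschke factor has modulus below 1 at \<open>z0\<close>,
      and \<open>g z0\<close>, hence \<open>k z0\<close>, is not 0.\<close>
    moreover have "cmod (g z0) < 1 * cmod (k z0)"
    proof -
      have "k z0 \<noteq> 0" using gk[OF z0(1)] \<open>L \<le> cmod (g z0)\<close> Lpos by auto
      then show ?thesis
        unfolding gk[OF z0(1)] norm_mult using blaschke_norm_less_1[OF a1, of z0] z0(1)
        by (intro mult_strict_right_mono) auto
    qed
    ultimately show False using \<open>L \<le> cmod (g z0)\<close> by simp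
  qed
  then show ?thesis using that[OF g(1) b b1 fbg] by blast
qed

text \<open>The zero-free factor has a holomorphic square root on the simply connected disc; one
  copy of the root takes \<open>B\<close> along, which does not increase its modulus.\<close>

lemma hardy_factorization:
  assumes f: "f \<in> hardy_space p" and p: "1 \<le> p"
  obtains u v where "u \<in> hardy_space (2*p)" "v \<in> hardy_space (2*p)" "f = (\<lambda>z. u z * v z)"
proof (cases "\<exists>z0\<in>unit_disc. f z0 \<noteq> 0")
  case False
  then have "f = (\<lambda>z. 0 * 0)" using hardy_spaceD(2)[OF f] by (auto simp: fun_eq_iff)
  then show ?thesis using that zero_in_hardy_space[of "2*p"] p by auto
next
  case True
  then obtain z0 where z0: "z0 \<in> unit_disc" "f z0 \<noteq> 0" by blast
  obtain B g where g: "g \<in> hardy_space p" and B: "B holomorphic_on unit_disc"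
    "\<And>z. z \<in> unit_disc \<Longrightarrow> cmod (B z) \<le> 1" and fBg: "\<And>z. z \<in> unit_disc \<Longrightarrow> f z = B z * g z"
    and nz: "\<And>z. z \<in> unit_disc \<Longrightarrow> g z \<noteq> 0"
    using hardy_nonvanishing_factor[OF f p z0] by metis
  obtain k0 where k0: "k0 holomorphic_on unit_disc" "\<And>z. z \<in> unit_disc \<Longrightarrow> g z = (k0 z)\<^sup>2"
    using hardy_spaceD(1)[OF g] nz simply_connected_eq_holomorphic_sqrt[OF open_ball, of "0::complex" 1]
      convex_imp_simply_connected[OF convex_ball, of "0::complex" 1] by blast
  define v where "v z = (if z \<in> unit_disc then k0 z else 0)" for z
  define u where "u z = B z * v z" for z
  have v: "v holomorphic_on unit_disc" by (rule holomorphic_transform[OF k0(1)]) (simp add: v_def)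
  have u: "u holomorphic_on unit_disc" unfolding u_def by (intro holomorphic_intros B v)
  have vmean: "hardy_mean (2*p) v r \<le> hardy_norm p g powr p" if r: "0 < r" "r < 1" for r
  proof -
    have "cmod (v z) powr (2*p) = cmod (g z) powr p" if "z \<in> unit_disc" for z
    proof (cases "v z = 0")
      case True then show ?thesis using that k0(2)[OF that] by (simp add: v_def)
    next
      case False
      have "cmod (g z) = cmod (v z) ^ 2" using that k0(2)[OF that] by (simp add: v_def norm_power)
      also have "\<dots> = cmod (v z) powr 2" using False by simp
      finally show ?thesis by (simp only: powr_powr)
    qed
    then have "hardy_mean (2*p) v r = hardy_mean p g r"
      unfolding hardy_mean_def using r by (intro integral_cong) (auto simp: norm_mult)
    then show ?thesis using hardy_mean_le_norm[OF g p r] by simp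
  qed
  have umean: "hardy_mean (2*p) u r \<le> hardy_norm p g powr p" if r: "0 < r" "r < 1" for r
  proof -
    have "hardy_mean (2*p) u r \<le> hardy_mean (2*p) v r" unfolding hardy_mean_def
    proof (rule integral_le)
      fix t
      have "cmod (B (of_real r * cis t)) * cmod (v (of_real r * cis t)) \<le> 1 * cmod (v (of_real r * cis t))"
        using r by (intro mult_right_mono B circle_point_in_disc) auto
      then show "cmod (u (of_real r * cis t)) powr (2*p) \<le> cmod (v (of_real r * cis t)) powr (2*p)"
        using p by (intro powr_mono2) (auto simp: u_def norm_mult)
    qed (use r p holomorphic_on_imp_continuous_on[OF u] holomorphic_on_imp_continuous_on[OF v] in \<open>auto intro!: hardy_mean_integrable\<close>)
    then show ?thesis using vmean[OF r] by simp
  qed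
  have "u \<in> hardy_space (2*p)" by (rule hardy_space_memI[OF u _ umean]) (auto simp: u_def v_def)
  moreover have "v \<in> hardy_space (2*p)" by (rule hardy_space_memI[OF v _ vmean]) (auto simp: v_def)
  moreover have "f = (\<lambda>z. u z * v z)"
    using fBg k0(2) hardy_spaceD(2)[OF f] by (auto simp: fun_eq_iff u_def v_def power2_eq_square)
  ultimately show ?thesis using that by blast
qed

section \<open>Dilations and the density of polynomials\<close>

lemma hardy_dilation:
  assumes f: "f \<in> hardy_space p" and p: "1 \<le> p" and s: "0 < s" "s < 1"
  defines "fs \<equiv> \<lambda>z. if z \<in> unit_disc then f (of_real s * z) else 0"
  shows "fs \<in> hardy_space p" "hardy_norm p fs \<le> hardy_norm p f"
proof -
  have sz: "of_real s * z \<in> unit_disc" if "z \<in> unit_disc" for z :: complex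
  proof -
    have "s * cmod z < 1 * 1" using that s by (intro mult_strict_mono) auto
    then show ?thesis using s by (simp add: norm_mult)
  qed
  have "(\<lambda>z. f (of_real s * z)) holomorphic_on unit_disc"
    by (rule holomorphic_on_compose_gen[of "\<lambda>z. of_real s * z" _ f unit_disc, unfolded o_def])
      (use sz in \<open>auto intro!: holomorphic_intros hardy_spaceD[OF f]\<close>)
  then have hol: "fs holomorphic_on unit_disc" by (rule holomorphic_transform) (simp add: fs_def)
  have "hardy_mean p fs r \<le> hardy_norm p f powr p" if r: "0 < r" "r < 1" for r
  proof -
    have sr: "0 < s * r" "s * r < 1" using mult_strict_mono[of s 1 r 1] s r by auto
    have "fs (of_real r * cis t) = f (of_real (s * r) * cis t)" for t
      using r by (simp add: fs_def norm_mult mult.assoc)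
    then have "hardy_mean p fs r = hardy_mean p f (s * r)" by (simp add: hardy_mean_def)
    then show ?thesis using hardy_mean_le_norm[OF f p sr] by simp
  qed
  then show "fs \<in> hardy_space p" "hardy_norm p fs \<le> hardy_norm p f"
    using hol hardy_norm_nonneg[of p f] p by (auto intro!: hardy_space_memI hardy_norm_le simp: fs_def)
qed

text \<open>With the offset 2 the radius lies in the open unit interval already for
  \<open>n = 0\<close>.\<close>

lemma dilation_radius: "0 < 1 - 1 / (real n + 2)" "1 - 1 / (real n + 2) < 1"
  by (auto simp: field_simps)

lemma dilation_radius_tendsto: "(\<lambda>n. 1 - 1 / (real n + 2)) \<longlonglongrightarrow> 1"
  by real_asymp

lemma hardy_dilation_tendsto_ge_2:
  assumes f: "f \<in> hardy_space q" and q: "2 \<le> q"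
  shows "(\<lambda>n. hardy_norm q (\<lambda>z. (if z \<in> unit_disc then f (of_real (1 - 1 / (real n + 2)) * z) else 0) - f z)) \<longlonglongrightarrow> 0"
proof (rule hardy_norm_convergence[OF _ f q])
  have q1: "1 \<le> q" using q by simp
  show "(\<lambda>z. if z \<in> unit_disc then f (of_real (1 - 1 / (real n + 2)) * z) else 0) \<in> hardy_space q"
    "hardy_norm q (\<lambda>z. if z \<in> unit_disc then f (of_real (1 - 1 / (real n + 2)) * z) else 0) \<le> hardy_norm q f" for n
    by (rule hardy_dilation[OF f q1 dilation_radius])+
  fix z :: complex assume z: "z \<in> unit_disc"
  have "(\<lambda>n. complex_of_real (1 - 1 / (real n + 2)) * z) \<longlonglongrightarrow> of_real 1 * z"
    by (intro tendsto_intros dilation_radius_tendsto)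
  moreover have "isCont f z"
    using hardy_spaceD(4)[OF f] z by (simp add: continuous_on_eq_continuous_at)
  ultimately have "(\<lambda>n. f (of_real (1 - 1 / (real n + 2)) * z)) \<longlonglongrightarrow> f z"
    by (metis isCont_tendsto_compose mult_1 of_real_1)
  then show "(\<lambda>n. if z \<in> unit_disc then f (of_real (1 - 1 / (real n + 2)) * z) else 0) \<longlonglongrightarrow> f z"
    using z by simp
qed

text \<open>Both factors of \<open>f = u v\<close> have exponent \<open>2*p \<ge> 2\<close>, where
  uniform convexity gives convergence of the dilations; the identity
  \<open>U V - u v = (U - u) V + u (V - v)\<close> and Hoelder's inequality transfer it to the
  product. This covers the exponents below 2.\<close>

lemma hardy_dilation_tendsto:
  assumes f: "f \<in> hardy_space p" and p: "1 \<le> p"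
  shows "(\<lambda>n. hardy_norm p (\<lambda>z. (if z \<in> unit_disc then f (of_real (1 - 1 / (real n + 2)) * z) else 0) - f z)) \<longlonglongrightarrow> 0"
proof -
  obtain u v where u: "u \<in> hardy_space (2*p)" and v: "v \<in> hardy_space (2*p)" and fuv: "f = (\<lambda>z. u z * v z)"
    using hardy_factorization[OF f p] by blast
  define U where "U n z = (if z \<in> unit_disc then u (of_real (1 - 1 / (real n + 2)) * z) else 0)" for n z
  define V where "V n z = (if z \<in> unit_disc then v (of_real (1 - 1 / (real n + 2)) * z) else 0)" for n z
  have p2: "2 \<le> 2 * p" "1 \<le> 2 * p" using p by auto
  have U: "U n \<in> hardy_space (2*p)" and V: "V n \<in> hardy_space (2*p)" "hardy_norm (2*p) (V n) \<le> hardy_norm (2*p) v" for n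
    unfolding U_def V_def by (rule hardy_dilation[OF u p2(2) dilation_radius] hardy_dilation[OF v p2(2) dilation_radius])+
  have Ulim: "(\<lambda>n. hardy_norm (2*p) (\<lambda>z. U n z - u z)) \<longlonglongrightarrow> 0"
    unfolding U_def by (rule hardy_dilation_tendsto_ge_2[OF u p2(1)])
  have Vlim: "(\<lambda>n. hardy_norm (2*p) (\<lambda>z. V n z - v z)) \<longlonglongrightarrow> 0"
    unfolding V_def by (rule hardy_dilation_tendsto_ge_2[OF v p2(1)])
  let ?F = "\<lambda>n z. (if z \<in> unit_disc then f (of_real (1 - 1 / (real n + 2)) * z) else 0) - f z"
  have bound: "hardy_norm p (?F n) \<le> hardy_norm (2*p) (\<lambda>z. U n z - u z) * hardy_norm (2*p) v
      + hardy_norm (2*p) u * hardy_norm (2*p) (\<lambda>z. V n z - v z)" for n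
  proof -
    note dU = hardy_diff(1)[OF U[of n] u p2(2)] and dV = hardy_diff(1)[OF V(1)[of n] v p2(2)]
    have "?F n = (\<lambda>z. (U n z - u z) * V n z + u z * (V n z - v z))"
      unfolding fuv U_def V_def by (intro ext) (simp split: if_split, simp add: algebra_simps)
    then have "hardy_norm p (?F n) \<le> hardy_norm p (\<lambda>z. (U n z - u z) * V n z) + hardy_norm p (\<lambda>z. u z * (V n z - v z))"
      using hardy_add(2)[OF hardy_mult(1)[OF dU V(1)[of n] p] hardy_mult(1)[OF u dV p] p] by simp
    also have "\<dots> \<le> hardy_norm (2*p) (\<lambda>z. U n z - u z) * hardy_norm (2*p) (V n)
       + hardy_norm (2*p) u * hardy_norm (2*p) (\<lambda>z. V n z - v z)"
      by (intro add_mono hardy_mult dU dV u V p)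
    also have "\<dots> \<le> hardy_norm (2*p) (\<lambda>z. U n z - u z) * hardy_norm (2*p) v
       + hardy_norm (2*p) u * hardy_norm (2*p) (\<lambda>z. V n z - v z)"
      by (intro add_mono mult_left_mono V hardy_norm_nonneg order_refl)
    finally show ?thesis .
  qed
  have "(\<lambda>n. hardy_norm (2*p) (\<lambda>z. U n z - u z) * hardy_norm (2*p) v
      + hardy_norm (2*p) u * hardy_norm (2*p) (\<lambda>z. V n z - v z)) \<longlonglongrightarrow> 0 * hardy_norm (2*p) v + hardy_norm (2*p) u * 0"
    by (intro tendsto_intros Ulim Vlim)
  then have "(\<lambda>n. hardy_norm (2*p) (\<lambda>z. U n z - u z) * hardy_norm (2*p) v
      + hardy_norm (2*p) u * hardy_norm (2*p) (\<lambda>z. V n z - v z)) \<longlonglongrightarrow> 0" by simp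
  then show ?thesis
    by (rule tendsto_sandwich[OF always_eventually[OF allI[OF hardy_norm_nonneg]] always_eventually[OF allI[OF bound]] tendsto_const])
qed

definition closed_subspace :: "real \<Rightarrow> (complex \<Rightarrow> complex) set \<Rightarrow> bool"
  where "closed_subspace p E \<longleftrightarrow> E \<subseteq> hardy_space p \<and> (\<lambda>_. 0) \<in> E \<and>
    (\<forall>f\<in>E. \<forall>g\<in>E. (\<lambda>z. f z + g z) \<in> E) \<and> (\<forall>c. \<forall>f\<in>E. (\<lambda>z. c * f z) \<in> E) \<and>
    (\<forall>f\<in>hardy_space p. (\<forall>e>0. \<exists>g\<in>E. hardy_norm p (\<lambda>z. g z - f z) < e) \<longrightarrow> f \<in> E)"

lemma closed_subspace_approx:
  assumes "closed_subspace p E" "f \<in> hardy_space p"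
    "\<And>e. 0 < e \<Longrightarrow> \<exists>g\<in>E. hardy_norm p (\<lambda>z. g z - f z) < e"
  shows "f \<in> E"
  using assms unfolding closed_subspace_def by blast

lemma closed_subspace_sum:
  assumes "closed_subspace p E" "\<And>i. i \<in> I \<Longrightarrow> f i \<in> E"
  shows "(\<lambda>z. \<Sum>i\<in>I. c i * f i z) \<in> E"
proof (cases "finite I")
  case True
  then show ?thesis using assms(2)
    by (induction I rule: finite_induct) (use assms(1) in \<open>auto simp: closed_subspace_def\<close>)
qed (use assms(1) in \<open>simp add: closed_subspace_def\<close>)

lemma closed_subspace_limit:
  assumes "closed_subspace p E" "\<And>n::nat. g n \<in> E" "f \<in> hardy_space p"
    "(\<lambda>n. hardy_norm p (\<lambda>z. g n z - f z)) \<longlonglongrightarrow> 0"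
  shows "f \<in> E"
proof -
  have "\<exists>g\<in>E. hardy_norm p (\<lambda>z. g z - f z) < e" if "0 < e" for e
    using order_tendstoD(2)[OF assms(4) that] assms(2) unfolding eventually_sequentially by blast
  then show ?thesis by (rule closed_subspace_approx[OF assms(1,3)])
qed

text \<open>A dilation of \<open>f\<close> is holomorphic beyond the closed disc, so its Taylor
  polynomials converge uniformly on the disc and hence in norm; the dilations in turn converge to
  \<open>f\<close>.\<close>

lemma hardy_dense_if_monomials:
  assumes E: "closed_subspace p E" and p: "1 \<le> p"
    and mono: "\<And>k. (\<lambda>z. if z \<in> unit_disc then z ^ k else 0) \<in> E"
    and f: "f \<in> hardy_space p"
  shows "f \<in> E"
proof (rule closed_subspace_limit[OF E _ f hardy_dilation_tendsto[OF f p]])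
  fix n
  define s where "s = 1 - 1 / (real n + 2)"
  have s: "0 < s" "s < 1" unfolding s_def by (rule dilation_radius)+
  define a where "a k = (deriv ^^ k) f 0 / fact k" for k
  have sums: "(\<lambda>k. a k * w ^ k) sums f w" if "w \<in> unit_disc" for w
    using holomorphic_power_series[OF hardy_spaceD(1)[OF f] that] by (simp add: a_def)
  \<comment> \<open>Convergence of the series at a point beyond \<open>s\<close> gives absolute
    convergence at \<open>s\<close>, the majorant for the M-test.\<close>
  define s' where "s' = (s + 1) / 2"
  have s': "s < s'" "s' < 1" using s by (auto simp: s'_def)
  have "summable (\<lambda>k. a k * of_real s' ^ k)" using sums[of "of_real s'"] s s' by (auto simp: sums_iff)
  then have summ: "summable (\<lambda>k. norm (a k * of_real s ^ k))"
    by (rule powser_insidea) (use s s' in auto)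
  have unif: "uniform_limit unit_disc (\<lambda>N z. \<Sum>k<N. a k * (of_real s * z) ^ k) (\<lambda>z. \<Sum>k. a k * (of_real s * z) ^ k) sequentially"
  proof (rule Weierstrass_m_test[OF _ summ])
    fix k and z :: complex assume "z \<in> unit_disc"
    then have "cmod z ^ k \<le> 1" by (intro power_le_one) auto
    then show "norm (a k * (of_real s * z) ^ k) \<le> norm (a k * of_real s ^ k)"
      using mult_left_mono[of "cmod z ^ k" 1 "cmod (a k) * s ^ k"] s
      by (simp add: norm_mult norm_power power_mult_distrib mult.assoc)
  qed
  let ?fs = "\<lambda>z. if z \<in> unit_disc then f (of_real s * z) else 0"
  let ?P = "\<lambda>N z. \<Sum>k<N. (a k * of_real s ^ k) * (if z \<in> unit_disc then z ^ k else 0)"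
  have fs: "?fs \<in> hardy_space p" by (rule hardy_dilation[OF f p s])
  have P: "?P N \<in> E" for N by (intro closed_subspace_sum[OF E] mono)
  then have PH: "?P N \<in> hardy_space p" for N using E by (auto simp: closed_subspace_def)
  have "\<exists>g\<in>E. hardy_norm p (\<lambda>z. g z - ?fs z) < e" if "0 < e" for e
  proof -
    define d where "d = e / (2 * (2 * pi) powr (1/p))"
    have d: "0 < d" using that by (simp add: d_def)
    obtain N where N: "\<And>z. z \<in> unit_disc \<Longrightarrow> dist (\<Sum>k<N. a k * (of_real s * z) ^ k) (\<Sum>k. a k * (of_real s * z) ^ k) < d"
      using uniform_limitD[OF unif d] unfolding eventually_sequentially by blast
    have "cmod (?P N z - ?fs z) \<le> d" if z: "z \<in> unit_disc" for z
    proof -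
      have "of_real s * z \<in> unit_disc"
        using mult_strict_mono[of s 1 "cmod z" 1] z s by (simp add: norm_mult)
      then have "(\<Sum>k. a k * (of_real s * z) ^ k) = f (of_real s * z)" by (rule sums_unique[OF sums, symmetric])
      then show ?thesis using N[OF z] z by (simp add: dist_norm power_mult_distrib mult.assoc)
    qed
    then have "hardy_norm p (\<lambda>z. ?P N z - ?fs z) \<le> (2 * pi) powr (1/p) * d"
      using p hardy_spaceD(1)[OF hardy_diff(1)[OF PH[of N] fs p]] by (intro hardy_bounded) auto
    also have "\<dots> < e" using that by (simp add: d_def)
    finally show ?thesis by (rule bexI[OF _ P])
  qed
  then have "?fs \<in> E" by (rule closed_subspace_approx[OF E fs])
  then show "(\<lambda>z. if z \<in> unit_disc then f (of_real (1 - 1 / (real n + 2)) * z) else 0) \<in> E"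
    unfolding s_def .
qed

section \<open>Operators with a dense span of eigenvectors\<close>

text \<open>Building on the metric of the norm makes total boundedness and closures available;
  completeness enters where total boundedness has to yield relative compactness.\<close>

locale function_banach_space = Metric_space X "\<lambda>f g. N (\<lambda>x. f x - g x)"
  for X :: "('a \<Rightarrow> complex) set" and N :: "('a \<Rightarrow> complex) \<Rightarrow> real" +
  assumes zero_mem: "(\<lambda>_. 0) \<in> X"
    and add_mem: "\<And>f g. f \<in> X \<Longrightarrow> g \<in> X \<Longrightarrow> (\<lambda>x. f x + g x) \<in> X"
    and scale_mem: "\<And>c f. f \<in> X \<Longrightarrow> (\<lambda>x. c * f x) \<in> X"
    and norm_add: "\<And>f g. f \<in> X \<Longrightarrow> g \<in> X \<Longrightarrow> N (\<lambda>x. f x + g x) \<le> N f + N g"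
    and norm_scale: "\<And>c f. f \<in> X \<Longrightarrow> N (\<lambda>x. c * f x) = cmod c * N f"
    and complete: mcomplete
begin

lemma norm_nonneg: "0 \<le> N f"
  using nonneg[of f "\<lambda>_. 0"] by simp

lemma norm_eq_0: "f \<in> X \<Longrightarrow> N f = 0 \<Longrightarrow> f = (\<lambda>_. 0)"
  using zero[of f "\<lambda>_. 0"] zero_mem by simp

lemma norm_zero: "N (\<lambda>_. 0) = 0"
  using norm_scale[OF zero_mem, of 0] by simp

lemma diff_mem: "f \<in> X \<Longrightarrow> g \<in> X \<Longrightarrow> (\<lambda>x. f x - g x) \<in> X"
  using add_mem[of f "\<lambda>x. -1 * g x"] scale_mem[of g "-1"] by simp

lemma sum_mem: "(\<And>i. i \<in> I \<Longrightarrow> f i \<in> X) \<Longrightarrow> (\<lambda>x. \<Sum>i\<in>I. c i * f i x) \<in> X"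
  by (induction I rule: infinite_finite_induct) (auto simp: zero_mem intro!: add_mem scale_mem)

lemma norm_sum_le: "(\<And>i. i \<in> I \<Longrightarrow> f i \<in> X) \<Longrightarrow> N (\<lambda>x. \<Sum>i\<in>I. c i * f i x) \<le> (\<Sum>i\<in>I. cmod (c i) * N (f i))"
proof (induction I rule: infinite_finite_induct)
  case (insert a I)
  have "N (\<lambda>x. c a * f a x + (\<Sum>i\<in>I. c i * f i x)) \<le> N (\<lambda>x. c a * f a x) + N (\<lambda>x. \<Sum>i\<in>I. c i * f i x)"
    using insert.prems by (intro norm_add scale_mem sum_mem) auto
  then show ?case using insert norm_scale[of "f a" "c a"] by fastforce
qed (auto simp: norm_zero)

lemma bounded_operatorsD:
  assumes "T \<in> bounded_operators X N"
  shows "T \<in> X \<rightarrow>\<^sub>E X" "f \<in> X \<Longrightarrow> T f \<in> X"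
    "f \<in> X \<Longrightarrow> g \<in> X \<Longrightarrow> T (\<lambda>x. f x + g x) = (\<lambda>x. T f x + T g x)"
    "f \<in> X \<Longrightarrow> T (\<lambda>x. c * f x) = (\<lambda>x. c * T f x)"
    "\<exists>K\<ge>0. \<forall>f\<in>X. N (T f) \<le> K * N f"
proof -
  obtain K where K: "\<forall>f\<in>X. N (T f) \<le> K * N f"
    using assms by (auto simp: bounded_operators_def)
  have "N (T f) \<le> max K 0 * N f" if "f \<in> X" for f
    using K that mult_right_mono[OF max.cobounded1[of K 0] norm_nonneg[of f]] by force
  then show "\<exists>K\<ge>0. \<forall>f\<in>X. N (T f) \<le> K * N f" by (intro exI[of _ "max K 0"]) auto
qed (use assms in \<open>auto simp: bounded_operators_def\<close>)

lemma bounded_operator_diff: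
  assumes "T \<in> bounded_operators X N" "f \<in> X" "g \<in> X"
  shows "T (\<lambda>x. f x - g x) = (\<lambda>x. T f x - T g x)"
  using bounded_operatorsD(3)[OF assms(1,2) scale_mem[OF assms(3), of "-1"]]
    bounded_operatorsD(4)[OF assms(1,3), of "-1"] by simp

lemma bounded_operator_zero:
  assumes "T \<in> bounded_operators X N"
  shows "T (\<lambda>_. 0) = (\<lambda>_. 0)"
  using bounded_operatorsD(4)[OF assms zero_mem, of 0] by simp

lemma bounded_operator_sum:
  assumes T: "T \<in> bounded_operators X N" and f: "\<And>i. i \<in> I \<Longrightarrow> f i \<in> X"
  shows "T (\<lambda>x. \<Sum>i\<in>I. c i * f i x) = (\<lambda>x. \<Sum>i\<in>I. c i * T (f i) x)"
  using f
proof (induction I rule: infinite_finite_induct)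
  case (insert a I)
  then have "T (\<lambda>x. c a * f a x + (\<Sum>i\<in>I. c i * f i x)) = (\<lambda>x. T (\<lambda>x. c a * f a x) x + T (\<lambda>x. \<Sum>i\<in>I. c i * f i x) x)"
    by (intro bounded_operatorsD(3)[OF T] scale_mem sum_mem) auto
  then show ?case using insert bounded_operatorsD(4)[OF T, of "f a" "c a"] by simp
qed (auto simp: bounded_operator_zero[OF T])

lemma norm_le_operator_norm:
  assumes T: "T \<in> bounded_operators X N" and M: "operator_norm X N T \<le> M" and f: "f \<in> X"
  shows "N (T f) \<le> M * N f"
proof (cases "N f = 0")
  case True
  then have "f = (\<lambda>_. 0)" using f by (rule norm_eq_0[rotated])
  then show ?thesis using bounded_operator_zero[OF T] norm_zero by simp
next
  case False
  then have pos: "0 < N f" using norm_nonneg[of f] by simp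
  obtain K where K: "0 \<le> K" "\<forall>f\<in>X. N (T f) \<le> K * N f" using bounded_operatorsD(5)[OF T] by auto
  define g where "g = (\<lambda>x. of_real (1 / N f) * f x)"
  have g: "g \<in> X" unfolding g_def by (rule scale_mem[OF f])
  have "N g = 1" unfolding g_def using norm_scale[OF f, of "of_real (1 / N f)"] pos by (simp add: norm_divide)
  \<comment> \<open>Without this bound the supremum in \<open>operator_norm\<close> would carry no
    information.\<close>
  have "bdd_above ((\<lambda>f. N (T f)) ` {f \<in> X. N f \<le> 1})"
  proof (rule bdd_aboveI2)
    fix h assume "h \<in> {f \<in> X. N f \<le> 1}"
    then show "N (T h) \<le> K" using K mult_left_mono[of "N h" 1 K] by force
  qed
  then have "N (T g) \<le> operator_norm X N T"
    unfolding operator_norm_def using g \<open>N g = 1\<close> by (intro cSUP_upper) auto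
  moreover have "N (T g) = cmod (of_real (1 / N f)) * N (T f)"
    unfolding g_def bounded_operatorsD(4)[OF T f] by (rule norm_scale[OF bounded_operatorsD(2)[OF T f]])
  ultimately have "N (T f) / N f \<le> M" using M pos by (simp add: norm_divide)
  then show ?thesis using pos by (simp add: field_simps)
qed

lemma funpow_properties:
  assumes T: "T \<in> bounded_operators X N"
  shows "f \<in> X \<Longrightarrow> (T ^^ k) f \<in> X"
    "f \<in> X \<Longrightarrow> g \<in> X \<Longrightarrow> (T ^^ k) (\<lambda>x. f x + g x) = (\<lambda>x. (T ^^ k) f x + (T ^^ k) g x)"
    "f \<in> X \<Longrightarrow> (T ^^ k) (\<lambda>x. c * f x) = (\<lambda>x. c * (T ^^ k) f x)"
    "\<exists>K\<ge>0. \<forall>f\<in>X. N ((T ^^ k) f) \<le> K * N f"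
proof -
  show mem: "f \<in> X \<Longrightarrow> (T ^^ k) f \<in> X" for f k
    by (induction k) (auto intro: bounded_operatorsD(2)[OF T])
  show "f \<in> X \<Longrightarrow> g \<in> X \<Longrightarrow> (T ^^ k) (\<lambda>x. f x + g x) = (\<lambda>x. (T ^^ k) f x + (T ^^ k) g x)"
    by (induction k) (auto simp: bounded_operatorsD(3)[OF T mem mem])
  show "f \<in> X \<Longrightarrow> (T ^^ k) (\<lambda>x. c * f x) = (\<lambda>x. c * (T ^^ k) f x)"
    by (induction k) (auto simp: bounded_operatorsD(4)[OF T mem])
  obtain K where K: "0 \<le> K" "\<forall>f\<in>X. N (T f) \<le> K * N f" using bounded_operatorsD(5)[OF T] by auto
  have "N ((T ^^ k) f) \<le> K ^ k * N f" if "f \<in> X" for f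
  proof (induction k)
    case (Suc k)
    have "N ((T ^^ Suc k) f) \<le> K * N ((T ^^ k) f)" using K mem[OF that] by simp
    also have "\<dots> \<le> K * (K ^ k * N f)" by (rule mult_left_mono[OF Suc K(1)])
    finally show ?case by simp
  qed simp
  then show "\<exists>K\<ge>0. \<forall>f\<in>X. N ((T ^^ k) f) \<le> K * N f" using K(1) by (intro exI[of _ "K ^ k"]) auto
qed

lemma poly_operator_bounded:
  assumes T: "T \<in> bounded_operators X N"
  shows "poly_operator X q T \<in> bounded_operators X N"
proof -
  let ?P = "\<lambda>f x. \<Sum>k\<le>degree q. coeff q k * (T ^^ k) f x"
  have P: "poly_operator X q T f = ?P f" if "f \<in> X" for f using that by (simp add: poly_operator_def)
  have mem: "?P f \<in> X" if "f \<in> X" for f by (intro sum_mem funpow_properties[OF T] that)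
  have "\<exists>K. \<forall>k. 0 \<le> K k \<and> (\<forall>f\<in>X. N ((T ^^ k) f) \<le> K k * N f)"
    using funpow_properties(4)[OF T] by metis
  then obtain K where K: "\<And>k. 0 \<le> K k" "\<And>k f. f \<in> X \<Longrightarrow> N ((T ^^ k) f) \<le> K k * N f" by auto
  have "N (?P f) \<le> (\<Sum>k\<le>degree q. cmod (coeff q k) * K k) * N f" if "f \<in> X" for f
  proof -
    have "N (?P f) \<le> (\<Sum>k\<le>degree q. cmod (coeff q k) * N ((T ^^ k) f))"
      by (intro norm_sum_le funpow_properties[OF T] that)
    also have "\<dots> \<le> (\<Sum>k\<le>degree q. cmod (coeff q k) * (K k * N f))"
      by (intro sum_mono mult_left_mono K that) auto
    finally show ?thesis by (simp add: sum_distrib_right mult.assoc)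
  qed
  then have "\<exists>K. \<forall>f\<in>X. N (poly_operator X q T f) \<le> K * N f"
    by (intro exI[of _ "\<Sum>k\<le>degree q. cmod (coeff q k) * K k"] ballI) (simp only: P)
  moreover have "poly_operator X q T \<in> X \<rightarrow>\<^sub>E X"
    unfolding poly_operator_def by (rule restrict_PiE_iff[THEN iffD2]) (intro ballI mem)
  moreover have "poly_operator X q T (\<lambda>x. f x + g x) = (\<lambda>x. poly_operator X q T f x + poly_operator X q T g x)"
    if "f \<in> X" "g \<in> X" for f g
    unfolding P[OF add_mem[OF that]] P[OF that(1)] P[OF that(2)] funpow_properties(2)[OF T that] distrib_left sum.distrib ..
  moreover have "poly_operator X q T (\<lambda>x. c * f x) = (\<lambda>x. c * poly_operator X q T f x)" if "f \<in> X" for f c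
    unfolding P[OF scale_mem[OF that]] P[OF that] funpow_properties(3)[OF T that] sum_distrib_left
    by (simp only: mult.left_commute)
  ultimately show ?thesis unfolding bounded_operators_def by blast
qed

lemma poly_operator_eigenvector:
  assumes f: "f \<in> X" "T f = (\<lambda>x. \<mu> * f x)" and T: "T \<in> bounded_operators X N"
  shows "poly_operator X q T f = (\<lambda>x. poly q \<mu> * f x)"
proof -
  have "(T ^^ k) f = (\<lambda>x. \<mu> ^ k * f x)" for k
  proof (induction k)
    case (Suc k)
    have "(T ^^ Suc k) f = (\<lambda>x. \<mu> ^ k * (\<mu> * f x))"
      using Suc bounded_operatorsD(4)[OF T f(1), of "\<mu> ^ k"] by (simp add: f(2))
    then show ?case by (simp add: mult_ac)
  qed simp
  then show ?thesis using f(1) by (simp add: poly_operator_def poly_altdef sum_distrib_right mult.assoc)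
qed

text \<open>Membership in the closed linear span of \<open>S\<close>, with the vectors of
  \<open>S\<close> serving as their own indices.\<close>

definition approximable_by :: "('a \<Rightarrow> complex) set \<Rightarrow> ('a \<Rightarrow> complex) \<Rightarrow> bool"
  where "approximable_by S f \<longleftrightarrow> (\<forall>\<epsilon>>0. \<exists>I c. finite I \<and> I \<subseteq> S \<and> N (\<lambda>x. f x - (\<Sum>e\<in>I. c e * e x)) < \<epsilon>)"

lemma eigenvalue_bound:
  assumes "e \<in> X" "A \<in> bounded_operators X N" "operator_norm X N A \<le> M" "A e = (\<lambda>x. \<nu> * e x)"
    "N e \<noteq> 0"
  shows "cmod \<nu> \<le> M"
  using norm_le_operator_norm[OF assms(2,3,1)] norm_scale[OF assms(1), of \<nu>] norm_nonneg[of e] assms(4,5) by simp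

text \<open>On a finite combination of eigenvectors an operator of the family is determined by
  finitely many eigenvalues in the disc of radius \<open>M\<close>. Sorting these into a grid gives
  finitely many classes, and operators of one class nearly agree at \<open>f\<close>.\<close>

lemma eigenvector_orbit_totally_bounded:
  assumes S: "S \<subseteq> X" and A: "\<A> \<subseteq> bounded_operators X N"
    and M: "\<And>A. A \<in> \<A> \<Longrightarrow> operator_norm X N A \<le> M" and M0: "0 \<le> M"
    and eig: "\<And>A e. A \<in> \<A> \<Longrightarrow> e \<in> S \<Longrightarrow> \<exists>\<nu>. A e = (\<lambda>x. \<nu> * e x)"
    and f: "f \<in> X" "approximable_by S f"
  shows "mtotally_bounded ((\<lambda>A. A f) ` \<A>)"
  unfolding mtotally_bounded_def
proof (intro allI impI)
  fix \<epsilon> :: real assume \<epsilon>: "0 < \<epsilon>"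
  \<comment> \<open>Makes \<open>M * d\<close> at most \<open>\<epsilon> / 4\<close>, the cost of
    replacing \<open>f\<close> by its finite approximation under one operator; the
    \<open>+ 1\<close> allows \<open>M = 0\<close>.\<close>
  define d where "d = \<epsilon> / 4 / (M + 1)"
  have d: "0 < d" using \<epsilon> M0 by (simp add: d_def)
  obtain I c where I: "finite I" "I \<subseteq> S" and Nd: "N (\<lambda>x. f x - (\<Sum>e\<in>I. c e * e x)) < d"
    using f(2) d unfolding approximable_by_def by blast
  define g where "g = (\<lambda>x. \<Sum>e\<in>I. c e * e x)"
  have IX: "e \<in> X" if "e \<in> I" for e using that I S by auto
  have g: "g \<in> X" unfolding g_def by (rule sum_mem) (rule IX)
  have "\<exists>\<nu>. A e = (\<lambda>x. \<nu> * e x) \<and> cmod \<nu> \<le> M" if Ae: "A \<in> \<A>" "e \<in> I" for A e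
  \<comment> \<open>Every number is an eigenvalue for the zero vector; 0 is chosen so as to respect
    the bound \<open>M\<close>.\<close>
  proof (cases "N e = 0")
    case True
    then have "e = (\<lambda>_. 0)" using IX[OF Ae(2)] norm_eq_0 by auto
    then show ?thesis using bounded_operator_zero[of A] Ae A M0 by (intro exI[of _ 0]) auto
  next
    case False
    obtain \<nu> where nu: "A e = (\<lambda>x. \<nu> * e x)" using eig Ae I by blast
    show ?thesis using eigenvalue_bound[OF IX[OF Ae(2)] _ M[OF Ae(1)] nu False] A Ae(1) nu by blast
  qed
  then obtain \<nu> where \<nu>: "\<And>A e. A \<in> \<A> \<Longrightarrow> e \<in> I \<Longrightarrow> A e = (\<lambda>x. \<nu> A e * e x)"
    and \<nu>M: "\<And>A e. A \<in> \<A> \<Longrightarrow> e \<in> I \<Longrightarrow> cmod (\<nu> A e) \<le> M" by metis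
  define C where "C = (\<Sum>e\<in>I. cmod (c e) * N e)"
  have C: "0 \<le> C" unfolding C_def by (intro sum_nonneg mult_nonneg_nonneg norm_nonneg) auto
  \<comment> \<open>Eigenvalues in one grid square differ by at most \<open>2 * \<delta>\<close>,
    and the choice makes \<open>2 * \<delta> * C\<close> at most
    \<open>\<epsilon> / 4\<close>.\<close>
  define \<delta> where "\<delta> = \<epsilon> / (8 * (C + 1))"
  have \<delta>: "0 < \<delta>" using \<epsilon> C by (simp add: \<delta>_def)
  define \<kappa> where "\<kappa> A = (\<lambda>e\<in>I. (\<lfloor>Re (\<nu> A e) / \<delta>\<rfloor>, \<lfloor>Im (\<nu> A e) / \<delta>\<rfloor>))" for A
  define L where "L = \<lceil>M / \<delta>\<rceil> + 1"
  have fin: "finite (\<kappa> ` \<A>)"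
  proof (rule finite_subset)
    have "\<lfloor>x / \<delta>\<rfloor> \<in> {-L..L}" if "\<bar>x\<bar> \<le> M" for x
    proof -
      have "-(M / \<delta>) \<le> x / \<delta>" "x / \<delta> \<le> M / \<delta>" using that \<delta> by (auto simp: field_simps)
      then show ?thesis unfolding L_def by (auto; linarith)
    qed
    note box = this
    have "\<lfloor>Re (\<nu> A e) / \<delta>\<rfloor> \<in> {-L..L} \<and> \<lfloor>Im (\<nu> A e) / \<delta>\<rfloor> \<in> {-L..L}" if "A \<in> \<A>" "e \<in> I" for A e
      using box[OF order_trans[OF abs_Re_le_cmod \<nu>M[OF that]]] box[OF order_trans[OF abs_Im_le_cmod \<nu>M[OF that]]] ..
    then have "\<kappa> A \<in> I \<rightarrow>\<^sub>E {-L..L} \<times> {-L..L}" if "A \<in> \<A>" for A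
      unfolding \<kappa>_def restrict_PiE_iff using that by simp
    then show "\<kappa> ` \<A> \<subseteq> I \<rightarrow>\<^sub>E {-L..L} \<times> {-L..L}" by (rule image_subsetI)
    show "finite (I \<rightarrow>\<^sub>E {-L..L} \<times> {-L..L})" by (intro finite_PiE I) auto
  qed
  have close: "N (\<lambda>x. A f x - A' f x) < \<epsilon>" if AA: "A \<in> \<A>" "A' \<in> \<A>" and eq: "\<kappa> A = \<kappa> A'" for A A'
  proof -
    have bo: "A \<in> bounded_operators X N" "A' \<in> bounded_operators X N" using AA A by auto
    have fg: "(\<lambda>x. f x - g x) \<in> X" by (rule diff_mem[OF f(1) g])
    have \<nu>d: "cmod (\<nu> A e - \<nu> A' e) \<le> 2 * \<delta>" if e: "e \<in> I" for e
    proof -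
      have fl: "\<bar>x - y\<bar> \<le> \<delta>" if "\<lfloor>x / \<delta>\<rfloor> = \<lfloor>y / \<delta>\<rfloor>" for x y
      proof -
        have "\<bar>x / \<delta> - y / \<delta>\<bar> \<le> 1" using that by linarith
        moreover have "\<bar>x - y\<bar> = \<bar>x / \<delta> - y / \<delta>\<bar> * \<delta>"
          using \<delta> by (simp add: diff_divide_distrib[symmetric])
        ultimately show ?thesis using mult_right_mono[of "\<bar>x / \<delta> - y / \<delta>\<bar>" 1 \<delta>] \<delta> by simp
      qed
      have "\<kappa> A e = \<kappa> A' e" using eq by simp
      then have "\<bar>Re (\<nu> A e) - Re (\<nu> A' e)\<bar> \<le> \<delta>" "\<bar>Im (\<nu> A e) - Im (\<nu> A' e)\<bar> \<le> \<delta>"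
        using e by (auto simp: \<kappa>_def intro!: fl)
      then show ?thesis using cmod_le[of "\<nu> A e - \<nu> A' e"] by simp
    qed
    have Ag: "B g x = (\<Sum>e\<in>I. c e * (\<nu> B e * e x))" if "B \<in> \<A>" "B \<in> bounded_operators X N" for B x
      using bounded_operator_sum[OF that(2), of I "\<lambda>e. e" c, OF IX] \<nu>[OF that(1)] unfolding g_def by simp
    have "(\<lambda>x. A g x - A' g x) = (\<lambda>x. \<Sum>e\<in>I. (c e * (\<nu> A e - \<nu> A' e)) * e x)"
      unfolding Ag[OF AA(1) bo(1)] Ag[OF AA(2) bo(2)] sum_subtractf[symmetric] by (simp only: algebra_simps)
    then have "N (\<lambda>x. A g x - A' g x) \<le> (\<Sum>e\<in>I. cmod (c e * (\<nu> A e - \<nu> A' e)) * N e)"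
      by (simp only:) (rule norm_sum_le[OF IX])
    also have "\<dots> \<le> (\<Sum>e\<in>I. (cmod (c e) * (2 * \<delta>)) * N e)"
      unfolding norm_mult by (intro sum_mono mult_right_mono mult_left_mono \<nu>d norm_nonneg) auto
    also have "\<dots> = 2 * \<delta> * C" by (simp add: C_def sum_distrib_left mult_ac)
    also have "\<dots> \<le> \<epsilon> / 4" using \<epsilon> C by (simp add: \<delta>_def field_simps)
    finally have 1: "N (\<lambda>x. A g x - A' g x) \<le> \<epsilon> / 4" .
    have Md: "M * N (\<lambda>x. f x - g x) \<le> \<epsilon> / 4"
    proof -
      have "M * N (\<lambda>x. f x - g x) \<le> (M + 1) * d"
        using Nd M0 norm_nonneg by (intro mult_mono) (auto simp: g_def)
      moreover have "M + 1 \<noteq> 0" using M0 by simp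
      then have "(M + 1) * d = \<epsilon> / 4" unfolding d_def by (rule nonzero_mult_div_cancel_left[of _ "\<epsilon> / 4", unfolded times_divide_eq_right[symmetric]])
      ultimately show ?thesis by simp
    qed
    have 2: "N (\<lambda>x. A f x - A g x) \<le> \<epsilon> / 4" "N (\<lambda>x. A' f x - A' g x) \<le> \<epsilon> / 4"
      using norm_le_operator_norm[OF bo(1) M[OF AA(1)] fg] norm_le_operator_norm[OF bo(2) M[OF AA(2)] fg] Md
      unfolding bounded_operator_diff[OF bo(1) f(1) g] bounded_operator_diff[OF bo(2) f(1) g] by linarith+
    note mem = bounded_operatorsD(2)[OF bo(1) f(1)] bounded_operatorsD(2)[OF bo(2) f(1)]
      bounded_operatorsD(2)[OF bo(1) g] bounded_operatorsD(2)[OF bo(2) g]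
    show ?thesis
      using triangle[OF mem(1,3,2)] triangle[OF mem(3,4,2)] 1 2 commute[of "A' g" "A' f"] \<epsilon> by linarith
  qed
  \<comment> \<open>One operator from each class; their values at \<open>f\<close> form the finite
    net.\<close>
  define R where "R = (\<lambda>k. (SOME A. A \<in> \<A> \<and> \<kappa> A = k)) ` (\<kappa> ` \<A>)"
  have R: "(SOME A'. A' \<in> \<A> \<and> \<kappa> A' = \<kappa> A) \<in> \<A> \<and> \<kappa> (SOME A'. A' \<in> \<A> \<and> \<kappa> A' = \<kappa> A) = \<kappa> A" if "A \<in> \<A>" for A
    using that by (intro someI[of "\<lambda>A'. A' \<in> \<A> \<and> \<kappa> A' = \<kappa> A"]) auto
  show "\<exists>K. finite K \<and> K \<subseteq> (\<lambda>A. A f) ` \<A> \<and> (\<lambda>A. A f) ` \<A> \<subseteq> (\<Union>x\<in>K. mball x \<epsilon>)"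
  proof (intro exI conjI)
    show "finite ((\<lambda>A. A f) ` R)" unfolding R_def using fin by blast
    show "(\<lambda>A. A f) ` R \<subseteq> (\<lambda>A. A f) ` \<A>" using R by (auto simp: R_def)
    show "(\<lambda>A. A f) ` \<A> \<subseteq> (\<Union>x\<in>(\<lambda>A. A f) ` R. mball x \<epsilon>)"
    proof clarsimp
      fix A assume AA: "A \<in> \<A>"
      let ?A' = "SOME A'. A' \<in> \<A> \<and> \<kappa> A' = \<kappa> A"
      have "N (\<lambda>x. ?A' f x - A f x) < \<epsilon>" using R[OF AA] AA by (intro close) auto
      moreover have "?A' f \<in> X" "A f \<in> X" using R[OF AA] AA A f(1) bounded_operatorsD(2) by blast+
      moreover have "?A' \<in> R" using AA by (auto simp: R_def)
      ultimately show "\<exists>A'\<in>R. A' f \<in> X \<and> A f \<in> X \<and> N (\<lambda>x. A' f x - A f x) < \<epsilon>" by blast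
    qed
  qed
qed

text \<open>The strong operator topology lives on the bounded operators, so a limit in the full
  product has to be shown linear and bounded. Each of these conditions involves finitely many
  vectors at a time, which a basic neighbourhood in the product controls.\<close>

lemma sot_closure_bounded:
  assumes A: "\<A> \<subseteq> bounded_operators X N"
    and M: "\<And>A. A \<in> \<A> \<Longrightarrow> operator_norm X N A \<le> M"
    and T: "T \<in> product_topology (\<lambda>_. mtopology) X closure_of \<A>"
  shows "T \<in> bounded_operators X N"
proof -
  have TX: "T \<in> X \<rightarrow>\<^sub>E X" using T by (auto simp: in_closure_of)
  then have Tm: "T f \<in> X" if "f \<in> X" for f using that by auto
  have approx: "\<exists>A\<in>\<A>. \<forall>f\<in>F. N (\<lambda>x. T f x - A f x) < \<epsilon>" if F: "finite F" "F \<subseteq> X" and \<epsilon>: "0 < \<epsilon>" for F \<epsilon>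
  proof -
    let ?U = "\<Pi>\<^sub>E f\<in>X. if f \<in> F then mball (T f) \<epsilon> else X"
    have "openin (product_topology (\<lambda>_. mtopology) X) ?U"
      unfolding openin_PiE_gen using F by (auto intro: finite_subset[OF _ F(1)])
    moreover have "T \<in> ?U" using TX Tm \<epsilon> by (auto simp: PiE_iff norm_zero)
    ultimately obtain A where "A \<in> \<A>" "A \<in> ?U" using T unfolding in_closure_of by blast
    then show ?thesis using F by (intro bexI[of _ A]) (force simp: PiE_iff split: if_splits)+
  qed
  have small: "h = (\<lambda>_. 0)" if h: "h \<in> X" "\<And>\<epsilon>. 0 < \<epsilon> \<Longrightarrow> N h \<le> K * \<epsilon>" and K: "0 < K" for h K
  proof -
    have "N h \<le> 0 + e" if "0 < e" for e using h(2)[of "e / K"] K that by simp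
    then have "N h \<le> 0" by (rule field_le_epsilon)
    then show ?thesis using norm_nonneg[of h] h(1) norm_eq_0 by simp
  qed
  have "T (\<lambda>x. f x + g x) = (\<lambda>x. T f x + T g x)" if f: "f \<in> X" and g: "g \<in> X" for f g
  proof -
    let ?s = "\<lambda>x. f x + g x"
    let ?h = "\<lambda>x. T ?s x - (T f x + T g x)"
    have s: "?s \<in> X" by (rule add_mem[OF f g])
    have "?h = (\<lambda>_. 0)"
    proof (rule small[of _ 3])
      show "?h \<in> X" by (intro diff_mem add_mem Tm f g)
      fix \<epsilon> :: real assume "0 < \<epsilon>"
      then obtain A where A1: "A \<in> \<A>" and Ae: "\<forall>k\<in>{f, g, ?s}. N (\<lambda>x. T k x - A k x) < \<epsilon>"
        using approx[of "{f, g, ?s}" \<epsilon>] f g s by blast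
      then have bo: "A \<in> bounded_operators X N" using A by auto
      note Am = bounded_operatorsD(2)[OF bo]
      have "?h = (\<lambda>x. (T ?s x - A ?s x) + ((A f x - T f x) + (A g x - T g x)))"
        using bounded_operatorsD(3)[OF bo f g] by (auto simp: fun_eq_iff)
      then have "N ?h \<le> N (\<lambda>x. T ?s x - A ?s x) + N (\<lambda>x. (A f x - T f x) + (A g x - T g x))"
        by (simp only:) (intro norm_add diff_mem add_mem Tm Am f g s)
      also have "N (\<lambda>x. (A f x - T f x) + (A g x - T g x)) \<le> N (\<lambda>x. A f x - T f x) + N (\<lambda>x. A g x - T g x)"
        by (intro norm_add diff_mem Tm Am f g)
      finally show "N ?h \<le> 3 * \<epsilon>" using Ae commute[of "A f" "T f"] commute[of "A g" "T g"] by simp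
    qed simp
    then show ?thesis by (auto simp: fun_eq_iff dest: fun_cong)
  qed
  moreover have "T (\<lambda>x. c * f x) = (\<lambda>x. c * T f x)" if f: "f \<in> X" for f c
  proof -
    let ?s = "\<lambda>x. c * f x"
    let ?h = "\<lambda>x. T ?s x - c * T f x"
    have s: "?s \<in> X" by (rule scale_mem[OF f])
    have "?h = (\<lambda>_. 0)"
    proof (rule small[of _ "1 + cmod c"])
      show "?h \<in> X" by (intro diff_mem scale_mem Tm f)
      fix \<epsilon> :: real assume "0 < \<epsilon>"
      then obtain A where A1: "A \<in> \<A>" and Ae: "\<forall>k\<in>{f, ?s}. N (\<lambda>x. T k x - A k x) < \<epsilon>"
        using approx[of "{f, ?s}" \<epsilon>] f s by blast
      then have bo: "A \<in> bounded_operators X N" using A by auto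
      note Am = bounded_operatorsD(2)[OF bo]
      have "?h = (\<lambda>x. (T ?s x - A ?s x) + c * (A f x - T f x))"
        using bounded_operatorsD(4)[OF bo f] by (auto simp: fun_eq_iff algebra_simps)
      then have "N ?h \<le> N (\<lambda>x. T ?s x - A ?s x) + N (\<lambda>x. c * (A f x - T f x))"
        by (simp only:) (intro norm_add diff_mem scale_mem Tm Am f s)
      also have "N (\<lambda>x. c * (A f x - T f x)) = cmod c * N (\<lambda>x. A f x - T f x)"
        by (intro norm_scale diff_mem Tm Am f)
      also have "\<dots> \<le> cmod c * \<epsilon>" using Ae commute[of "A f" "T f"] by (intro mult_left_mono) auto
      finally show "N ?h \<le> (1 + cmod c) * \<epsilon>" using Ae by (simp add: algebra_simps)
    qed (simp add: add_pos_nonneg)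
    then show ?thesis by (auto simp: fun_eq_iff dest: fun_cong)
  qed
  moreover have "N (T f) \<le> M * N f" if f: "f \<in> X" for f
  proof (rule field_le_epsilon)
    fix \<epsilon> :: real assume "0 < \<epsilon>"
    then obtain A where A1: "A \<in> \<A>" and Ae: "N (\<lambda>x. T f x - A f x) < \<epsilon>"
      using approx[of "{f}" \<epsilon>] f by blast
    then have bo: "A \<in> bounded_operators X N" using A by auto
    have "N (T f) = N (\<lambda>x. (T f x - A f x) + A f x)" by simp
    also have "\<dots> \<le> N (\<lambda>x. T f x - A f x) + N (A f)"
      by (intro norm_add diff_mem Tm bounded_operatorsD(2)[OF bo] f)
    finally show "N (T f) \<le> M * N f + \<epsilon>" using Ae norm_le_operator_norm[OF bo M[OF A1] f] by simp
  qed
  ultimately show ?thesis using TX unfolding bounded_operators_def by blast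
qed

theorem strongly_compact_if_eigenvectors_dense:
  assumes T: "T \<in> bounded_operators X N"
    and S: "S \<subseteq> X" and eig: "\<And>e. e \<in> S \<Longrightarrow> \<exists>\<mu>. T e = (\<lambda>x. \<mu> * e x)"
    and dense: "\<And>f. f \<in> X \<Longrightarrow> approximable_by S f"
  shows "strongly_compact_operator X N T"
  unfolding strongly_compact_operator_def strongly_compact_algebra_def
proof (intro conjI allI impI T)
  show sub: "operator_alg X T \<subseteq> bounded_operators X N"
    unfolding operator_alg_def using poly_operator_bounded[OF T] by blast
  fix \<B> assume B: "\<B> \<subseteq> operator_alg X T" and "\<exists>M. \<forall>A\<in>\<B>. operator_norm X N A \<le> M"
  then obtain M0 where M0: "\<And>A. A \<in> \<B> \<Longrightarrow> operator_norm X N A \<le> M0" by blast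
  define M where "M = max M0 0"
  have M: "operator_norm X N A \<le> M" if "A \<in> \<B>" for A using M0[OF that] by (simp add: M_def)
  have BO: "\<B> \<subseteq> bounded_operators X N" using B sub by blast
  let ?P = "product_topology (\<lambda>_. mtopology) X"
  have eigB: "\<exists>\<nu>. A e = (\<lambda>x. \<nu> * e x)" if "A \<in> \<B>" "e \<in> S" for A e
  proof -
    have "A \<in> operator_alg X T" using that(1) B by blast
    then obtain q where "A = poly_operator X q T" unfolding operator_alg_def by blast
    then show ?thesis using poly_operator_eigenvector[of e T] eig that S T by blast
  qed
  \<comment> \<open>The factors for Tychonoff's theorem: closures of orbits, compact because the
    orbits are totally bounded in a complete space.\<close>
  define C where "C f = mtopology closure_of ((\<lambda>A. A f) ` \<B>)" for f
  have C: "compactin mtopology (C f)" if "f \<in> X" for f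
  proof -
    have "mtotally_bounded ((\<lambda>A. A f) ` \<B>)"
    proof (rule eigenvector_orbit_totally_bounded[OF S BO])
      show "\<exists>\<nu>. A e = (\<lambda>x. \<nu> * e x)" if "A \<in> \<B>" "e \<in> S" for A e by (rule eigB[OF that])
      show "approximable_by S f" by (rule dense[OF that])
    qed (use M that in \<open>auto simp: M_def\<close>)
    moreover have "(\<lambda>A. A f) ` \<B> \<subseteq> X" using BO bounded_operatorsD(2) that by blast
    ultimately show ?thesis using mtotally_bounded_eq_compact_closure_of[OF complete] unfolding C_def by blast
  qed
  have "compactin ?P (Pi\<^sub>E X C)" using C by (simp add: compactin_PiE)
  moreover have "closedin ?P (Pi\<^sub>E X C)" using C by (auto simp: closedin_product_topology C_def)
  moreover have "\<B> \<subseteq> Pi\<^sub>E X C"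
  proof
    fix A assume A: "A \<in> \<B>"
    have "A f \<in> C f" if "f \<in> X" for f
      unfolding C_def using A BO bounded_operatorsD(2) that
      by (intro closure_of_subset[THEN subsetD] imageI) (auto simp: image_subset_iff)
    then show "A \<in> Pi\<^sub>E X C" using A BO bounded_operatorsD(1)[of A] by (auto simp: PiE_iff)
  qed
  ultimately have "compactin ?P (?P closure_of \<B>)"
    by (intro closed_compactin[OF _ closure_of_minimal closedin_closure_of]) auto
  moreover have cl: "?P closure_of \<B> \<subseteq> bounded_operators X N"
    using sot_closure_bounded[OF BO M] by blast
  \<comment> \<open>The closure in the product already consists of bounded operators, so the
    subspace topology does not change it.\<close>
  moreover have "strong_operator_topology X N closure_of \<B> = ?P closure_of \<B>"
    unfolding strong_operator_topology_def norm_topology_def closure_of_subtopology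
    using cl BO by (simp add: Int_absorb1 inf.absorb2)
  ultimately show "compactin (strong_operator_topology X N) (strong_operator_topology X N closure_of \<B>)"
    unfolding strong_operator_topology_def norm_topology_def by (simp add: compactin_subtopology)
qed

section \<open>The closed span as a subspace\<close>

lemma approximable_by_mem:
  assumes "e \<in> S"
  shows "approximable_by S e"
  unfolding approximable_by_def using assms norm_zero
  by (intro allI impI exI[of _ "{e}"] exI[of _ "\<lambda>_. 1"]) simp

lemma approximable_by_zero: "approximable_by S (\<lambda>_. 0)"
  unfolding approximable_by_def using norm_zero by (intro allI impI exI[of _ "{}"]) simp

lemma approximable_by_add:
  assumes S: "S \<subseteq> X" and f: "f \<in> X" "approximable_by S f" and g: "g \<in> X" "approximable_by S g"
  shows "approximable_by S (\<lambda>x. f x + g x)"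
  unfolding approximable_by_def
proof (intro allI impI)
  fix \<epsilon> :: real assume "0 < \<epsilon>"
  then have e2: "0 < \<epsilon> / 2" by simp
  obtain I c where I: "finite I" "I \<subseteq> S" "N (\<lambda>x. f x - (\<Sum>e\<in>I. c e * e x)) < \<epsilon> / 2"
    using f(2) e2 unfolding approximable_by_def by blast
  obtain J d where J: "finite J" "J \<subseteq> S" "N (\<lambda>x. g x - (\<Sum>e\<in>J. d e * e x)) < \<epsilon> / 2"
    using g(2) e2 unfolding approximable_by_def by blast
  \<comment> \<open>Coefficients are padded with 0 to the union and added, since \<open>I\<close>
    and \<open>J\<close> may overlap.\<close>
  define a where "a e = (if e \<in> I then c e else 0) + (if e \<in> J then d e else 0)" for e
  have ext: "(\<Sum>e\<in>K. k e * e x) = (\<Sum>e\<in>I \<union> J. (if e \<in> K then k e else 0) * e x)" if "K \<subseteq> I \<union> J" for K k x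
  proof -
    have "(\<Sum>e\<in>I \<union> J. (if e \<in> K then k e else 0) * e x) = (\<Sum>e\<in>K. (if e \<in> K then k e else 0) * e x)"
      using I(1) J(1) that by (intro sum.mono_neutral_right) auto
    then show ?thesis by simp
  qed
  have IX: "(\<lambda>x. f x - (\<Sum>e\<in>I. c e * e x)) \<in> X" and JX: "(\<lambda>x. g x - (\<Sum>e\<in>J. d e * e x)) \<in> X"
    using S I(2) J(2) by (auto intro!: diff_mem sum_mem f(1) g(1))
  have "(\<lambda>x. f x + g x - (\<Sum>e\<in>I \<union> J. a e * e x)) = (\<lambda>x. (f x - (\<Sum>e\<in>I. c e * e x)) + (g x - (\<Sum>e\<in>J. d e * e x)))"
    unfolding ext[OF Un_upper1] ext[OF Un_upper2] a_def distrib_right sum.distrib by (simp only: add_diff_add)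
  then have "N (\<lambda>x. f x + g x - (\<Sum>e\<in>I \<union> J. a e * e x)) < \<epsilon>"
    using norm_add[OF IX JX] I(3) J(3) by simp
  then show "\<exists>I c. finite I \<and> I \<subseteq> S \<and> N (\<lambda>x. f x + g x - (\<Sum>e\<in>I. c e * e x)) < \<epsilon>"
    using I J by (intro exI[of _ "I \<union> J"] exI[of _ a]) auto
qed

lemma approximable_by_scale:
  assumes S: "S \<subseteq> X" and f: "f \<in> X" "approximable_by S f"
  shows "approximable_by S (\<lambda>x. k * f x)"
  unfolding approximable_by_def
proof (intro allI impI)
  fix \<epsilon> :: real assume \<epsilon>: "0 < \<epsilon>"
  have k1: "0 < cmod k + 1" by (simp add: add_nonneg_pos)
  obtain I c where I: "finite I" "I \<subseteq> S" "N (\<lambda>x. f x - (\<Sum>e\<in>I. c e * e x)) < \<epsilon> / (cmod k + 1)"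
    using f(2) divide_pos_pos[OF \<epsilon> k1] unfolding approximable_by_def by blast
  have IX: "(\<lambda>x. f x - (\<Sum>e\<in>I. c e * e x)) \<in> X" using S I(2) by (auto intro!: diff_mem sum_mem f(1))
  have "(\<lambda>x. k * f x - (\<Sum>e\<in>I. (k * c e) * e x)) = (\<lambda>x. k * (f x - (\<Sum>e\<in>I. c e * e x)))"
    by (simp add: sum_distrib_left right_diff_distrib mult.assoc)
  then have "N (\<lambda>x. k * f x - (\<Sum>e\<in>I. (k * c e) * e x)) = cmod k * N (\<lambda>x. f x - (\<Sum>e\<in>I. c e * e x))"
    using norm_scale[OF IX, of k] by simp
  also have "\<dots> \<le> (cmod k + 1) * N (\<lambda>x. f x - (\<Sum>e\<in>I. c e * e x))" by (intro mult_right_mono norm_nonneg) auto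
  also have "\<dots> < \<epsilon>" using I(3) k1 by (simp add: field_simps)
  finally have "N (\<lambda>x. k * f x - (\<Sum>e\<in>I. (k * c e) * e x)) < \<epsilon>" .
  then show "\<exists>I c. finite I \<and> I \<subseteq> S \<and> N (\<lambda>x. k * f x - (\<Sum>e\<in>I. c e * e x)) < \<epsilon>"
    using I(1,2) by (intro exI[of _ I] exI[of _ "\<lambda>e. k * c e"]) auto
qed

lemma approximable_by_limit:
  assumes S: "S \<subseteq> X" and f: "f \<in> X"
    and lim: "\<And>\<epsilon>. 0 < \<epsilon> \<Longrightarrow> \<exists>g\<in>X. approximable_by S g \<and> N (\<lambda>x. g x - f x) < \<epsilon>"
  shows "approximable_by S f"
  unfolding approximable_by_def
proof (intro allI impI)
  fix \<epsilon> :: real assume "0 < \<epsilon>"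
  then have e2: "0 < \<epsilon> / 2" by simp
  obtain g where g: "g \<in> X" "approximable_by S g" "N (\<lambda>x. g x - f x) < \<epsilon> / 2" using lim[OF e2] by blast
  obtain I c where I: "finite I" "I \<subseteq> S" "N (\<lambda>x. g x - (\<Sum>e\<in>I. c e * e x)) < \<epsilon> / 2"
    using g(2) e2 unfolding approximable_by_def by blast
  have IX: "(\<lambda>x. \<Sum>e\<in>I. c e * e x) \<in> X" using S I(2) by (auto intro!: sum_mem)
  have "N (\<lambda>x. f x - (\<Sum>e\<in>I. c e * e x)) < \<epsilon>"
    using triangle[OF f g(1) IX] g(3) I(3) commute[of g f] by simp
  then show "\<exists>I c. finite I \<and> I \<subseteq> S \<and> N (\<lambda>x. f x - (\<Sum>e\<in>I. c e * e x)) < \<epsilon>"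
    using I(1,2) by (intro exI[of _ I] exI[of _ c]) auto
qed

end

section \<open>The Koenigs domain lies in a strip\<close>

lemma blaschke_inverse:
  assumes "cmod w < 1" "cmod z < 1"
  shows "((z - w) / (1 - cnj w * z) + w) / (1 + cnj w * ((z - w) / (1 - cnj w * z))) = z"
proof -
  have nz: "1 - cnj w * z \<noteq> 0" "1 - cnj w * w \<noteq> 0"
    using blaschke_denom_nonzero[of w z] blaschke_denom_nonzero[of w w] assms by blast+
  define \<xi> where "\<xi> = (z - w) / (1 - cnj w * z)"
  have \<xi>: "\<xi> * (1 - cnj w * z) = z - w" using nz by (simp add: \<xi>_def)
  have "(\<xi> + w) * (1 - cnj w * z) = z * (1 - cnj w * w)" "(1 + cnj w * \<xi>) * (1 - cnj w * z) = 1 - cnj w * w"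
    using \<xi> by algebra+
  then have "((\<xi> + w) * (1 - cnj w * z)) / ((1 + cnj w * \<xi>) * (1 - cnj w * z)) = z"
    using nz by simp
  then show ?thesis using nz by (simp add: \<xi>_def)
qed

text \<open>Disc automorphisms taking 0 to \<open>w\<close> and \<open>f w\<close> to 0 reduce this
  to Schwarz's lemma.\<close>

lemma schwarz_pick:
  assumes f: "f holomorphic_on unit_disc" "\<And>z. z \<in> unit_disc \<Longrightarrow> f z \<in> unit_disc"
    and w: "w \<in> unit_disc" and z: "z \<in> unit_disc"
  shows "cmod ((f z - f w) / (1 - cnj (f w) * f z)) \<le> cmod ((z - w) / (1 - cnj w * z))"
proof -
  define \<psi> where "\<psi> \<xi> = (\<xi> - (- w)) / (1 - cnj (- w) * \<xi>)" for \<xi>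
  define \<eta> where "\<eta> \<xi> = (\<xi> - f w) / (1 - cnj (f w) * \<xi>)" for \<xi>
  define \<xi> where "\<xi> = (z - w) / (1 - cnj w * z)"
  have w1: "cmod (- w) < 1" "cmod w < 1" and fw: "cmod (f w) < 1" using w f(2)[OF w] by auto
  have \<psi>: "\<psi> holomorphic_on unit_disc" "\<psi> ` unit_disc \<subseteq> unit_disc"
    unfolding \<psi>_def using blaschke_factor_holomorphic[OF w1(1)] blaschke_norm_less_1[OF w1(1)] by auto
  have \<eta>: "\<eta> holomorphic_on unit_disc" "\<eta> ` unit_disc \<subseteq> unit_disc"
    unfolding \<eta>_def using blaschke_factor_holomorphic[OF fw] blaschke_norm_less_1[OF fw] by auto
  have hol: "(\<eta> \<circ> (f \<circ> \<psi>)) holomorphic_on unit_disc"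
    using \<psi> \<eta> f by (intro holomorphic_on_compose_gen[where t = unit_disc]) auto
  have maps: "\<psi> x \<in> unit_disc" "f (\<psi> x) \<in> unit_disc" "\<eta> (f (\<psi> x)) \<in> unit_disc" if "cmod x < 1" for x
    using that \<psi>(2) \<eta>(2) f(2) by (auto simp: image_subset_iff)
  have "cmod \<xi> < 1" unfolding \<xi>_def using w z by (intro blaschke_norm_less_1) auto
  have "cmod ((\<eta> \<circ> (f \<circ> \<psi>)) \<xi>) \<le> cmod \<xi>"
    by (rule Schwarz_Lemma(1)[OF hol]) (use \<open>cmod \<xi> < 1\<close> maps in \<open>auto simp: \<psi>_def \<eta>_def\<close>)
  moreover have "\<psi> \<xi> = z" using blaschke_inverse[of w z] w z by (simp add: \<psi>_def \<xi>_def)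
  ultimately show ?thesis by (simp add: \<eta>_def \<xi>_def)
qed

text \<open>Cleared of denominators, the inequality can be followed as \<open>w\<close> and
  \<open>f w\<close> tend to the circle; what then matters is the quotient of the two vanishing
  factors, which Julia's inequality bounds by \<open>c\<close>.\<close>

lemma schwarz_pick_square:
  assumes f: "f holomorphic_on unit_disc" "\<And>z. z \<in> unit_disc \<Longrightarrow> f z \<in> unit_disc"
    and w: "w \<in> unit_disc" and z: "z \<in> unit_disc"
  shows "(cmod (1 - cnj (f w) * f z))\<^sup>2 * ((1 - (cmod w)\<^sup>2) * (1 - (cmod z)\<^sup>2))
    \<le> (cmod (1 - cnj w * z))\<^sup>2 * ((1 - (cmod (f w))\<^sup>2) * (1 - (cmod (f z))\<^sup>2))"
proof -
  have nz: "1 - cnj (f w) * f z \<noteq> 0" "1 - cnj w * z \<noteq> 0"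
    using w z f(2)[OF w] f(2)[OF z] by (intro blaschke_denom_nonzero; simp)+
  define P Q where "P = (cmod (1 - cnj (f w) * f z))\<^sup>2" and "Q = (cmod (1 - cnj w * z))\<^sup>2"
  have PQ: "0 < P" "0 < Q" using nz by (auto simp: P_def Q_def)
  have "(cmod ((f z - f w) / (1 - cnj (f w) * f z)))\<^sup>2 \<le> (cmod ((z - w) / (1 - cnj w * z)))\<^sup>2"
    by (intro power_mono schwarz_pick assms) auto
  then have "(P - (1 - (cmod (f w))\<^sup>2) * (1 - (cmod (f z))\<^sup>2)) / P \<le> (Q - (1 - (cmod w)\<^sup>2) * (1 - (cmod z)\<^sup>2)) / Q"
    unfolding P_def Q_def norm_divide power_divide
    using blaschke_identity[of "f w" "f z"] blaschke_identity[of w z] by (simp add: algebra_simps)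
  moreover define A B where "A = (1 - (cmod (f w))\<^sup>2) * (1 - (cmod (f z))\<^sup>2)" and "B = (1 - (cmod w)\<^sup>2) * (1 - (cmod z)\<^sup>2)"
  ultimately have "1 - A / P \<le> 1 - B / Q" using PQ by (simp add: diff_divide_distrib)
  then have "B / Q \<le> A / P" by simp
  then have "P * B \<le> Q * A" using PQ by (simp add: field_simps)
  then show ?thesis unfolding P_def Q_def A_def B_def .
qed

text \<open>The limit form of the Schwarz-Pick inequality as \<open>w\<close> tends to a boundary point; the quotients
  compared here define the horodiscs at \<open>\<tau>\<close>.\<close>

lemma julia_inequality:
  assumes f: "f holomorphic_on unit_disc" "\<And>z. z \<in> unit_disc \<Longrightarrow> f z \<in> unit_disc"
    and w: "\<And>n. w n \<in> unit_disc" "w \<longlonglongrightarrow> \<tau>" "(\<lambda>n. f (w n)) \<longlonglongrightarrow> \<tau>"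
    and c: "\<And>n::nat. 1 - (cmod (f (w n)))\<^sup>2 \<le> c * (1 - (cmod (w n))\<^sup>2)"
    and z: "z \<in> unit_disc"
  shows "(cmod (1 - cnj \<tau> * f z))\<^sup>2 * (1 - (cmod z)\<^sup>2) \<le> c * ((cmod (1 - cnj \<tau> * z))\<^sup>2 * (1 - (cmod (f z))\<^sup>2))"
proof (rule LIMSEQ_le)
  show "(\<lambda>n. (cmod (1 - cnj (f (w n)) * f z))\<^sup>2 * (1 - (cmod z)\<^sup>2)) \<longlonglongrightarrow> (cmod (1 - cnj \<tau> * f z))\<^sup>2 * (1 - (cmod z)\<^sup>2)"
    by (intro tendsto_intros w)
  show "(\<lambda>n. c * ((cmod (1 - cnj (w n) * z))\<^sup>2 * (1 - (cmod (f z))\<^sup>2))) \<longlonglongrightarrow> c * ((cmod (1 - cnj \<tau> * z))\<^sup>2 * (1 - (cmod (f z))\<^sup>2))"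
    by (intro tendsto_intros w)
  have "(cmod (1 - cnj (f (w n)) * f z))\<^sup>2 * (1 - (cmod z)\<^sup>2) \<le> c * ((cmod (1 - cnj (w n) * z))\<^sup>2 * (1 - (cmod (f z))\<^sup>2))" for n
  proof -
    have pos: "0 < 1 - (cmod (w n))\<^sup>2" "0 \<le> 1 - (cmod (f z))\<^sup>2"
      using w(1)[of n] f(2)[OF z] by (auto simp: abs_square_less_1 power_le_one less_imp_le)
    have "(1 - (cmod (w n))\<^sup>2) * ((cmod (1 - cnj (f (w n)) * f z))\<^sup>2 * (1 - (cmod z)\<^sup>2))
      \<le> (cmod (1 - cnj (w n) * z))\<^sup>2 * ((1 - (cmod (f (w n)))\<^sup>2) * (1 - (cmod (f z))\<^sup>2))"
      using schwarz_pick_square[OF f w(1)[of n] z] by (simp add: mult_ac)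
    also have "\<dots> \<le> (cmod (1 - cnj (w n) * z))\<^sup>2 * ((c * (1 - (cmod (w n))\<^sup>2)) * (1 - (cmod (f z))\<^sup>2))"
      by (intro mult_left_mono mult_right_mono c pos) auto
    also have "\<dots> = (1 - (cmod (w n))\<^sup>2) * (c * ((cmod (1 - cnj (w n) * z))\<^sup>2 * (1 - (cmod (f z))\<^sup>2)))"
      by (simp add: mult_ac)
    finally show ?thesis using pos(1) by simp
  qed
  then show "\<exists>N. \<forall>n\<ge>N. (cmod (1 - cnj (f (w n)) * f z))\<^sup>2 * (1 - (cmod z)\<^sup>2)
    \<le> c * ((cmod (1 - cnj (w n) * z))\<^sup>2 * (1 - (cmod (f z))\<^sup>2))" by blast
qed

text \<open>A positive sequence cannot increase from some index on and still tend to 0. Applied to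
  \<open>1 - \<bar>w n\<bar>^2\<close> along an orbit, this yields points where the quotient in
  Julia's inequality is at most 1.\<close>

lemma frequently_nonincreasing:
  fixes a :: "nat \<Rightarrow> real"
  assumes "\<And>n. 0 < a n" "a \<longlonglongrightarrow> 0"
  obtains r where "strict_mono (r :: nat \<Rightarrow> nat)" "\<And>n. a (Suc (r n)) \<le> a (r n)"
proof -
  have "infinite {n. a (Suc n) \<le> a n}"
  proof
    assume "finite {n. a (Suc n) \<le> a n}"
    then obtain N where "\<And>n. a (Suc n) \<le> a n \<Longrightarrow> n < N"
      using finite_nat_set_iff_bounded by auto
    then have inc: "a n < a (Suc n)" if "N \<le> n" for n using that by (meson not_le)
    have "a N \<le> a n" if "N \<le> n" for n
      using that by (induction rule: dec_induct) (use inc in \<open>auto intro: order_trans less_imp_le\<close>)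
    then have "a N \<le> 0" by (intro LIMSEQ_le_const[OF assms(2)]) blast
    then show False using assms(1)[of N] by simp
  qed
  from infinite_enumerate[OF this] that show ?thesis by auto
qed

lemma cmod_diff_eq_cmod_one_minus:
  assumes "cmod \<tau> = 1"
  shows "cmod (1 - cnj \<tau> * z) = cmod (\<tau> - z)"
proof -
  have "\<tau> * (1 - cnj \<tau> * z) = \<tau> - z"
    using complex_norm_square[of \<tau>] assms by (simp add: algebra_simps)
  then show ?thesis using assms by (metis mult_1 norm_mult)
qed

text \<open>By hypothesis \<open>f\<close> maps every horodisc at \<open>\<tau>\<close> into itself.
  Horodiscs through points near the end of the radius are small, which forces the radial limit
  \<open>\<tau>\<close> with an explicit rate.\<close>

lemma radial_limit_from_horodiscs:
  assumes f: "\<And>z. z \<in> unit_disc \<Longrightarrow> f z \<in> unit_disc"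
    and \<tau>: "cmod \<tau> = 1"
    and horo: "\<And>z. z \<in> unit_disc \<Longrightarrow> (cmod (1 - cnj \<tau> * f z))\<^sup>2 * (1 - (cmod z)\<^sup>2) \<le> (cmod (1 - cnj \<tau> * z))\<^sup>2 * (1 - (cmod (f z))\<^sup>2)"
    and s: "0 < s" "s < 1"
  shows "(cmod (\<tau> - f (of_real s * \<tau>)))\<^sup>2 \<le> 1 - s"
proof -
  let ?z = "of_real s * \<tau>"
  have zn: "cmod ?z = s" using s \<tau> by (simp add: norm_mult)
  then have z: "?z \<in> unit_disc" using s by simp
  have "\<tau> - ?z = of_real (1 - s) * \<tau>" by (simp add: algebra_simps)
  then have d: "cmod (\<tau> - ?z) = 1 - s"
    using \<tau> s by (simp add: norm_mult del: of_real_diff)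
  have "(cmod (\<tau> - f ?z))\<^sup>2 * (1 - s\<^sup>2) \<le> (1 - s)\<^sup>2 * (1 - (cmod (f ?z))\<^sup>2)"
    using horo[OF z] unfolding cmod_diff_eq_cmod_one_minus[OF \<tau>] d zn .
  also have "\<dots> \<le> (1 - s)\<^sup>2 * 1" by (intro mult_left_mono) auto
  finally have "(1 - s) * ((cmod (\<tau> - f ?z))\<^sup>2 * (1 + s)) \<le> (1 - s) * (1 - s)"
    by (simp add: power2_eq_square algebra_simps)
  then have "(cmod (\<tau> - f ?z))\<^sup>2 * (1 + s) \<le> 1 - s" using s by simp
  moreover have "(cmod (\<tau> - f ?z))\<^sup>2 * 1 \<le> (cmod (\<tau> - f ?z))\<^sup>2 * (1 + s)" using s by (intro mult_left_mono) auto
  ultimately show ?thesis by simp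
qed

text \<open>Combining \<open>\<bar>b - a\<bar> \<le> s \<bar>1 - cnj a * b\<bar>\<close> with
  \<open>\<bar>1 - cnj a * b\<bar> \<le> 1 - \<bar>a\<bar>^2 + \<bar>a\<bar> \<bar>b -
  a\<bar>\<close> gives \<open>\<bar>b - a\<bar> \<le> 3 s (1 - \<bar>a\<bar>)\<close>; the constant
  comes from \<open>1 + x \<le> 3 (1 - s x)\<close> for \<open>x = \<bar>a\<bar>\<close> and
  \<open>3 s < 1\<close>.\<close>

lemma pseudo_hyperbolic_norm_lower_bound:
  assumes a: "cmod a < 1" and b: "cmod b < 1" and s: "0 \<le> s" "3 * s < 1"
    and d: "cmod ((b - a) / (1 - cnj a * b)) \<le> s"
  shows "(1 - 3 * s) * (1 - cmod a) \<le> 1 - cmod b"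
proof -
  have nz: "1 - cnj a * b \<noteq> 0" by (rule blaschke_denom_nonzero[OF a b])
  have 1: "cmod (b - a) \<le> s * cmod (1 - cnj a * b)"
    using d nz by (simp add: norm_divide field_simps)
  have "1 - cnj a * b = of_real (1 - (cmod a)\<^sup>2) + cnj a * (a - b)"
    using complex_norm_square[of a] by (simp add: algebra_simps)
  then have "cmod (1 - cnj a * b) \<le> cmod (of_real (1 - (cmod a)\<^sup>2)) + cmod (cnj a * (a - b))"
    by (metis norm_triangle_ineq)
  also have "cmod (of_real (1 - (cmod a)\<^sup>2)) = 1 - (cmod a)\<^sup>2"
    unfolding norm_of_real using a by (simp add: power_le_one)
  also have "cmod (cnj a * (a - b)) = cmod a * cmod (b - a)" by (simp add: norm_mult norm_minus_commute)
  finally have 2: "cmod (1 - cnj a * b) \<le> 1 - (cmod a)\<^sup>2 + cmod a * cmod (b - a)" .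
  define x y where "x = cmod a" and "y = cmod (b - a)"
  have x: "0 \<le> x" "x < 1" and y: "0 \<le> y" using a by (auto simp: x_def y_def)
  have "y \<le> s * (1 - x\<^sup>2 + x * y)" using 1 mult_left_mono[OF 2 s(1)] unfolding x_def y_def by linarith
  then have 3: "y * (1 - s * x) \<le> s * (1 + x) * (1 - x)" by (simp add: power2_eq_square algebra_simps)
  have sx: "s * x \<le> s" using x s by (simp add: mult_left_le)
  have "s * (1 + x) * (1 - x) \<le> (3 * s * (1 - x)) * (1 - s * x)"
  proof -
    have "1 + x \<le> 3 * (1 - s * x)"
    proof -
      have "3 * (s * x) \<le> x" using s x by (metis mult.assoc mult_left_le_one_le mult_nonneg_nonneg less_imp_le zero_le_numeral)
      moreover have "3 * (1 - s * x) = 3 - 3 * (s * x)" by simp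
      ultimately show ?thesis using x by linarith
    qed
    then have "(s * (1 - x)) * (1 + x) \<le> (s * (1 - x)) * (3 * (1 - s * x))"
      using s x by (intro mult_left_mono) auto
    then show ?thesis by (simp only: mult_ac)
  qed
  with 3 have "y * (1 - s * x) \<le> (3 * s * (1 - x)) * (1 - s * x)" by linarith
  then have "y \<le> 3 * s * (1 - x)" using sx s by (subst (asm) mult_le_cancel_right_pos) auto
  moreover have "cmod b \<le> x + y" unfolding x_def y_def using norm_triangle_ineq[of a "b - a"] by simp
  ultimately show ?thesis unfolding x_def[symmetric] by (simp add: algebra_simps)
qed

text \<open>Julia's inequality is used twice. Along the orbit of 0 it holds with coefficient 1,
  which gives the radial limit \<open>\<tau>\<close>. With this limit known, integrating the
  derivative along the radius bounds \<open>1 - \<bar>f\<bar>\<close> by little more than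
  \<open>a\<close> times the distance to the circle, and a second application with radial points
  improves the coefficient to any \<open>c > a\<close>.\<close>

lemma julia_coefficient_bound:
  assumes f: "f holomorphic_on unit_disc" "\<And>z. z \<in> unit_disc \<Longrightarrow> f z \<in> unit_disc"
    and \<tau>: "cmod \<tau> = 1"
    and lim: "(\<lambda>n::nat. (f ^^ n) 0) \<longlonglongrightarrow> \<tau>"
    and a: "0 < a" "a < 1" "nontangential_limit (deriv f) \<tau> (of_real a)"
    and c: "a < c"
    and z: "z \<in> unit_disc"
  shows "(cmod (1 - cnj \<tau> * f z))\<^sup>2 * (1 - (cmod z)\<^sup>2) \<le> c * ((cmod (1 - cnj \<tau> * z))\<^sup>2 * (1 - (cmod (f z))\<^sup>2))"
proof -
  define w where "w n = (f ^^ n) 0" for n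
  have wD: "w n \<in> unit_disc" for n unfolding w_def by (induction n) (use f(2) in auto)
  have wlim: "w \<longlonglongrightarrow> \<tau>" using lim unfolding w_def .
  have apos: "0 < 1 - (cmod (w n))\<^sup>2" for n using wD[of n] by (simp add: abs_square_less_1)
  have "(\<lambda>n. 1 - (cmod (w n))\<^sup>2) \<longlonglongrightarrow> 1 - (cmod \<tau>)\<^sup>2" by (intro tendsto_intros wlim)
  then have "(\<lambda>n. 1 - (cmod (w n))\<^sup>2) \<longlonglongrightarrow> 0" using \<tau> by simp
  from frequently_nonincreasing[OF apos this]
  obtain r where r: "strict_mono (r :: nat \<Rightarrow> nat)" "\<And>n. 1 - (cmod (w (Suc (r n))))\<^sup>2 \<le> 1 - (cmod (w (r n)))\<^sup>2" by blast
  have horo: "(cmod (1 - cnj \<tau> * f z))\<^sup>2 * (1 - (cmod z)\<^sup>2) \<le> (cmod (1 - cnj \<tau> * z))\<^sup>2 * (1 - (cmod (f z))\<^sup>2)"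
    if z: "z \<in> unit_disc" for z
  proof -
    have fw: "f (w n) = w (Suc n)" for n by (simp add: w_def)
    have "(\<lambda>n. f (w (r n))) \<longlonglongrightarrow> \<tau>"
      unfolding fw using LIMSEQ_subseq_LIMSEQ[OF LIMSEQ_Suc[OF wlim] r(1)] by (simp add: o_def)
    moreover have "(\<lambda>n. w (r n)) \<longlonglongrightarrow> \<tau>" using LIMSEQ_subseq_LIMSEQ[OF wlim r(1)] by (simp add: o_def)
    ultimately show ?thesis
      using julia_inequality[OF f, of "\<lambda>n. w (r n)" \<tau> 1 z] wD r(2) z by (simp add: fw)
  qed
  have radial: "(cmod (\<tau> - f (of_real s * \<tau>)))\<^sup>2 \<le> 1 - s" if "0 < s" "s < 1" for s
    by (rule radial_limit_from_horodiscs[OF f(2) \<tau> horo that])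
  \<comment> \<open>Room for two losses: \<open>a < b\<close> absorbs the convergence of the
    derivative, \<open>b < c\<close> the passage from \<open>1 - x\<close> to
    \<open>1 - x^2\<close>.\<close>
  define b where "b = (a + c) / 2"
  have b: "a < b" "b < c" "0 < b" using a c by (auto simp: b_def)
  have sD: "of_real s * \<tau> \<in> unit_disc" if "0 \<le> s" "s < 1" for s using that \<tau> by (simp add: norm_mult)
  \<comment> \<open>The Stolz region with \<open>M = 2\<close> contains the points of the radius
    considered here.\<close>
  have "(deriv f \<longlongrightarrow> of_real a) (at \<tau> within {z \<in> unit_disc. cmod (z - \<tau>) < 2 * (1 - cmod z)})"
    by (rule a(3)[unfolded nontangential_limit_def, rule_format]) simp
  then have "\<forall>\<^sub>F z in at \<tau> within {z \<in> unit_disc. cmod (z - \<tau>) < 2 * (1 - cmod z)}. dist (deriv f z) (of_real a) < b - a"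
    using b by (intro tendstoD) auto
  then obtain d where d: "0 < d" and dd: "\<And>z. z \<in> unit_disc \<Longrightarrow> cmod (z - \<tau>) < 2 * (1 - cmod z) \<Longrightarrow> z \<noteq> \<tau> \<Longrightarrow> dist z \<tau> < d \<Longrightarrow> dist (deriv f z) (of_real a) < b - a"
    unfolding eventually_at by auto
  have deriv_le: "cmod (deriv f (of_real s * \<tau>)) \<le> b" if s: "0 < s" "s < 1" "1 - d < s" for s
  proof -
    have e: "of_real s * \<tau> - \<tau> = of_real (s - 1) * \<tau>" by (simp add: algebra_simps)
    have n: "cmod (of_real s * \<tau> - \<tau>) = 1 - s" unfolding e norm_mult norm_of_real using s \<tau> by simp
    have "dist (deriv f (of_real s * \<tau>)) (of_real a) < b - a"
    proof (rule dd)
      show "of_real s * \<tau> \<in> unit_disc" using s by (intro sD) auto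
      show "cmod (of_real s * \<tau> - \<tau>) < 2 * (1 - cmod (of_real s * \<tau>))" unfolding n using s \<tau> by (simp add: norm_mult)
      show "dist (of_real s * \<tau>) \<tau> < d" unfolding dist_norm n using s by simp
      show "of_real s * \<tau> \<noteq> \<tau>" using n s by auto
    qed
    then show ?thesis using norm_triangle_ineq2[of "deriv f (of_real s * \<tau>)" "of_real a"] a by (simp add: dist_norm)
  qed
  \<comment> \<open>Beyond \<open>s0\<close> a radial point stays away from 0, lies within
    \<open>d\<close> of \<open>\<tau>\<close>, and satisfies
    \<open>2 * b \<le> c * (1 + s)\<close>.\<close>
  define s0 where "s0 = max (1/2) (max (1 - d/2) (2 * b / c - 1))"
  have c0: "0 < c" using a c by simp
  have "1/2 \<le> s0" "1 - d/2 \<le> s0" "2 * b / c - 1 \<le> s0" unfolding s0_def by (simp_all only: le_max_iff_disj order_refl simp_thms)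
  moreover have "2 * b / c < 2" using b c0 by (simp add: field_simps)
  then have "s0 < 1" unfolding s0_def using d by (simp only: max_less_iff_conj) simp
  moreover have "1 - d < 1 - d/2" using d by simp
  ultimately have s0: "1/2 \<le> s0" "1 - d < s0" "s0 < 1" "2 * b / c - 1 \<le> s0" by linarith+
  have bound: "1 - (cmod (f (of_real s * \<tau>)))\<^sup>2 \<le> c * (1 - (cmod (of_real s * \<tau>))\<^sup>2)" if s: "s0 < s" "s < 1" for s
  proof -
    have lip: "cmod (f (of_real t * \<tau>) - f (of_real s * \<tau>)) \<le> b * (1 - s)" if t: "s < t" "t < 1" for t
    proof -
      let ?S = "closed_segment (of_real s * \<tau>) (of_real t * \<tau>)"
      have inS: "\<exists>u. s \<le> u \<and> u \<le> t \<and> x = of_real u * \<tau>" if "x \<in> ?S" for x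
      proof -
        obtain v where v: "0 \<le> v" "v \<le> 1" "x = (1 - v) *\<^sub>R (of_real s * \<tau>) + v *\<^sub>R (of_real t * \<tau>)"
          using \<open>x \<in> ?S\<close> by (auto simp: in_segment)
        have "x = of_real (s + v * (t - s)) * \<tau>" by (simp add: v(3) scaleR_conv_of_real algebra_simps)
        moreover have "0 \<le> v * (t - s)" "v * (t - s) \<le> 1 * (t - s)" using v t by (auto intro!: mult_right_mono)
        ultimately show ?thesis by (intro exI[of _ "s + v * (t - s)"]) auto
      qed
      have "cmod (f (of_real t * \<tau>) - f (of_real s * \<tau>)) \<le> b * cmod (of_real t * \<tau> - of_real s * \<tau>)"
      proof (rule field_differentiable_bound[where S = ?S and f' = "deriv f"])
        fix x assume "x \<in> ?S"
        then obtain u where u: "s \<le> u" "u \<le> t" "x = of_real u * \<tau>" using inS by blast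
        have u1: "0 < u" "u < 1" "1 - d < u" using u t s s0 by auto
        then have "x \<in> unit_disc" unfolding u(3) by (intro sD) auto
        then show "(f has_field_derivative deriv f x) (at x within ?S)"
          using holomorphic_derivI[OF f(1) open_ball] by blast
        show "cmod (deriv f x) \<le> b" unfolding u(3) by (rule deriv_le[OF u1])
      qed auto
      also have "of_real t * \<tau> - of_real s * \<tau> = of_real (t - s) * \<tau>" by (simp add: algebra_simps)
      also have "b * cmod (of_real (t - s) * \<tau>) \<le> b * (1 - s)"
        unfolding norm_mult norm_of_real using t \<tau> b by simp
      finally show ?thesis .
    qed
    have "cmod (\<tau> - f (of_real s * \<tau>)) \<le> b * (1 - s)"
    proof (rule field_le_epsilon)
      fix e :: real assume e: "0 < e"
      \<comment> \<open>The estimate \<open>radial\<close> controls the square of the distance to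
        \<open>\<tau>\<close>, hence the square of \<open>e\<close>; the other entry keeps
        \<open>t\<close> beyond \<open>s\<close>.\<close>
      define t where "t = 1 - min (e\<^sup>2) ((1 - s) / 2)"
      have t: "s < t" "t < 1" "1 - t \<le> e\<^sup>2" using s e by (auto simp: t_def min_def field_simps)
      have "(cmod (\<tau> - f (of_real t * \<tau>)))\<^sup>2 \<le> e\<^sup>2" using radial[of t] t s s0 by simp
      then have "cmod (\<tau> - f (of_real t * \<tau>)) \<le> e" by (rule power2_le_imp_le) (use e in simp)
      then show "cmod (\<tau> - f (of_real s * \<tau>)) \<le> b * (1 - s) + e"
        using lip[OF t(1,2)] norm_triangle_ineq[of "\<tau> - f (of_real t * \<tau>)" "f (of_real t * \<tau>) - f (of_real s * \<tau>)"] by simp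
    qed
    then have 1: "1 - cmod (f (of_real s * \<tau>)) \<le> b * (1 - s)"
      using norm_triangle_ineq2[of \<tau> "f (of_real s * \<tau>)"] \<tau> by simp
    define x where "x = cmod (f (of_real s * \<tau>))"
    have x: "0 \<le> x" "x < 1" unfolding x_def using f(2)[OF sD[of s]] s s0 by auto
    have "1 - x\<^sup>2 = (1 - x) * (1 + x)" by (simp add: power2_eq_square algebra_simps)
    also have "\<dots> \<le> (b * (1 - s)) * 2" using 1 x b s unfolding x_def[symmetric] by (intro mult_mono) auto
    also have "\<dots> = (1 - s) * (2 * b)" by simp
    also have "\<dots> \<le> (1 - s) * (c * (1 + s))"
    proof (rule mult_left_mono)
      have "2 * b / c \<le> 1 + s" using s s0 by simp
      then show "2 * b \<le> c * (1 + s)" using c0 by (simp add: field_simps)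
    qed (use s in auto)
    also have "\<dots> = c * (1 - (cmod (of_real s * \<tau>))\<^sup>2)"
      using s s0 \<tau> by (simp add: norm_mult power2_eq_square algebra_simps)
    finally show ?thesis unfolding x_def .
  qed
  define \<sigma> where "\<sigma> n = 1 - (1 - s0) / (real n + 2)" for n
  have \<sigma>: "s0 < \<sigma> n" "\<sigma> n < 1" for n
  proof -
    have "(1 - s0) * 1 < (1 - s0) * (real n + 2)" using s0 by (intro mult_strict_left_mono) auto
    then show "s0 < \<sigma> n" by (simp add: \<sigma>_def field_simps)
    show "\<sigma> n < 1" using s0 by (simp add: \<sigma>_def)
  qed
  have \<sigma>lim: "\<sigma> \<longlonglongrightarrow> 1" unfolding \<sigma>_def by real_asymp
  have "(\<lambda>n. \<tau> - f (of_real (\<sigma> n) * \<tau>)) \<longlonglongrightarrow> 0"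
  proof (rule Lim_null_comparison)
    have "cmod (\<tau> - f (of_real (\<sigma> n) * \<tau>)) \<le> sqrt (1 - \<sigma> n)" for n
      using radial[of "\<sigma> n"] \<sigma>[of n] s0 by (intro real_le_rsqrt) auto
    then show "\<forall>\<^sub>F n in sequentially. norm (\<tau> - f (of_real (\<sigma> n) * \<tau>)) \<le> sqrt (1 - \<sigma> n)" by simp
    have "(\<lambda>n. sqrt (1 - \<sigma> n)) \<longlonglongrightarrow> sqrt (1 - 1)" by (intro tendsto_intros \<sigma>lim)
    then show "(\<lambda>n. sqrt (1 - \<sigma> n)) \<longlonglongrightarrow> 0" by simp
  qed
  then have "(\<lambda>n. \<tau> - (\<tau> - f (of_real (\<sigma> n) * \<tau>))) \<longlonglongrightarrow> \<tau> - 0" by (intro tendsto_diff tendsto_const)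
  then have fl: "(\<lambda>n. f (of_real (\<sigma> n) * \<tau>)) \<longlonglongrightarrow> \<tau>" by simp
  have "(\<lambda>n. of_real (\<sigma> n) * \<tau>) \<longlonglongrightarrow> of_real 1 * \<tau>" by (intro tendsto_intros \<sigma>lim)
  then have wl: "(\<lambda>n. of_real (\<sigma> n) * \<tau>) \<longlonglongrightarrow> \<tau>" by simp
  have sD': "of_real (\<sigma> n) * \<tau> \<in> unit_disc" for n using \<sigma>[of n] s0 by (intro sD) auto
  show ?thesis by (rule julia_inequality[OF f sD' wl fl bound[OF \<sigma>] z])
qed

section \<open>The Koenigs function and the size of its image\<close>

lemma koenigs_shift:
  assumes k: "koenigs_function \<Phi> h" and t: "0 \<le> t" and z: "z \<in> unit_disc"
  shows "\<Phi> t z \<in> unit_disc" "h (\<Phi> t z) = h z + of_real t"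
proof -
  have *: "h z + of_real t \<in> h ` unit_disc" "\<Phi> t z = inv_into unit_disc h (h z + of_real t)"
    using k t z unfolding koenigs_function_def by blast+
  show "\<Phi> t z \<in> unit_disc" "h (\<Phi> t z) = h z + of_real t"
    unfolding *(2) using inv_into_into[OF *(1)] f_inv_into_f[OF *(1)] by auto
qed

lemma koenigs_inverse:
  assumes k: "koenigs_function \<Phi> h"
  obtains g where "g holomorphic_on h ` unit_disc" "\<And>z. z \<in> unit_disc \<Longrightarrow> g (h z) = z"
    "\<And>w. w \<in> h ` unit_disc \<Longrightarrow> g w \<in> unit_disc" "\<And>w. w \<in> h ` unit_disc \<Longrightarrow> h (g w) = w"
proof -
  have h: "h holomorphic_on unit_disc" "inj_on h unit_disc" using k by (auto simp: koenigs_function_def)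
  obtain g where g: "g holomorphic_on h ` unit_disc" "\<And>z. z \<in> unit_disc \<Longrightarrow> g (h z) = z"
    using holomorphic_has_inverse[OF h(1) open_ball h(2)] by metis
  have "g w \<in> unit_disc" "h (g w) = w" if "w \<in> h ` unit_disc" for w using that g(2) by auto
  with g show ?thesis by (rule that)
qed

text \<open>A disc of radius \<open>R\<close> in the Koenigs domain stays in it when moved to the right, so by Schwarz-Pick
  one step of the semiflow can multiply \<open>1 - \<bar>z\<bar>\<close> at worst by \<open>1 - 3 / R\<close>; for large \<open>R\<close> this is slower
  than the geometric decay at the Denjoy-Wolff point.\<close>

lemma koenigs_domain_no_large_disc:
  assumes hyp: "hyperbolic_semiflow \<Phi>" and k: "koenigs_function \<Phi> h"
  obtains R where "0 < R" "\<And>w. \<not> ball w R \<subseteq> h ` unit_disc"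
proof -
  have sf: "holomorphic_semiflow \<Phi>" using hyp by (simp add: hyperbolic_semiflow_def)
  obtain \<tau> \<alpha> where dw: "denjoy_wolff_point \<Phi> \<tau>" and \<alpha>: "\<alpha> < 0"
    and nt: "\<And>t. 0 \<le> t \<Longrightarrow> nontangential_limit (deriv (\<Phi> t)) \<tau> (of_real (exp (t * \<alpha>)))"
    using hyp by (auto simp: hyperbolic_semiflow_def)
  define f where "f = \<Phi> 1"
  have f: "f holomorphic_on unit_disc" "\<And>z. z \<in> unit_disc \<Longrightarrow> f z \<in> unit_disc"
    using sf by (auto simp: holomorphic_semiflow_def f_def Pi_iff)
  have fD: "(f ^^ n) z \<in> unit_disc" if "z \<in> unit_disc" for n z
    by (induction n) (use that f in auto)
  have fn: "(f ^^ n) z = \<Phi> (real n) z" if "z \<in> unit_disc" for n z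
  proof (induction n)
    case 0 then show ?case using sf that by (simp add: holomorphic_semiflow_def)
  next
    case (Suc n)
    have "\<Phi> (1 + real n) z = \<Phi> 1 (\<Phi> (real n) z)" using sf that unfolding holomorphic_semiflow_def by auto
    then show ?case using Suc by (simp add: f_def)
  qed
  have \<tau>: "cmod \<tau> = 1" using dw by (simp add: denjoy_wolff_point_def)
  have "((\<lambda>t. \<Phi> t 0) \<longlongrightarrow> \<tau>) at_top"
    using dw[unfolded denjoy_wolff_point_def, THEN conjunct2, rule_format, of "{0}"] by simp
  then have "(\<lambda>n. \<Phi> (real n) 0) \<longlonglongrightarrow> \<tau>" by (rule filterlim_compose[OF _ filterlim_real_sequentially])
  then have lim: "(\<lambda>n. (f ^^ n) 0) \<longlonglongrightarrow> \<tau>" by (simp add: fn)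
  define a where "a = exp \<alpha>"
  have a: "0 < a" "a < 1" using \<alpha> by (auto simp: a_def)
  have nta: "nontangential_limit (deriv f) \<tau> (of_real a)" using nt[of 1] by (simp add: f_def a_def)
  define c where "c = (a + 1) / 2"
  have c: "a < c" "c < 1" "0 < c" using a by (auto simp: c_def)
  \<comment> \<open>The level sets of \<open>E\<close> are the horocycles at \<open>\<tau>\<close>;
    the Julia coefficient below 1 makes \<open>E\<close> decay geometrically along orbits.\<close>
  define E where "E z = (cmod (1 - cnj \<tau> * z))\<^sup>2 / (1 - (cmod z)\<^sup>2)" for z
  have pos: "0 < 1 - (cmod z)\<^sup>2" if "z \<in> unit_disc" for z :: complex using that by (simp add: abs_square_less_1)
  have Estep: "E (f z) \<le> c * E z" if z: "z \<in> unit_disc" for z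
    using julia_coefficient_bound[OF f \<tau> lim a nta c(1) z] pos[OF z] pos[OF f(2)[OF z]]
    by (simp add: E_def field_simps)
  have En: "E ((f ^^ n) z) \<le> c ^ n * E z" if z: "z \<in> unit_disc" for n z
  proof (induction n)
    case (Suc n)
    have "E ((f ^^ Suc n) z) \<le> c * E ((f ^^ n) z)" using Estep[OF fD[OF z]] by simp
    also have "\<dots> \<le> c * (c ^ n * E z)" using c Suc by (intro mult_left_mono) auto
    finally show ?case by simp
  qed simp
  \<comment> \<open>\<open>E\<close> controls the distance to the circle because
    \<open>\<bar>1 - cnj \<tau> * z\<bar> \<ge> 1 - \<bar>z\<bar>\<close>; the factor 2 bounds
    \<open>1 + \<bar>z\<bar>\<close>.\<close>
  have Elow: "1 - cmod z \<le> 2 * E z" if z: "z \<in> unit_disc" for z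
  proof -
    have z1: "cmod z < 1" using z by simp
    have "1 - cmod z \<le> cmod (1 - cnj \<tau> * z)"
      using norm_triangle_ineq2[of 1 "cnj \<tau> * z"] \<tau> by (simp add: norm_mult)
    then have "(1 - cmod z)\<^sup>2 \<le> (cmod (1 - cnj \<tau> * z))\<^sup>2" using z1 by (intro power_mono) auto
    moreover have "(1 - cmod z) * (1 - (cmod z)\<^sup>2) \<le> 2 * (1 - cmod z)\<^sup>2"
    proof -
      have "(1 - cmod z)\<^sup>2 * (1 + cmod z) \<le> (1 - cmod z)\<^sup>2 * 2" using z1 by (intro mult_left_mono) auto
      then show ?thesis by (simp add: power2_eq_square algebra_simps)
    qed
    ultimately have "(1 - cmod z) * (1 - (cmod z)\<^sup>2) \<le> 2 * (cmod (1 - cnj \<tau> * z))\<^sup>2" by linarith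
    then show ?thesis using pos[OF z] by (simp add: E_def field_simps)
  qed
  \<comment> \<open>With this value \<open>K = (1 + c) / 2\<close> lies strictly between
    \<open>c\<close> and 1.\<close>
  define s where "s = (1 - c) / 6"
  define K where "K = 1 - 3 * s"
  have s: "0 < s" "s < 1" "3 * s < 1" "c < K" "0 < K" using c by (auto simp: s_def K_def field_simps)
  obtain g where g: "g holomorphic_on h ` unit_disc" "\<And>z. z \<in> unit_disc \<Longrightarrow> g (h z) = z"
    "\<And>w. w \<in> h ` unit_disc \<Longrightarrow> g w \<in> unit_disc" "\<And>w. w \<in> h ` unit_disc \<Longrightarrow> h (g w) = w"
    using koenigs_inverse[OF k] by metis
  have "\<not> ball w (1 / s) \<subseteq> h ` unit_disc" for w
  proof
    assume sub: "ball w (1 / s) \<subseteq> h ` unit_disc"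
    have "w \<in> ball w (1 / s)" using s by simp
    then obtain z where z: "z \<in> unit_disc" "h z = w" using sub by blast
    have hn: "h ((f ^^ n) z) = w + of_nat n" for n
      using koenigs_shift(2)[OF k _ z(1), of "real n"] z by (simp add: fn)
    have step: "K * (1 - cmod ((f ^^ n) z)) \<le> 1 - cmod ((f ^^ Suc n) z)" for n
    proof -
      \<comment> \<open>The inverse Koenigs function on the translated disc of radius
        \<open>1 / s\<close>, rescaled to the unit disc; one time step takes the centre to the point
        with parameter \<open>s\<close>.\<close>
      define G where "G \<zeta> = g (w + of_nat n + of_real (1/s) * \<zeta>)" for \<zeta>
      have dom: "w + of_nat n + of_real (1/s) * \<zeta> \<in> h ` unit_disc" if "\<zeta> \<in> unit_disc" for \<zeta>
      proof -
        have "w + of_real (1/s) * \<zeta> \<in> ball w (1/s)" using that s by (simp add: dist_norm norm_mult norm_divide field_simps)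
        then obtain x where "x \<in> unit_disc" "h x = w + of_real (1/s) * \<zeta>" using sub by (metis imageE subsetD)
        then have "h (\<Phi> (real n) x) = w + of_nat n + of_real (1/s) * \<zeta>" "\<Phi> (real n) x \<in> unit_disc"
          using koenigs_shift[OF k, of "real n" x] by auto
        then show ?thesis by (metis image_eqI)
      qed
      have "G holomorphic_on unit_disc" unfolding G_def
        by (rule holomorphic_on_compose_gen[of "\<lambda>\<zeta>. w + of_nat n + of_real (1/s) * \<zeta>" _ g "h ` unit_disc", unfolded o_def])
          (use dom g in \<open>auto intro!: holomorphic_intros\<close>)
      moreover have GD: "G \<zeta> \<in> unit_disc" if "\<zeta> \<in> unit_disc" for \<zeta> unfolding G_def by (intro g dom that)
      ultimately have "cmod ((G (of_real s) - G 0) / (1 - cnj (G 0) * G (of_real s))) \<le> cmod ((of_real s - 0) / (1 - cnj 0 * of_real s))"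
        using s by (intro schwarz_pick) auto
      then have "cmod ((G (of_real s) - G 0) / (1 - cnj (G 0) * G (of_real s))) \<le> s" using s by simp
      moreover have "G 0 = (f ^^ n) z" unfolding G_def using g(2)[OF fD[OF z(1), of n]] by (simp add: hn)
      moreover have "G (of_real s) = (f ^^ Suc n) z"
      proof -
        have "w + of_nat n + of_real (1/s) * of_real s = h ((f ^^ Suc n) z)"
          unfolding hn using s by (simp flip: of_real_mult)
        then show ?thesis unfolding G_def using g(2)[OF fD[OF z(1), of "Suc n"]] by simp
      qed
      ultimately show ?thesis
        unfolding K_def using fD[OF z(1), of n] fD[OF z(1), of "Suc n"] s
        by (intro pseudo_hyperbolic_norm_lower_bound) auto
    qed
    have low: "K ^ n * (1 - cmod z) \<le> 1 - cmod ((f ^^ n) z)" for n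
    proof (induction n)
      case (Suc n)
      have "K * (K ^ n * (1 - cmod z)) \<le> K * (1 - cmod ((f ^^ n) z))" using Suc s by (intro mult_left_mono) auto
      then show ?case using step[of n] by simp
    qed simp
    \<comment> \<open>The distance to the circle would decay no faster than \<open>K ^ n\<close> and
      at least as fast as \<open>c ^ n\<close>, although \<open>c < K\<close>.\<close>
    have "1 - cmod z \<le> 2 * E z * (c / K) ^ n" for n
    proof -
      have "K ^ n * (1 - cmod z) \<le> 2 * (c ^ n * E z)"
        using low[of n] Elow[OF fD[OF z(1)], of n] En[OF z(1), of n] by linarith
      then show ?thesis using s by (simp add: power_divide field_simps)
    qed
    moreover have "(\<lambda>n. 2 * E z * (c / K) ^ n) \<longlonglongrightarrow> 2 * E z * 0"
      using c s by (intro tendsto_intros LIMSEQ_power_zero) auto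
    ultimately have "1 - cmod z \<le> 2 * E z * 0" by (intro LIMSEQ_le_const) auto
    then show False using z by simp
  qed
  then show ?thesis using that[of "1 / s"] s by simp
qed

text \<open>Invariance makes the set of heights at abscissa \<open>n\<close> increase with
  \<open>n\<close>, so a compact interval of heights is reached at a single abscissa. Everything to
  the right of that vertical segment lies in \<open>\<Omega>\<close>, and an interval of length
  \<open>2 * R\<close> leaves room for a disc of radius \<open>R\<close>.\<close>

lemma right_invariant_domain_in_strip:
  assumes \<Omega>: "open \<Omega>" "connected \<Omega>" and shift: "\<And>w t. w \<in> \<Omega> \<Longrightarrow> 0 \<le> t \<Longrightarrow> w + of_real t \<in> \<Omega>"
    and R: "0 < R" "\<And>w. \<not> ball w R \<subseteq> \<Omega>"
  obtains b where "\<And>w. w \<in> \<Omega> \<Longrightarrow> \<bar>Im w\<bar> \<le> b"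
proof (cases "\<Omega> = {}")
  case True then show ?thesis using that[of 0] by blast
next
  case False
  then obtain w0 where w0: "w0 \<in> \<Omega>" by blast
  have conn: "connected (Im ` \<Omega>)" by (intro connected_continuous_image \<Omega> continuous_intros)
  have gap: "\<bar>Im w - Im w'\<bar> \<le> 2 * R" if w: "w \<in> \<Omega>" "w' \<in> \<Omega>" "Im w \<le> Im w'" for w w'
  proof (rule ccontr)
    assume "\<not> ?thesis"
    then have big: "2 * R < Im w' - Im w" using w by simp
    define y where "y = (Im w + Im w') / 2"
    let ?J = "{y - R..y + R}"
    have J: "?J \<subseteq> Im ` \<Omega>"
    proof
      fix u assume "u \<in> ?J"
      then have "Im w \<le> u" "u \<le> Im w'" using big by (auto simp: y_def field_simps)
      then show "u \<in> Im ` \<Omega>" using conn w unfolding connected_iff_interval by blast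
    qed
    define U where "U n = {u. Complex (real n) u \<in> \<Omega>}" for n :: nat
    have mono: "U n \<subseteq> U m" if "n \<le> m" for n m
    proof
      fix u assume "u \<in> U n"
      then show "u \<in> U m" using shift[of "Complex (real n) u" "real m - real n"] that
        by (simp add: U_def complex_of_real_def complex_eq_iff plus_complex.code)
    qed
    have opn: "open (U n)" for n
    proof -
      have "continuous_on UNIV (\<lambda>u. Complex (real n) u)" by (intro continuous_intros)
      from open_vimage[OF \<Omega>(1) this] show ?thesis by (simp add: U_def vimage_def)
    qed
    have cov: "?J \<subseteq> (\<Union>n. U n)"
    proof
      fix u assume "u \<in> ?J"
      then obtain x where x: "x \<in> \<Omega>" "Im x = u" using J by blast
      obtain n where n: "Re x \<le> real n" using real_arch_simple by blast
      have "Complex (real n) u = x + of_real (real n - Re x)" using x by (simp add: complex_eq_iff)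
      also have "\<dots> \<in> \<Omega>" by (rule shift[OF x(1)]) (use n in simp)
      finally show "u \<in> (\<Union>n. U n)" by (auto simp: U_def)
    qed
    obtain D where D: "finite D" "?J \<subseteq> (\<Union>n\<in>D. U n)"
      using compactE_image[OF compact_Icc, of UNIV U "y - R" "y + R"] opn cov by metis
    have JM: "?J \<subseteq> U (Max (insert 0 D))"
    proof
      fix u assume "u \<in> ?J"
      then obtain n where "n \<in> D" "u \<in> U n" using D by blast
      then show "u \<in> U (Max (insert 0 D))" using mono[of n "Max (insert 0 D)"] D by auto
    qed
    let ?M = "real (Max (insert 0 D))"
    \<comment> \<open>The centre is moved right by \<open>R\<close>, so that the whole disc lies to
      the right of abscissa \<open>?M\<close>.\<close>
    have "ball (Complex (?M + R) y) R \<subseteq> \<Omega>"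
    proof
      fix x assume "x \<in> ball (Complex (?M + R) y) R"
      then have "cmod (Complex (?M + R) y - x) < R" by (simp add: dist_norm)
      then have "\<bar>Re (Complex (?M + R) y - x)\<bar> < R" "\<bar>Im (Complex (?M + R) y - x)\<bar> < R"
        using abs_Re_le_cmod abs_Im_le_cmod order_le_less_trans by blast+
      then have "Im x \<in> ?J" "?M \<le> Re x" by auto
      then have "Complex ?M (Im x) \<in> \<Omega>" using JM by (auto simp: U_def)
      moreover have "x = Complex ?M (Im x) + of_real (Re x - ?M)" by (simp add: complex_eq_iff)
      ultimately show "x \<in> \<Omega>" using shift[of "Complex ?M (Im x)" "Re x - ?M"] \<open>?M \<le> Re x\<close> by simp
    qed
    then show False using R by blast
  qed
  have "\<bar>Im w\<bar> \<le> \<bar>Im w0\<bar> + 2 * R" if "w \<in> \<Omega>" for w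
    using gap[OF that w0] gap[OF w0 that] by (cases "Im w \<le> Im w0") linarith+
  then show ?thesis by (rule that)
qed

section \<open>Kernel convergence\<close>

lemma nbhd_properties:
  fixes \<Omega> :: "complex set"
  assumes "connected \<Omega>" "0 < d"
  shows "open (\<Union>v\<in>\<Omega>. ball v d)" "connected (\<Union>v\<in>\<Omega>. ball v d)" "\<Omega> \<subseteq> (\<Union>v\<in>\<Omega>. ball v d)"
proof -
  show "open (\<Union>v\<in>\<Omega>. ball v d)" by blast
  show "\<Omega> \<subseteq> (\<Union>v\<in>\<Omega>. ball v d)" using assms by force
  \<comment> \<open>The neighbourhood is the sum of \<open>\<Omega>\<close> and a disc, hence a
    continuous image of a connected product.\<close>
  have "(\<Union>v\<in>\<Omega>. ball v d) = (\<lambda>(x, y). x + y) ` (\<Omega> \<times> ball 0 d)"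
  proof (intro equalityI subsetI)
    fix x assume "x \<in> (\<Union>v\<in>\<Omega>. ball v d)"
    then obtain v where "v \<in> \<Omega>" "dist v x < d" by auto
    then show "x \<in> (\<lambda>(x, y). x + y) ` (\<Omega> \<times> ball 0 d)"
      by (intro image_eqI[of _ _ "(v, x - v)"]) (auto simp: dist_norm norm_minus_commute)
  qed (force simp: dist_norm)
  moreover have "continuous_on (\<Omega> \<times> ball 0 d) (\<lambda>(x, y). x + y)"
    unfolding case_prod_beta by (intro continuous_intros)
  ultimately show "connected (\<Union>v\<in>\<Omega>. ball v d)"
    using connected_continuous_image connected_Times[OF assms(1) connected_ball] by metis
qed

text \<open>The complement is invariant under translation to the left, so each of its components
  contains a ray and is unbounded.\<close>

lemma right_invariant_simply_connected:
  fixes U :: "complex set"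
  assumes U: "open U" "connected U" and shift: "\<And>w t. w \<in> U \<Longrightarrow> 0 \<le> t \<Longrightarrow> w + of_real t \<in> U"
  shows "simply_connected U"
  unfolding simply_connected_eq_unbounded_complement_components[OF U(1)]
proof (intro conjI ballI U)
  fix C assume C: "C \<in> components (- U)"
  then obtain c where c: "c \<in> C" using in_components_nonempty by blast
  then have cU: "c \<notin> U" using in_components_subset[OF C] by blast
  define L where "L = (\<lambda>t. c - of_real t) ` {0::real..}"
  have "connected L" unfolding L_def by (intro connected_continuous_image continuous_intros) auto
  moreover have "L \<subseteq> - U"
  proof
    fix x assume "x \<in> L"
    then obtain t where "0 \<le> t" "x = c - of_real t" by (auto simp: L_def)
    then show "x \<in> - U" using shift[of x t] cU by auto
  qed
  moreover have "c \<in> L" unfolding L_def by (intro image_eqI[of _ _ 0]) auto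
  ultimately have LC: "L \<subseteq> C" using components_maximal[OF C] c by blast
  show "\<not> bounded C"
  proof
    assume "bounded C"
    then obtain B where B: "\<And>x. x \<in> C \<Longrightarrow> cmod x \<le> B" by (auto simp: bounded_iff)
    have "0 \<le> B" using B[OF c] norm_ge_zero[of c] by linarith
    have "c - of_real (cmod c + B + 1) \<in> C" 
      by (rule subsetD[OF LC]) (use \<open>0 \<le> B\<close> in \<open>auto simp: L_def simp del: of_real_add\<close>)
    then have "cmod (c - of_real (cmod c + B + 1)) \<le> B" by (rule B)
    moreover have "cmod (of_real (cmod c + B + 1)) = cmod c + B + 1"
      unfolding norm_of_real using \<open>0 \<le> B\<close> by simp
    ultimately show False
      using norm_triangle_ineq2[of "of_real (cmod c + B + 1)" c] by (simp only: norm_minus_commute)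
  qed
qed

lemma riemann_map_normalized:
  assumes S: "open S" "simply_connected S" "S \<noteq> UNIV" "w0 \<in> S"
  obtains k m where "k holomorphic_on S" "m holomorphic_on unit_disc"
    "\<And>w. w \<in> S \<Longrightarrow> k w \<in> unit_disc" "\<And>z. z \<in> unit_disc \<Longrightarrow> m z \<in> S"
    "\<And>w. w \<in> S \<Longrightarrow> m (k w) = w" "k w0 = 0"
proof -
  obtain f g where f: "f holomorphic_on S" and g: "g holomorphic_on unit_disc"
    and fg: "\<forall>z\<in>S. f z \<in> unit_disc \<and> g (f z) = z" and gf: "\<forall>z\<in>unit_disc. g z \<in> S \<and> f (g z) = z"
    using Riemann_mapping_theorem[of S] S by blast
  define a where "a = f w0"
  have a: "cmod a < 1" "cmod (- a) < 1" using fg S(4) by (auto simp: a_def)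
  define k where "k w = (f w - a) / (1 - cnj a * f w)" for w
  define \<psi> where "\<psi> z = (z - (- a)) / (1 - cnj (- a) * z)" for z
  have \<psi>: "\<psi> holomorphic_on unit_disc" "\<psi> ` unit_disc \<subseteq> unit_disc"
    unfolding \<psi>_def using blaschke_factor_holomorphic[OF a(2)] blaschke_norm_less_1[OF a(2)] by auto
  have fD: "cmod (f w) < 1" if "w \<in> S" for w using fg that by auto
  show ?thesis
  proof (rule that[of k "g \<circ> \<psi>"])
    have "((\<lambda>z. (z - a) / (1 - cnj a * z)) \<circ> f) holomorphic_on S"
      using fg by (intro holomorphic_on_compose_gen[OF f blaschke_factor_holomorphic[OF a(1)]]) auto
    then show "k holomorphic_on S" by (simp add: k_def[abs_def] o_def)
    show "g \<circ> \<psi> holomorphic_on unit_disc" by (rule holomorphic_on_compose_gen[OF \<psi>(1) g \<psi>(2)])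
    show "k w \<in> unit_disc" if "w \<in> S" for w
      using blaschke_norm_less_1[OF a(1) fD[OF that]] by (simp add: k_def)
    show "(g \<circ> \<psi>) z \<in> S" if "z \<in> unit_disc" for z
      using gf \<psi>(2) that by (auto simp: image_subset_iff)
    show "(g \<circ> \<psi>) (k w) = w" if "w \<in> S" for w
    proof -
      have "\<psi> (k w) = f w" using blaschke_inverse[OF a(1) fD[OF that]] by (simp add: \<psi>_def k_def)
      then show ?thesis using fg that by simp
    qed
    show "k w0 = 0" by (simp add: k_def a_def)
  qed
qed

text \<open>The values avoid the line of height \<open>B\<close>; two points of this line, rescaled
  to 0 and 1, are omitted by every function of the family, and Schottky's theorem gives local
  boundedness. The distance of the two points equals the distance of \<open>w0\<close> from the
  first, so all rescaled values at 0 have modulus 1.\<close>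

lemma strip_valued_locally_bounded:
  fixes m :: "nat \<Rightarrow> complex \<Rightarrow> complex"
  assumes m: "\<And>n. m n holomorphic_on unit_disc" "\<And>n z. z \<in> unit_disc \<Longrightarrow> Im (m n z) < B" "\<And>n. m n 0 = w0"
    and K: "compact K" "K \<subseteq> unit_disc"
  shows "\<exists>C. \<forall>n. \<forall>z\<in>K. cmod (m n z) \<le> C"
proof -
  define c where "c = Complex 0 B"
  have "Im w0 < B" using m(2)[of 0 0] m(3)[of 0] by simp
  then have "w0 \<noteq> c" by (auto simp: c_def)
  define r where "r = cmod (w0 - c)"
  have r: "0 < r" using \<open>w0 \<noteq> c\<close> by (simp add: r_def)
  define F where "F n z = (m n z - c) / of_real r" for n z
  have nz: "F n z \<noteq> 0 \<and> F n z \<noteq> 1" if "z \<in> unit_disc" for n z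
  proof -
    have "m n z \<noteq> c" "m n z \<noteq> c + of_real r" using m(2)[OF that, of n] by (auto simp: c_def complex_eq_iff)
    then show ?thesis using r by (simp add: F_def field_simps)
  qed
  obtain C where C: "\<And>h z. h \<in> range F \<Longrightarrow> z \<in> K \<Longrightarrow> cmod (h z) \<le> C"
  proof (rule GPicard3[of unit_disc 0 "range F" "range F" K])
    show "h holomorphic_on unit_disc" if "h \<in> range F" for h
      using that r unfolding F_def by (auto intro!: holomorphic_intros m)
    show "h z \<noteq> 0 \<and> h z \<noteq> 1" if "h \<in> range F" "z \<in> unit_disc" for h z using nz that by auto
    show "cmod (h 0) \<le> 1" if "h \<in> range F" for h
      using that r by (auto simp: F_def m(3) norm_divide r_def)
  qed (use K in auto)
  have "cmod (m n z) \<le> r * C + cmod c" if "z \<in> K" for n z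
  proof -
    have "m n z = of_real r * F n z + c" using r by (simp add: F_def)
    then have "cmod (m n z) \<le> cmod (of_real r * F n z) + cmod c" by (metis norm_triangle_ineq)
    also have "cmod (of_real r * F n z) = r * cmod (F n z)" using r by (simp add: norm_mult)
    also have "\<dots> \<le> r * C" using r C[OF rangeI that] by (intro mult_left_mono) auto
    finally show ?thesis by simp
  qed
  then show ?thesis by blast
qed

text \<open>Caratheodory kernel convergence: the Riemann maps \<open>k n\<close> of the neighbourhoods of \<open>\<Omega>\<close>, read in the
  disc through \<open>h\<close>, converge to a rotation, because limits of the inverse maps have values in the interior
  of the closure of \<open>\<Omega>\<close>.\<close>

lemma kernel_approximation:
  assumes h: "h holomorphic_on unit_disc" "inj_on h unit_disc" and \<Omega>: "\<Omega> = h ` unit_disc"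
    and shift: "\<And>w t. w \<in> \<Omega> \<Longrightarrow> 0 \<le> t \<Longrightarrow> w + of_real t \<in> \<Omega>"
    and strip: "\<And>w. w \<in> \<Omega> \<Longrightarrow> \<bar>Im w\<bar> \<le> b"
    and int: "interior (closure \<Omega>) = \<Omega>"
  obtains u :: "nat \<Rightarrow> complex \<Rightarrow> complex" and d :: "nat \<Rightarrow> real"
  where "\<And>j. 0 < d j" "\<And>j. u j holomorphic_on (\<Union>v\<in>\<Omega>. ball v (d j))"
    "\<And>j w. w \<in> (\<Union>v\<in>\<Omega>. ball v (d j)) \<Longrightarrow> cmod (u j w) \<le> 1"
    "\<And>z. z \<in> unit_disc \<Longrightarrow> (\<lambda>j. u j (h z)) \<longlonglongrightarrow> z"
proof -
  define \<delta> where "\<delta> n = inverse (real (Suc n))" for n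
  have \<delta>: "0 < \<delta> n" "\<delta> n \<le> 1" for n by (auto simp: \<delta>_def field_simps)
  define U where "U n = (\<Union>v\<in>\<Omega>. ball v (\<delta> n))" for n
  define w0 where "w0 = h 0"
  have w0: "w0 \<in> \<Omega>" by (auto simp: w0_def \<Omega>)
  have conn: "connected \<Omega>" unfolding \<Omega>
    by (intro connected_continuous_image holomorphic_on_imp_continuous_on h connected_ball)
  have U: "open (U n)" "connected (U n)" "\<Omega> \<subseteq> U n" for n
    unfolding U_def using nbhd_properties[OF conn \<delta>(1)] by blast+
  have Ustrip: "\<bar>Im w\<bar> < b + 1" if w: "w \<in> U n" for w n
  proof -
    obtain v where v: "v \<in> \<Omega>" "dist v w < \<delta> n" using w by (auto simp: U_def)
    have "\<bar>Im (w - v)\<bar> < 1" using abs_Im_le_cmod[of "w - v"] v(2) \<delta>(2)[of n] by (simp add: dist_norm norm_minus_commute)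
    then show ?thesis using strip[OF v(1)] by simp
  qed
  have Ushift: "w + of_real t \<in> U n" if w: "w \<in> U n" and t: "0 \<le> t" for w t n
  proof -
    obtain v where v: "v \<in> \<Omega>" "dist v w < \<delta> n" using w by (auto simp: U_def)
    then have "w + of_real t \<in> ball (v + of_real t) (\<delta> n)" by simp
    then show ?thesis unfolding U_def by (rule UN_I[OF shift[OF v(1) t]])
  qed
  have "\<exists>k m. k holomorphic_on U n \<and> m holomorphic_on unit_disc \<and>
    (\<forall>w\<in>U n. k w \<in> unit_disc \<and> m (k w) = w) \<and> (\<forall>z\<in>unit_disc. m z \<in> U n) \<and> k w0 = 0" for n
  proof -
    have "Complex 0 (b + 1) \<notin> U n" using Ustrip[of "Complex 0 (b + 1)" n] by auto
    then have "U n \<noteq> UNIV" by blast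
    have w0U: "w0 \<in> U n" using w0 U(3) by blast
    have sc: "simply_connected (U n)"
      by (rule right_invariant_simply_connected[OF U(1,2)]) (rule Ushift)
    obtain k m where "k holomorphic_on U n" "m holomorphic_on unit_disc"
      "\<And>w. w \<in> U n \<Longrightarrow> k w \<in> unit_disc" "\<And>z. z \<in> unit_disc \<Longrightarrow> m z \<in> U n"
      "\<And>w. w \<in> U n \<Longrightarrow> m (k w) = w" "k w0 = 0"
      by (rule riemann_map_normalized[OF U(1) sc \<open>U n \<noteq> UNIV\<close> w0U]) blast
    then show ?thesis by blast
  qed
  then obtain k m where k: "\<And>n. k n holomorphic_on U n" "\<And>n. m n holomorphic_on unit_disc"
      "\<And>n w. w \<in> U n \<Longrightarrow> k n w \<in> unit_disc" "\<And>n w. w \<in> U n \<Longrightarrow> m n (k n w) = w"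
      "\<And>n z. z \<in> unit_disc \<Longrightarrow> m n z \<in> U n" "\<And>n. k n w0 = 0"
    by metis
  have m0: "m n 0 = w0" for n using k(4)[of w0 n] k(6)[of n] w0 U(3) by auto
  \<comment> \<open>The inverse Riemann maps form a normal family because their values stay in one
    fixed strip.\<close>
  obtain M r where M: "M holomorphic_on unit_disc" and r: "strict_mono (r :: nat \<Rightarrow> nat)"
      and Mlim: "\<And>x. x \<in> unit_disc \<Longrightarrow> (\<lambda>n. m (r n) x) \<longlonglongrightarrow> M x"
      and Munif: "\<And>K. compact K \<Longrightarrow> K \<subseteq> unit_disc \<Longrightarrow> uniform_limit K (m \<circ> r) M sequentially"
  proof (rule Montel[of unit_disc "range m" m])
    fix K :: "complex set" assume K: "compact K" "K \<subseteq> unit_disc"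
    have "\<exists>C. \<forall>n. \<forall>z\<in>K. cmod (m n z) \<le> C"
    proof (rule strip_valued_locally_bounded[where B = "b + 1", OF k(2) _ m0 K])
      show "Im (m n z) < b + 1" if "z \<in> unit_disc" for n z using Ustrip[OF k(5)[OF that, of n]] by simp
    qed
    then show "\<exists>C. \<forall>h\<in>range m. \<forall>z\<in>K. cmod (h z) \<le> C" by blast
  qed (use k(2) in auto)
  define \<psi> where "\<psi> n z = k (r n) (h z)" for n z
  have hU: "h z \<in> U n" if "z \<in> unit_disc" for z n using U(3)[of n] that by (auto simp: \<Omega>)
  have \<psi>hol: "\<psi> n holomorphic_on unit_disc" for n
    unfolding \<psi>_def using hU by (intro holomorphic_on_compose_gen[OF h(1) k(1), unfolded o_def]) auto
  have \<psi>D: "\<psi> n z \<in> unit_disc" if "z \<in> unit_disc" for n z unfolding \<psi>_def by (intro k(3) hU that)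
  have \<psi>0: "\<psi> n 0 = 0" for n using k(6) by (simp add: \<psi>_def w0_def)
  have \<psi>le: "cmod (\<psi> n z) \<le> cmod z" if "z \<in> unit_disc" for n z
    by (rule Schwarz_Lemma(1)[OF \<psi>hol \<psi>0]) (use \<psi>D that in auto)
  obtain \<Psi> s where \<Psi>: "\<Psi> holomorphic_on unit_disc" and s: "strict_mono (s :: nat \<Rightarrow> nat)"
      and \<Psi>lim: "\<And>x. x \<in> unit_disc \<Longrightarrow> (\<lambda>n. \<psi> (s n) x) \<longlonglongrightarrow> \<Psi> x"
  proof (rule Montel[of unit_disc "range \<psi>" \<psi>])
    fix K :: "complex set" assume K: "compact K" "K \<subseteq> unit_disc"
    have "cmod (\<psi> n z) \<le> 1" if "z \<in> K" for n z using \<psi>D[of z n] K that by auto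
    then show "\<exists>C. \<forall>h\<in>range \<psi>. \<forall>z\<in>K. cmod (h z) \<le> C" by blast
  qed (use \<psi>hol in auto)
  have \<Psi>le: "cmod (\<Psi> z) \<le> cmod z" if "z \<in> unit_disc" for z
    by (rule LIMSEQ_le_const2[OF tendsto_norm[OF \<Psi>lim[OF that]]]) (use \<psi>le[OF that] in blast)
  then have \<Psi>D: "\<Psi> z \<in> unit_disc" if "z \<in> unit_disc" for z using that by force
  \<comment> \<open>The limit of \<open>m (k (h z)) = h z\<close>: by Schwarz's lemma the inner
    points stay in a fixed closed disc, on which the maps \<open>m\<close> converge
    uniformly.\<close>
  have M\<Psi>: "M (\<Psi> z) = h z" if z: "z \<in> unit_disc" for z
  proof -
    let ?K = "cball (0::complex) (cmod z)"
    have K: "compact ?K" "?K \<subseteq> unit_disc" using z by auto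
    have in_K: "\<psi> (s n) z \<in> ?K" for n using \<psi>le[OF z] by simp
    have "uniform_limit ?K (\<lambda>n. (m \<circ> r) (s n)) M sequentially"
      by (rule filterlim_compose[OF Munif[OF K] filterlim_subseq[OF s]])
    moreover have "isCont M (\<Psi> z)"
      using holomorphic_on_imp_continuous_on[OF M] \<Psi>D[OF z] by (simp add: continuous_on_eq_continuous_at)
    then have "(\<lambda>n. M (\<psi> (s n) z)) \<longlonglongrightarrow> M (\<Psi> z)" by (rule isCont_tendsto_compose[OF _ \<Psi>lim[OF z]])
    moreover have "(\<lambda>n. m (r (s n)) (\<psi> (s n) z) - M (\<psi> (s n) z)) \<longlonglongrightarrow> 0"
    proof (rule LIMSEQ_I)
      fix e :: real assume "0 < e"
      then have "\<forall>\<^sub>F n in sequentially. \<forall>x\<in>?K. dist ((m \<circ> r) (s n) x) (M x) < e"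
        using calculation(1) by (intro uniform_limitD)
      then obtain N where "\<And>n x. N \<le> n \<Longrightarrow> x \<in> ?K \<Longrightarrow> dist ((m \<circ> r) (s n) x) (M x) < e"
        unfolding eventually_sequentially by blast
      from this[OF _ in_K] show "\<exists>N. \<forall>n\<ge>N. norm (m (r (s n)) (\<psi> (s n) z) - M (\<psi> (s n) z) - 0) < e"
        by (auto simp: dist_norm)
    qed
    ultimately have "(\<lambda>n. (m (r (s n)) (\<psi> (s n) z) - M (\<psi> (s n) z)) + M (\<psi> (s n) z)) \<longlonglongrightarrow> 0 + M (\<Psi> z)"
      by (intro tendsto_add) auto
    moreover have "m (r (s n)) (\<psi> (s n) z) = h z" for n unfolding \<psi>_def by (rule k(4)[OF hU[OF z]])
    ultimately have "(\<lambda>n. h z) \<longlonglongrightarrow> M (\<Psi> z)" by simp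
    then show ?thesis by (simp add: LIMSEQ_const_iff)
  qed
  have Mcl: "M z \<in> closure \<Omega>" if z: "z \<in> unit_disc" for z
    unfolding closure_approachable
  proof (intro allI impI)
    fix e :: real assume "0 < e"
    then have "\<forall>\<^sub>F n in sequentially. dist (m (r n) z) (M z) < e / 2" using Mlim[OF z] by (intro tendstoD) auto
    moreover have "(\<lambda>n. \<delta> (r n)) \<longlonglongrightarrow> 0"
      unfolding \<delta>_def using LIMSEQ_subseq_LIMSEQ[OF LIMSEQ_inverse_real_of_nat r] by (simp add: o_def)
    then have "\<forall>\<^sub>F n in sequentially. \<delta> (r n) < e / 2" using \<open>0 < e\<close> by (intro order_tendstoD) auto
    ultimately have "\<forall>\<^sub>F n in sequentially. dist (m (r n) z) (M z) < e / 2 \<and> \<delta> (r n) < e / 2" by (rule eventually_conj)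
    then obtain n where n: "dist (m (r n) z) (M z) < e / 2" "\<delta> (r n) < e / 2"
      using eventually_happens'[OF sequentially_bot] by blast
    obtain v where v: "v \<in> \<Omega>" "dist v (m (r n) z) < \<delta> (r n)" using k(5)[OF z, of "r n"] by (auto simp: U_def)
    then have "dist v (M z) < e" using dist_triangle[of v "M z" "m (r n) z"] n by linarith
    then show "\<exists>y\<in>\<Omega>. dist y (M z) < e" using v(1) by blast
  qed
  \<comment> \<open>Being nonconstant, \<open>M\<close> has an open image, which therefore lies in
    the interior of the closure of \<open>\<Omega>\<close>, that is, in
    \<open>\<Omega>\<close>.\<close>
  have nonconst: "\<not> M constant_on unit_disc"
  proof
    assume "M constant_on unit_disc"
    then obtain c where "\<And>z. z \<in> unit_disc \<Longrightarrow> M z = c" unfolding constant_on_def by blast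
    then have "h z = c" if "z \<in> unit_disc" for z using M\<Psi>[OF that] \<Psi>D[OF that] by metis
    then have "h 0 = h (1/2)" by simp
    then show False using inj_onD[OF h(2), of 0 "1/2"] by simp
  qed
  have "open (M ` unit_disc)"
    by (rule open_mapping_thm[OF M open_ball connected_ball open_ball order_refl nonconst])
  then have "M ` unit_disc \<subseteq> interior (closure \<Omega>)" using Mcl by (intro interior_maximal) auto
  then have M\<Omega>: "M z \<in> h ` unit_disc" if "z \<in> unit_disc" for z using int \<Omega> that by auto
  obtain g where g: "g holomorphic_on h ` unit_disc" "\<And>z. z \<in> unit_disc \<Longrightarrow> g (h z) = z"
    using holomorphic_has_inverse[OF h(1) open_ball h(2)] by metis
  have gM: "(g \<circ> M) holomorphic_on unit_disc"
    using M\<Omega> by (intro holomorphic_on_compose_gen[OF M g(1)]) auto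
  have "\<Psi> 0 = 0" using \<Psi>le[of 0] by simp
  then have "M 0 = h 0" using M\<Psi>[of 0] by simp
  then have gM0: "(g \<circ> M) 0 = 0" using g(2)[of 0] by simp
  have gMD: "cmod ((g \<circ> M) z) < 1" if "cmod z < 1" for z using M\<Omega>[of z] that g(2) by auto
  \<comment> \<open>Schwarz's lemma applies to \<open>\<Psi>\<close> and to
    \<open>g \<circ> M\<close>, and the composition of the two is the identity; equality of the
    moduli makes \<open>\<Psi>\<close> a rotation.\<close>
  have "cmod (\<Psi> z) = cmod z" if z: "z \<in> unit_disc" for z
  proof -
    have "(g \<circ> M) (\<Psi> z) = z" using M\<Psi>[OF z] g(2)[OF z] by simp
    moreover have "cmod ((g \<circ> M) (\<Psi> z)) \<le> cmod (\<Psi> z)"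
      by (rule Schwarz_Lemma(1)[OF gM gM0 gMD]) (use \<Psi>D[OF z] in auto)
    ultimately show ?thesis using \<Psi>le[OF z] by simp
  qed
  then have "cmod (\<Psi> (1/2)) = cmod (1/2)" by (simp add: norm_divide)
  then have "\<exists>z. cmod z < 1 \<and> z \<noteq> 0 \<and> cmod (\<Psi> z) = cmod z" by (intro exI[of _ "1/2"]) simp
  then obtain \<alpha> where \<alpha>: "\<And>z. cmod z < 1 \<Longrightarrow> \<Psi> z = \<alpha> * z" "cmod \<alpha> = 1"
    using Schwarz_Lemma(3)[OF \<Psi> \<open>\<Psi> 0 = 0\<close>, of 0] \<Psi>D by auto
  have \<alpha>0: "\<alpha> \<noteq> 0" using \<alpha>(2) by auto
  show ?thesis
  \<comment> \<open>Division by \<open>\<alpha>\<close> undoes the rotation.\<close>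
  proof (rule that[of "\<lambda>j. \<delta> (r (s j))" "\<lambda>j w. k (r (s j)) w / \<alpha>"])
    show "0 < \<delta> (r (s j))" for j by (rule \<delta>)
    show "(\<lambda>w. k (r (s j)) w / \<alpha>) holomorphic_on (\<Union>v\<in>\<Omega>. ball v (\<delta> (r (s j))))" for j
      using k(1)[of "r (s j)"] \<alpha>0 unfolding U_def by (intro holomorphic_intros)
    show "cmod (k (r (s j)) w / \<alpha>) \<le> 1" if "w \<in> (\<Union>v\<in>\<Omega>. ball v (\<delta> (r (s j))))" for j w
      using k(3)[of w "r (s j)"] that \<alpha>(2) unfolding U_def by (simp add: norm_divide less_imp_le)
    fix z :: complex assume z: "z \<in> unit_disc"
    have "(\<lambda>j. \<psi> (s j) z / \<alpha>) \<longlonglongrightarrow> \<Psi> z / \<alpha>" by (intro tendsto_intros \<Psi>lim z \<alpha>0)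
    then show "(\<lambda>j. k (r (s j)) (h z) / \<alpha>) \<longlonglongrightarrow> z" using \<alpha>(1)[of z] \<alpha>0 z by (simp add: \<psi>_def)
  qed
qed

section \<open>Weighted approximation by exponentials\<close>

text \<open>The weight is a growth that functions built from \<open>exp (\<epsilon> h)\<close> and
  \<open>exp (- \<epsilon> h)\<close> can dominate; with real frequencies \<open>s\<close> the
  exponentials stay bounded on a horizontal strip.\<close>

definition exp_approximable :: "complex set \<Rightarrow> real \<Rightarrow> (complex \<Rightarrow> complex) \<Rightarrow> bool"
  where "exp_approximable \<Omega> \<epsilon> f \<longleftrightarrow> (\<forall>\<eta>>0. \<exists>I c. finite (I :: real set) \<and>
    (\<forall>w\<in>\<Omega>. cmod (f w - (\<Sum>s\<in>I. c s * exp (\<i> * of_real s * w))) \<le> \<eta> * exp (\<epsilon> * \<bar>Re w\<bar>)))"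

lemma exp_approximableD:
  assumes "exp_approximable \<Omega> \<epsilon> f" "0 < \<eta>"
  shows "\<exists>I c. finite (I :: real set) \<and>
    (\<forall>w\<in>\<Omega>. cmod (f w - (\<Sum>s\<in>I. c s * exp (\<i> * of_real s * w))) \<le> \<eta> * exp (\<epsilon> * \<bar>Re w\<bar>))"
  by (rule assms(1)[unfolded exp_approximable_def, rule_format, OF assms(2)])

lemma exp_approximable_cong:
  assumes "exp_approximable \<Omega> \<epsilon> f" "\<And>w. w \<in> \<Omega> \<Longrightarrow> f w = g w"
  shows "exp_approximable \<Omega> \<epsilon> g"
  using assms unfolding exp_approximable_def by simp

lemma exp_approximable_subset:
  assumes "exp_approximable \<Omega> \<epsilon> f" "\<Omega>' \<subseteq> \<Omega>"
  shows "exp_approximable \<Omega>' \<epsilon> f"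
  using assms unfolding exp_approximable_def by (meson subsetD)

lemma exp_approximable_exp: "exp_approximable \<Omega> \<epsilon> (\<lambda>w. exp (\<i> * of_real s * w))"
  unfolding exp_approximable_def by (intro allI impI exI[of _ "{s}"] exI[of _ "\<lambda>_. 1"]) simp

lemma exp_approximable_zero: "exp_approximable \<Omega> \<epsilon> (\<lambda>_. 0)"
  unfolding exp_approximable_def by (intro allI impI exI[of _ "{}"] exI[of _ "\<lambda>_. 1"]) simp

lemma exp_approximable_add:
  assumes f: "exp_approximable \<Omega> \<epsilon> f" and g: "exp_approximable \<Omega> \<epsilon> g"
  shows "exp_approximable \<Omega> \<epsilon> (\<lambda>w. f w + g w)"
  unfolding exp_approximable_def
proof (intro allI impI)
  fix \<eta> :: real assume "0 < \<eta>"
  then have e2: "0 < \<eta> / 2" by simp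
  from exp_approximableD[OF f e2] obtain I c where "finite (I :: real set)"
    and "\<forall>w\<in>\<Omega>. cmod (f w - (\<Sum>s\<in>I. c s * exp (\<i> * of_real s * w))) \<le> \<eta> / 2 * exp (\<epsilon> * \<bar>Re w\<bar>)" by (elim exE conjE)
  note I = this(1) bspec[OF this(2)]
  from exp_approximableD[OF g e2] obtain J d where "finite (J :: real set)"
    and "\<forall>w\<in>\<Omega>. cmod (g w - (\<Sum>s\<in>J. d s * exp (\<i> * of_real s * w))) \<le> \<eta> / 2 * exp (\<epsilon> * \<bar>Re w\<bar>)" by (elim exE conjE)
  note J = this(1) bspec[OF this(2)]
  define a where "a s = (if s \<in> I then c s else 0) + (if s \<in> J then d s else 0)" for s
  have ext: "(\<Sum>s\<in>K. c s * E s) = (\<Sum>s\<in>I \<union> J. (if s \<in> K then c s else 0) * E s)"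
    if "K \<subseteq> I \<union> J" for K and c E :: "real \<Rightarrow> complex"
  proof -
    have "(\<Sum>s\<in>I \<union> J. (if s \<in> K then c s else 0) * E s) = (\<Sum>s\<in>K. (if s \<in> K then c s else 0) * E s)"
      using I(1) J(1) that by (intro sum.mono_neutral_right) auto
    then show ?thesis by simp
  qed
  have "cmod (f w + g w - (\<Sum>s\<in>I \<union> J. a s * exp (\<i> * of_real s * w))) \<le> \<eta> * exp (\<epsilon> * \<bar>Re w\<bar>)" if w: "w \<in> \<Omega>" for w
  proof -
    have "(\<Sum>s\<in>I \<union> J. a s * exp (\<i> * of_real s * w)) = (\<Sum>s\<in>I. c s * exp (\<i> * of_real s * w)) + (\<Sum>s\<in>J. d s * exp (\<i> * of_real s * w))"
      unfolding ext[OF Un_upper1] ext[OF Un_upper2] a_def distrib_right sum.distrib ..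
    then have "cmod (f w + g w - (\<Sum>s\<in>I \<union> J. a s * exp (\<i> * of_real s * w)))
      \<le> cmod (f w - (\<Sum>s\<in>I. c s * exp (\<i> * of_real s * w))) + cmod (g w - (\<Sum>s\<in>J. d s * exp (\<i> * of_real s * w)))"
      by (simp only:) (rule norm_diff_triangle_ineq)
    then show ?thesis using I(2)[OF w] J(2)[OF w] by simp
  qed
  then show "\<exists>I c. finite (I :: real set) \<and> (\<forall>w\<in>\<Omega>. cmod (f w + g w - (\<Sum>s\<in>I. c s * exp (\<i> * of_real s * w))) \<le> \<eta> * exp (\<epsilon> * \<bar>Re w\<bar>))"
    using I(1) J(1) by (intro exI[of _ "I \<union> J"] exI[of _ a] conjI ballI) simp_all
qed

lemma exp_approximable_scale:
  assumes f: "exp_approximable \<Omega> \<epsilon> f"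
  shows "exp_approximable \<Omega> \<epsilon> (\<lambda>w. a * f w)"
  unfolding exp_approximable_def
proof (intro allI impI)
  fix \<eta> :: real assume \<eta>: "0 < \<eta>"
  define \<eta>' where "\<eta>' = \<eta> / (cmod a + 1)"
  have a1: "0 < cmod a + 1" by (simp add: add_nonneg_pos)
  then have e2: "0 < \<eta>'" using \<eta> by (simp add: \<eta>'_def)
  from exp_approximableD[OF f e2] obtain I c where "finite (I :: real set)"
    and "\<forall>w\<in>\<Omega>. cmod (f w - (\<Sum>s\<in>I. c s * exp (\<i> * of_real s * w))) \<le> \<eta>' * exp (\<epsilon> * \<bar>Re w\<bar>)" by (elim exE conjE)
  note I = this(1) bspec[OF this(2)]
  have "cmod (a * f w - (\<Sum>s\<in>I. (a * c s) * exp (\<i> * of_real s * w))) \<le> \<eta> * exp (\<epsilon> * \<bar>Re w\<bar>)" if w: "w \<in> \<Omega>" for w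
  proof -
    have "a * f w - (\<Sum>s\<in>I. (a * c s) * exp (\<i> * of_real s * w)) = a * (f w - (\<Sum>s\<in>I. c s * exp (\<i> * of_real s * w)))"
      by (simp add: sum_distrib_left right_diff_distrib mult.assoc)
    then have "cmod (a * f w - (\<Sum>s\<in>I. (a * c s) * exp (\<i> * of_real s * w))) \<le> cmod a * (\<eta>' * exp (\<epsilon> * \<bar>Re w\<bar>))"
      using mult_left_mono[OF I(2)[OF w], of "cmod a"] by (simp add: norm_mult)
    also have "\<dots> \<le> (cmod a + 1) * (\<eta>' * exp (\<epsilon> * \<bar>Re w\<bar>))" using e2 by (intro mult_right_mono) auto
    also have "\<dots> = \<eta> * exp (\<epsilon> * \<bar>Re w\<bar>)" using a1 by (simp add: \<eta>'_def)
    finally show ?thesis .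
  qed
  then show "\<exists>I c. finite (I :: real set) \<and> (\<forall>w\<in>\<Omega>. cmod (a * f w - (\<Sum>s\<in>I. c s * exp (\<i> * of_real s * w))) \<le> \<eta> * exp (\<epsilon> * \<bar>Re w\<bar>))"
    by (intro exI[of _ I] exI[of _ "\<lambda>s. a * c s"] conjI ballI I(1))
qed

lemma exp_approximable_diff:
  assumes "exp_approximable \<Omega> \<epsilon> f" "exp_approximable \<Omega> \<epsilon> g"
  shows "exp_approximable \<Omega> \<epsilon> (\<lambda>w. f w - g w)"
  using exp_approximable_add[OF assms(1) exp_approximable_scale[OF assms(2), of "-1"]] by simp

lemma exp_approximable_sum:
  assumes "\<And>i. i \<in> A \<Longrightarrow> exp_approximable \<Omega> \<epsilon> (f i)"
  shows "exp_approximable \<Omega> \<epsilon> (\<lambda>w. \<Sum>i\<in>A. f i w)"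
  using assms by (induction A rule: infinite_finite_induct) (auto intro: exp_approximable_zero exp_approximable_add)

lemma exp_approximable_limit:
  assumes "\<And>\<eta>. 0 < \<eta> \<Longrightarrow> \<exists>g. exp_approximable \<Omega> \<epsilon> g \<and> (\<forall>w\<in>\<Omega>. cmod (f w - g w) \<le> \<eta> * exp (\<epsilon> * \<bar>Re w\<bar>))"
  shows "exp_approximable \<Omega> \<epsilon> f"
  unfolding exp_approximable_def
proof (intro allI impI)
  fix \<eta> :: real assume "0 < \<eta>"
  then have e2: "0 < \<eta> / 2" by simp
  obtain g where g: "exp_approximable \<Omega> \<epsilon> g" "\<And>w. w \<in> \<Omega> \<Longrightarrow> cmod (f w - g w) \<le> \<eta> / 2 * exp (\<epsilon> * \<bar>Re w\<bar>)"
    using assms[OF e2] by blast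
  from exp_approximableD[OF g(1) e2] obtain I c where "finite (I :: real set)"
    and "\<forall>w\<in>\<Omega>. cmod (g w - (\<Sum>s\<in>I. c s * exp (\<i> * of_real s * w))) \<le> \<eta> / 2 * exp (\<epsilon> * \<bar>Re w\<bar>)" by (elim exE conjE)
  note I = this(1) bspec[OF this(2)]
  have "cmod (f w - (\<Sum>s\<in>I. c s * exp (\<i> * of_real s * w))) \<le> \<eta> * exp (\<epsilon> * \<bar>Re w\<bar>)" if "w \<in> \<Omega>" for w
    using norm_triangle_ineq[of "f w - g w" "g w - (\<Sum>s\<in>I. c s * exp (\<i> * of_real s * w))"] g(2)[OF that] I(2)[OF that] by simp
  then show "\<exists>I c. finite (I :: real set) \<and> (\<forall>w\<in>\<Omega>. cmod (f w - (\<Sum>s\<in>I. c s * exp (\<i> * of_real s * w))) \<le> \<eta> * exp (\<epsilon> * \<bar>Re w\<bar>))"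
    by (intro exI[of _ I] exI[of _ c] conjI ballI I(1))
qed

text \<open>Both sides of the estimate are continuous, so it extends from a dense part; this allows
  points on grid lines to be left out at first.\<close>

lemma exp_approximable_closure:
  assumes f: "exp_approximable \<Omega>' \<epsilon> f" "continuous_on \<Omega> f" and sub: "\<Omega>' \<subseteq> \<Omega>" "\<Omega> \<subseteq> closure \<Omega>'"
  shows "exp_approximable \<Omega> \<epsilon> f"
  unfolding exp_approximable_def
proof (intro allI impI)
  fix \<eta> :: real assume \<eta>: "0 < \<eta>"
  from exp_approximableD[OF f(1) \<eta>] obtain I c where "finite (I :: real set)"
    and "\<forall>w\<in>\<Omega>'. cmod (f w - (\<Sum>s\<in>I. c s * exp (\<i> * of_real s * w))) \<le> \<eta> * exp (\<epsilon> * \<bar>Re w\<bar>)" by (elim exE conjE)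
  note I = this(1) bspec[OF this(2)]
  have "cmod (f w - (\<Sum>s\<in>I. c s * exp (\<i> * of_real s * w))) \<le> \<eta> * exp (\<epsilon> * \<bar>Re w\<bar>)" if w: "w \<in> \<Omega>" for w
  proof -
    obtain x where "(\<forall>n::nat. x n \<in> \<Omega>') \<and> x \<longlonglongrightarrow> w"
      using subsetD[OF sub(2) w] unfolding closure_sequential by (elim exE)
    then have x: "\<And>n::nat. x n \<in> \<Omega>'" "x \<longlonglongrightarrow> w" by blast+
    have fx: "(\<lambda>n. f (x n)) \<longlonglongrightarrow> f w"
      by (rule continuous_on_tendsto_compose[OF f(2) x(2) w]) (use x(1) sub(1) in \<open>auto intro!: always_eventually\<close>)
    show ?thesis
    proof (rule LIMSEQ_le)
      show "(\<lambda>n. cmod (f (x n) - (\<Sum>s\<in>I. c s * exp (\<i> * of_real s * x n)))) \<longlonglongrightarrow> cmod (f w - (\<Sum>s\<in>I. c s * exp (\<i> * of_real s * w)))"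
        by (intro tendsto_intros fx x)
      show "(\<lambda>n. \<eta> * exp (\<epsilon> * \<bar>Re (x n)\<bar>)) \<longlonglongrightarrow> \<eta> * exp (\<epsilon> * \<bar>Re w\<bar>)" by (intro tendsto_intros x)
    qed (use I(2) x(1) in blast)
  qed
  then show "\<exists>I c. finite (I :: real set) \<and> (\<forall>w\<in>\<Omega>. cmod (f w - (\<Sum>s\<in>I. c s * exp (\<i> * of_real s * w))) \<le> \<eta> * exp (\<epsilon> * \<bar>Re w\<bar>))"
    by (intro exI[of _ I] exI[of _ c] conjI ballI I(1))
qed

text \<open>Riemann sums in \<open>t\<close> are finite combinations of approximable functions, and
  weighted equicontinuity makes their error uniform over \<open>\<Omega>\<close>.\<close>

lemma exp_approximable_integral:
  fixes K :: "real \<Rightarrow> complex \<Rightarrow> complex"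
  assumes ab: "0 \<le> S" and K: "\<And>t. 0 \<le> t \<Longrightarrow> t \<le> S \<Longrightarrow> exp_approximable \<Omega> \<epsilon> (K t)"
    and equi: "\<And>\<eta>. 0 < \<eta> \<Longrightarrow> \<exists>\<delta>>0. \<forall>t\<in>{0..S}. \<forall>t'\<in>{0..S}. \<bar>t - t'\<bar> < \<delta> \<longrightarrow>
        (\<forall>w\<in>\<Omega>. cmod (K t w - K t' w) \<le> \<eta> * exp (\<epsilon> * \<bar>Re w\<bar>))"
    and cont: "\<And>w. w \<in> \<Omega> \<Longrightarrow> continuous_on {0..S} (\<lambda>t. K t w)"
  shows "exp_approximable \<Omega> \<epsilon> (\<lambda>w. integral {0..S} (\<lambda>t. K t w))"
proof (rule exp_approximable_limit)
  fix \<eta> :: real assume \<eta>: "0 < \<eta>"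
  \<comment> \<open>\<open>S + 1\<close> rather than \<open>S\<close>, since \<open>S\<close> may be
    0.\<close>
  define \<eta>' where "\<eta>' = \<eta> / (S + 1)"
  have \<eta>': "0 < \<eta>'" "S * \<eta>' \<le> \<eta>" using \<eta> ab by (auto simp: \<eta>'_def field_simps)
  obtain \<delta> where \<delta>: "0 < \<delta>" "\<And>t t' w. t \<in> {0..S} \<Longrightarrow> t' \<in> {0..S} \<Longrightarrow> \<bar>t - t'\<bar> < \<delta> \<Longrightarrow> w \<in> \<Omega> \<Longrightarrow>
      cmod (K t w - K t' w) \<le> \<eta>' * exp (\<epsilon> * \<bar>Re w\<bar>)"
    using equi[OF \<eta>'(1)] by blast
  obtain n :: nat where n: "S / \<delta> < real n" using reals_Archimedean2 by blast
  have "0 \<le> S / \<delta>" using ab \<delta> by simp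
  then have n0: "0 < real n" using n by linarith
  define q where "q = S / real n"
  have q: "0 \<le> q" "q < \<delta>" "real n * q = S" using n n0 \<delta> ab by (auto simp: q_def field_simps)
  define g where "g w = (\<Sum>i<n. of_real q * K (real i * q) w)" for w
  have iq: "real i * q \<le> S" if "i \<le> n" for i
    using mult_right_mono[of "real i" "real n" q] that q by simp
  have "exp_approximable \<Omega> \<epsilon> g"
    unfolding g_def using iq q by (intro exp_approximable_sum exp_approximable_scale K) auto
  moreover have "cmod (integral {0..S} (\<lambda>t. K t w) - g w) \<le> \<eta> * exp (\<epsilon> * \<bar>Re w\<bar>)" if w: "w \<in> \<Omega>" for w
  proof -
    have int: "(\<lambda>t. K t w) integrable_on {a..b}" if "0 \<le> a" "b \<le> S" for a b
      by (rule integrable_continuous_real[OF continuous_on_subset[OF cont[OF w]]]) (use that in auto)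
    \<comment> \<open>The error after \<open>i\<close> of the \<open>n\<close> cells, by induction;
      each cell adds at most its length times the oscillation bound.\<close>
    have "cmod (integral {0..real i * q} (\<lambda>t. K t w) - (\<Sum>i<i. of_real q * K (real i * q) w)) \<le> real i * q * (\<eta>' * exp (\<epsilon> * \<bar>Re w\<bar>))"
      if "i \<le> n" for i
      using that
    proof (induction i)
      case (Suc i)
      define a where "a = real i * q"
      have a: "0 \<le> a" "a \<le> a + q" "a + q \<le> S" using q iq[of "Suc i"] Suc.prems by (auto simp: a_def algebra_simps)
      have 1: "integral {0..a + q} (\<lambda>t. K t w) = integral {0..a} (\<lambda>t. K t w) + integral {a..a + q} (\<lambda>t. K t w)"
        by (rule Henstock_Kurzweil_Integration.integral_combine[symmetric]) (use a int in auto)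
      have "((\<lambda>t. K t w - K a w) has_integral integral {a..a + q} (\<lambda>t. K t w) - q *\<^sub>R K a w) (cbox a (a + q))"
        using has_integral_diff[OF integrable_integral[OF int[OF a(1,3)]] has_integral_const_real[of "K a w" a "a + q"]] a by simp
      then have 2: "cmod (integral {a..a + q} (\<lambda>t. K t w) - q *\<^sub>R K a w) \<le> (\<eta>' * exp (\<epsilon> * \<bar>Re w\<bar>)) * measure lborel (cbox a (a + q))"
        by (rule has_integral_bound[rotated]) (use \<delta>(2)[of _ a w] a q w \<eta>' in auto)
      have "integral {0..real (Suc i) * q} (\<lambda>t. K t w) - (\<Sum>i<Suc i. of_real q * K (real i * q) w)
        = (integral {0..a} (\<lambda>t. K t w) - (\<Sum>i<i. of_real q * K (real i * q) w)) + (integral {a..a + q} (\<lambda>t. K t w) - q *\<^sub>R K a w)"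
        using 1 by (simp add: a_def algebra_simps scaleR_conv_of_real)
      also have "cmod \<dots> \<le> real i * q * (\<eta>' * exp (\<epsilon> * \<bar>Re w\<bar>)) + (\<eta>' * exp (\<epsilon> * \<bar>Re w\<bar>)) * q"
        using Suc 2 a by (intro norm_triangle_mono) (auto simp: a_def)
      finally show ?case by (simp add: algebra_simps)
    qed simp
    from this[of n] have "cmod (integral {0..S} (\<lambda>t. K t w) - g w) \<le> S * \<eta>' * exp (\<epsilon> * \<bar>Re w\<bar>)"
      using q by (simp add: g_def)
    also have "\<dots> \<le> \<eta> * exp (\<epsilon> * \<bar>Re w\<bar>)" using \<eta>' by (intro mult_right_mono) auto
    finally show ?thesis .
  qed
  ultimately show "\<exists>g. exp_approximable \<Omega> \<epsilon> g \<and> (\<forall>w\<in>\<Omega>. cmod (integral {0..S} (\<lambda>t. K t w) - g w) \<le> \<eta> * exp (\<epsilon> * \<bar>Re w\<bar>))"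
    by blast
qed

text \<open>The function \<open>exp (\<i> * z)\<close> has derivative of modulus at most 1 on the
  closed upper half plane, which is convex.\<close>

lemma cmod_exp_diff_le:
  assumes A: "0 \<le> Im A" and s: "0 \<le> s" "0 \<le> t"
  shows "cmod (exp (\<i> * of_real s * A) - exp (\<i> * of_real t * A)) \<le> \<bar>s - t\<bar> * cmod A"
proof -
  have "norm (exp (\<i> * (of_real s * A)) - exp (\<i> * (of_real t * A))) \<le> 1 * norm (of_real s * A - of_real t * A)"
  proof (rule field_differentiable_bound[where S = "{z. 0 \<le> Im z}" and f' = "\<lambda>z. exp (\<i> * z) * \<i>"])
    show "convex {z. 0 \<le> Im z}" by (rule convex_halfspace_Im_ge)
    show "((\<lambda>z. exp (\<i> * z)) has_field_derivative exp (\<i> * z) * \<i>) (at z within {z. 0 \<le> Im z})" for z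
      by (auto intro!: derivative_eq_intros)
    show "norm (exp (\<i> * z) * \<i>) \<le> 1" if "z \<in> {z. 0 \<le> Im z}" for z
      using that by (simp add: norm_mult)
  qed (use A s in auto)
  also have "of_real s * A - of_real t * A = of_real (s - t) * A" by (simp add: algebra_simps)
  finally show ?thesis unfolding norm_mult norm_of_real by (simp add: mult.assoc)
qed

lemma integral_exp_imaginary:
  assumes "A \<noteq> 0" "0 \<le> S"
  shows "integral {0..S} (\<lambda>t. exp (\<i> * of_real t * A)) = (exp (\<i> * of_real S * A) - 1) / (\<i> * A)"
proof -
  have "((\<lambda>t. exp (\<i> * of_real t * A)) has_integral exp (\<i> * of_real S * A) / (\<i> * A) - exp (\<i> * of_real 0 * A) / (\<i> * A)) {0..S}"
  proof (rule fundamental_theorem_of_calculus[OF assms(2)])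
    fix t
    have "((\<lambda>z. exp (\<i> * z * A) / (\<i> * A)) has_field_derivative exp (\<i> * of_real t * A)) (at (of_real t))"
      using assms(1) by (auto intro!: derivative_eq_intros)
    then show "((\<lambda>t. exp (\<i> * of_real t * A) / (\<i> * A)) has_vector_derivative exp (\<i> * of_real t * A)) (at t within {0..S})"
      using has_vector_derivative_real_field has_vector_derivative_at_within by blast
  qed
  from integral_unique[OF this] show ?thesis by (simp add: diff_divide_distrib)
qed

text \<open>\<open>1 / (\<zeta> - w)\<close> is a Laplace-type integral of the exponentials \<open>exp (\<plusminus> \<i> t (\<zeta> - w))\<close> when \<open>\<zeta>\<close> lies above
  (sign \<open>\<sigma> = 1\<close>) or below (sign \<open>\<sigma> = -1\<close>) the set.\<close>

lemma exp_approximable_outer_kernel: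
  assumes \<sigma>: "\<sigma> = 1 \<or> \<sigma> = (-1::real)" and d: "0 < d" "\<And>w. w \<in> \<Omega> \<Longrightarrow> d \<le> \<sigma> * Im (\<zeta> - w)"
    and b: "\<And>w. w \<in> \<Omega> \<Longrightarrow> \<bar>Im w\<bar> \<le> b" and \<epsilon>: "0 < \<epsilon>"
  shows "exp_approximable \<Omega> \<epsilon> (\<lambda>w. 1 / (\<zeta> - w))"
proof (rule exp_approximable_limit)
  fix \<eta> :: real assume \<eta>: "0 < \<eta>"
  \<comment> \<open>The sign brings \<open>\<zeta> - w\<close> into the upper half plane, at height
    at least \<open>d\<close>.\<close>
  define A where "A w = of_real \<sigma> * (\<zeta> - w)" for w
  have ImA: "d \<le> Im (A w)" if "w \<in> \<Omega>" for w using d(2)[OF that] by (simp add: A_def)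
  have A0: "A w \<noteq> 0" if "w \<in> \<Omega>" for w using ImA[OF that] d(1) by auto
  \<comment> \<open>Truncation point of the integral: the tail \<open>exp (- S d) / d\<close> is at
    most \<open>\<eta>\<close> because \<open>S d \<le> exp (S d)\<close>.\<close>
  define S where "S = 1 / (\<eta> * d\<^sup>2)"
  have S: "0 < S" using \<eta> d by (simp add: S_def)
  \<comment> \<open>The Lipschitz bound in \<open>t\<close> is \<open>\<bar>A w\<bar>\<close>, which
    grows linearly with \<open>\<bar>Re w\<bar>\<close>; the weight absorbs this through
    \<open>\<epsilon> x \<le> exp (\<epsilon> x)\<close>.\<close>
  define C where "C = cmod \<zeta> + \<bar>b\<bar> + 1 / \<epsilon>"
  have C: "0 < C" using \<epsilon> by (simp add: C_def add_nonneg_pos)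
  have AC: "cmod (A w) \<le> C * exp (\<epsilon> * \<bar>Re w\<bar>)" if "w \<in> \<Omega>" for w
  proof -
    have "cmod (A w) = cmod (\<zeta> - w)" using \<sigma> by (auto simp: A_def norm_mult norm_minus_commute)
    also have "\<dots> \<le> cmod \<zeta> + (\<bar>Re w\<bar> + \<bar>b\<bar>)"
      using norm_triangle_ineq4[of \<zeta> w] cmod_le[of w] b[OF that] by linarith
    also have "\<dots> \<le> (cmod \<zeta> + \<bar>b\<bar>) * exp (\<epsilon> * \<bar>Re w\<bar>) + 1 / \<epsilon> * exp (\<epsilon> * \<bar>Re w\<bar>)"
    proof -
      have "\<epsilon> * \<bar>Re w\<bar> \<le> exp (\<epsilon> * \<bar>Re w\<bar>)" using exp_ge_add_one_self[of "\<epsilon> * \<bar>Re w\<bar>"] by linarith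
      then have "\<bar>Re w\<bar> \<le> 1 / \<epsilon> * exp (\<epsilon> * \<bar>Re w\<bar>)" using \<epsilon> by (simp add: field_simps)
      moreover have "(cmod \<zeta> + \<bar>b\<bar>) * 1 \<le> (cmod \<zeta> + \<bar>b\<bar>) * exp (\<epsilon> * \<bar>Re w\<bar>)" using \<epsilon> by (intro mult_left_mono) auto
      moreover have "cmod \<zeta> + (\<bar>Re w\<bar> + \<bar>b\<bar>) = (cmod \<zeta> + \<bar>b\<bar>) * 1 + \<bar>Re w\<bar>" by simp
      ultimately show ?thesis by (simp only: add_mono)
    qed
    finally show ?thesis by (simp add: C_def distrib_right)
  qed
  define g where "g w = of_real \<sigma> * (- \<i>) * integral {0..S} (\<lambda>t. exp (\<i> * of_real t * A w))" for w
  have "exp_approximable \<Omega> \<epsilon> (\<lambda>w. integral {0..S} (\<lambda>t. exp (\<i> * of_real t * A w)))"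
  proof (rule exp_approximable_integral)
    fix t :: real
    have "exp (\<i> * of_real t * A w) = exp (\<i> * of_real (t * \<sigma>) * \<zeta>) * exp (\<i> * of_real (- (t * \<sigma>)) * w)" for w
      by (simp add: A_def exp_add[symmetric] algebra_simps)
    then show "exp_approximable \<Omega> \<epsilon> (\<lambda>w. exp (\<i> * of_real t * A w))"
      by (simp only:) (intro exp_approximable_scale exp_approximable_exp)
  next
    fix \<eta>' :: real assume \<eta>': "0 < \<eta>'"
    have "cmod (exp (\<i> * of_real t * A w) - exp (\<i> * of_real t' * A w)) \<le> \<eta>' * exp (\<epsilon> * \<bar>Re w\<bar>)"
      if "t \<in> {0..S}" "t' \<in> {0..S}" "\<bar>t - t'\<bar> < \<eta>' / C" "w \<in> \<Omega>" for t t' w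
    proof -
      have "cmod (exp (\<i> * of_real t * A w) - exp (\<i> * of_real t' * A w)) \<le> \<bar>t - t'\<bar> * cmod (A w)"
        using that ImA[of w] d by (intro cmod_exp_diff_le) auto
      also have "\<dots> \<le> (\<eta>' / C) * (C * exp (\<epsilon> * \<bar>Re w\<bar>))" using that AC[of w] by (intro mult_mono) auto
      finally show ?thesis using C by simp
    qed
    then show "\<exists>\<delta>>0. \<forall>t\<in>{0..S}. \<forall>t'\<in>{0..S}. \<bar>t - t'\<bar> < \<delta> \<longrightarrow>
        (\<forall>w\<in>\<Omega>. cmod (exp (\<i> * of_real t * A w) - exp (\<i> * of_real t' * A w)) \<le> \<eta>' * exp (\<epsilon> * \<bar>Re w\<bar>))"
      using \<eta>' C by (intro exI[of _ "\<eta>' / C"]) auto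
  qed (use S in \<open>auto intro!: continuous_intros\<close>)
  then have "exp_approximable \<Omega> \<epsilon> g" unfolding g_def by (rule exp_approximable_scale)
  moreover have "cmod (1 / (\<zeta> - w) - g w) \<le> \<eta> * exp (\<epsilon> * \<bar>Re w\<bar>)" if w: "w \<in> \<Omega>" for w
  proof -
    have "g w = of_real \<sigma> * (1 - exp (\<i> * of_real S * A w)) / A w"
      unfolding g_def integral_exp_imaginary[OF A0[OF w] less_imp_le[OF S]] using A0[OF w]
      by (simp add: field_simps)
    moreover have "1 / (\<zeta> - w) = of_real \<sigma> / A w" using \<sigma> by (auto simp: A_def)
    ultimately have "1 / (\<zeta> - w) - g w = of_real \<sigma> * exp (\<i> * of_real S * A w) / A w"
      by (simp add: diff_divide_distrib[symmetric] algebra_simps)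
    then have "cmod (1 / (\<zeta> - w) - g w) = exp (- (S * Im (A w))) / cmod (A w)"
      using \<sigma> by (auto simp: norm_mult norm_divide)
    also have "\<dots> \<le> exp (- (S * d)) / d"
      using ImA[OF w] d(1) S abs_Im_le_cmod[of "A w"] by (intro frac_le) auto
    also have "\<dots> \<le> \<eta>"
    proof -
      have "S * d \<le> exp (S * d)" using exp_ge_add_one_self[of "S * d"] by linarith
      moreover have "S * d * (\<eta> * d) = 1" using \<eta> d by (simp add: S_def power2_eq_square)
      ultimately have "1 \<le> exp (S * d) * (\<eta> * d)" using \<eta> d by (metis mult_right_mono mult_nonneg_nonneg less_imp_le)
      then show ?thesis using d by (simp add: exp_minus field_simps)
    qed
    also have "\<eta> \<le> \<eta> * exp (\<epsilon> * \<bar>Re w\<bar>)" using \<eta> \<epsilon> by simp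
    finally show ?thesis .
  qed
  ultimately show "\<exists>g. exp_approximable \<Omega> \<epsilon> g \<and> (\<forall>w\<in>\<Omega>. cmod (1 / (\<zeta> - w) - g w) \<le> \<eta> * exp (\<epsilon> * \<bar>Re w\<bar>))" by blast
qed

section \<open>Moving the poles of Cauchy kernels\<close>

lemma le_exp_weight:
  fixes x r \<eta> \<epsilon> :: real
  shows "0 \<le> \<eta> \<Longrightarrow> 0 \<le> \<epsilon> \<Longrightarrow> x \<le> \<eta> \<Longrightarrow> x \<le> \<eta> * exp (\<epsilon> * \<bar>r\<bar>)"
  using mult_left_mono[of 1 "exp (\<epsilon> * \<bar>r\<bar>)" \<eta>] by simp

text \<open>Partial fractions reduce \<open>1 / ((\<zeta> - w)^k (\<zeta> + t - w))\<close> to kernels with fewer poles, and \<open>t \<rightarrow> 0\<close>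
  then gives the next power of the kernel.\<close>

lemma exp_approximable_kernel_power:
  assumes \<epsilon>: "0 < \<epsilon>" and r: "0 < r" "\<And>w. w \<in> \<Omega> \<Longrightarrow> 2 * r \<le> cmod (\<zeta> - w)"
    and near: "\<And>\<zeta>'. cmod (\<zeta>' - \<zeta>) < r \<Longrightarrow> exp_approximable \<Omega> \<epsilon> (\<lambda>w. 1 / (\<zeta>' - w))"
  shows "exp_approximable \<Omega> \<epsilon> (\<lambda>w. 1 / (\<zeta> - w) ^ Suc k)"
proof -
  define A where "A w = \<zeta> - w" for w
  have A: "2 * r \<le> cmod (A w)" if "w \<in> \<Omega>" for w using r(2)[OF that] by (simp add: A_def)
  have A0: "A w \<noteq> 0" if "w \<in> \<Omega>" for w using A[OF that] r(1) by auto
  have At: "r \<le> cmod (A w + of_real t)" if "w \<in> \<Omega>" "0 < t" "t < r" for w t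
    using norm_triangle_ineq2[of "A w" "- of_real t"] A[OF that(1)] that by simp
  have At0: "A w + of_real t \<noteq> 0" if "w \<in> \<Omega>" "0 < t" "t < r" for w t
    using At[OF that] r(1) by auto
  have "exp_approximable \<Omega> \<epsilon> (\<lambda>w. 1 / A w ^ Suc k) \<and>
    (\<forall>t. 0 < t \<and> t < r \<longrightarrow> exp_approximable \<Omega> \<epsilon> (\<lambda>w. 1 / (A w ^ k * (A w + of_real t))))"
  proof (induction k)
    case 0
    have "exp_approximable \<Omega> \<epsilon> (\<lambda>w. 1 / A w)" using near[of \<zeta>] r by (simp add: A_def)
    moreover have "exp_approximable \<Omega> \<epsilon> (\<lambda>w. 1 / (A w + of_real t))" if "0 < t" "t < r" for t
      using near[of "\<zeta> + of_real t"] that by (simp add: A_def algebra_simps)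
    ultimately show ?case by simp
  next
    case (Suc k)
    have step: "exp_approximable \<Omega> \<epsilon> (\<lambda>w. 1 / (A w ^ Suc k * (A w + of_real t)))" if t: "0 < t" "t < r" for t
    proof (rule exp_approximable_cong)
      show "exp_approximable \<Omega> \<epsilon> (\<lambda>w. of_real (1 / t) * (1 / A w ^ Suc k - 1 / (A w ^ k * (A w + of_real t))))"
        using Suc t by (intro exp_approximable_scale exp_approximable_diff) auto
      fix w assume w: "w \<in> \<Omega>"
      have "1 / A w ^ Suc k - 1 / (A w ^ k * (A w + of_real t)) = of_real t / (A w ^ Suc k * (A w + of_real t))"
        using A0[OF w] At0[OF w t] by (simp add: divide_simps)
      then show "of_real (1 / t) * (1 / A w ^ Suc k - 1 / (A w ^ k * (A w + of_real t))) = 1 / (A w ^ Suc k * (A w + of_real t))"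
        using t by simp
    qed
    have "exp_approximable \<Omega> \<epsilon> (\<lambda>w. 1 / A w ^ Suc (Suc k))"
    proof (rule exp_approximable_limit)
      fix \<eta> :: real assume \<eta>: "0 < \<eta>"
      define C where "C = 1 / ((2 * r) ^ Suc (Suc k) * r)"
      have C: "0 < C" using r by (simp add: C_def)
      \<comment> \<open>\<open>r / 2\<close> keeps the shifted pole in the admissible disc,
        \<open>\<eta> / C\<close> makes the remainder small.\<close>
      define t where "t = min (r / 2) (\<eta> / C)"
      have t: "0 < t" "t < r" "t * C \<le> \<eta>" using r \<eta> C by (auto simp: t_def min_def field_simps)
      have "cmod (1 / A w ^ Suc (Suc k) - 1 / (A w ^ Suc k * (A w + of_real t))) \<le> \<eta> * exp (\<epsilon> * \<bar>Re w\<bar>)" if w: "w \<in> \<Omega>" for w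
      proof -
        have "1 / A w ^ Suc (Suc k) - 1 / (A w ^ Suc k * (A w + of_real t)) = of_real t / (A w ^ Suc (Suc k) * (A w + of_real t))"
          using A0[OF w] At0[OF w t(1,2)] by (simp add: divide_simps)
        then have "cmod (1 / A w ^ Suc (Suc k) - 1 / (A w ^ Suc k * (A w + of_real t))) = t / (cmod (A w) ^ Suc (Suc k) * cmod (A w + of_real t))"
          using t by (simp add: norm_divide norm_mult norm_power)
        also have "\<dots> \<le> t / ((2 * r) ^ Suc (Suc k) * r)"
          using A[OF w] At[OF w t(1,2)] t r by (intro divide_left_mono mult_mono power_mono mult_pos_pos zero_less_power) auto
        also have "\<dots> \<le> \<eta>" using t(3) by (simp add: C_def)
        finally show ?thesis using \<eta> \<epsilon> by (intro le_exp_weight) auto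
      qed
      then show "\<exists>g. exp_approximable \<Omega> \<epsilon> g \<and> (\<forall>w\<in>\<Omega>. cmod (1 / A w ^ Suc (Suc k) - g w) \<le> \<eta> * exp (\<epsilon> * \<bar>Re w\<bar>))"
        using step[OF t(1,2)] by blast
    qed
    then show ?case using step by blast
  qed
  then show ?thesis by (simp add: A_def)
qed

text \<open>The kernel is expanded in a geometric series about \<open>\<zeta>\<close>; the ratio is
  at most 1/2 because the pole moves by at most \<open>r\<close> while \<open>\<Omega>\<close> is at
  distance at least \<open>2 * r\<close>.\<close>

lemma exp_approximable_kernel_near:
  assumes \<epsilon>: "0 < \<epsilon>" and r: "0 < r" "\<And>w. w \<in> \<Omega> \<Longrightarrow> 2 * r \<le> cmod (\<zeta> - w)"
    and near: "\<And>k. exp_approximable \<Omega> \<epsilon> (\<lambda>w. 1 / (\<zeta> - w) ^ Suc k)" and \<zeta>': "cmod (\<zeta>' - \<zeta>) \<le> r"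
  shows "exp_approximable \<Omega> \<epsilon> (\<lambda>w. 1 / (\<zeta>' - w))"
proof (rule exp_approximable_limit)
  fix \<eta> :: real assume \<eta>: "0 < \<eta>"
  obtain n where n: "(1/2) ^ n < \<eta> * r" using real_arch_pow_inv[of "\<eta> * r" "1/2"] \<eta> r by auto
  define g where "g w = (\<Sum>k<n. (\<zeta> - \<zeta>') ^ k * (1 / (\<zeta> - w) ^ Suc k))" for w
  have "exp_approximable \<Omega> \<epsilon> g"
    unfolding g_def by (intro exp_approximable_sum exp_approximable_scale near)
  moreover have "cmod (1 / (\<zeta>' - w) - g w) \<le> \<eta> * exp (\<epsilon> * \<bar>Re w\<bar>)" if w: "w \<in> \<Omega>" for w
  proof -
    define q where "q = (\<zeta> - \<zeta>') / (\<zeta> - w)"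
    have A: "2 * r \<le> cmod (\<zeta> - w)" "\<zeta> - w \<noteq> 0" using r w by force+
    have A': "r \<le> cmod (\<zeta>' - w)" "\<zeta>' - w \<noteq> 0"
    proof -
      show "r \<le> cmod (\<zeta>' - w)"
        using norm_triangle_ineq2[of "\<zeta> - w" "\<zeta> - \<zeta>'"] A(1) \<zeta>' by (simp add: norm_minus_commute)
      then show "\<zeta>' - w \<noteq> 0" using r(1) by auto
    qed
    have "cmod q \<le> r / (2 * r)" unfolding q_def norm_divide using A r \<zeta>' by (intro frac_le) (auto simp: norm_minus_commute)
    then have q: "cmod q \<le> 1/2" using r by simp
    have q1: "1 - q = (\<zeta>' - w) / (\<zeta> - w)" using A by (simp add: q_def field_simps)
    have "(\<Sum>k<n. q ^ k) * (1 - q) = 1 - q ^ n" by (metis mult.commute one_diff_power_eq)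
    then have "(\<Sum>k<n. q ^ k) * (\<zeta>' - w) = (1 - q ^ n) * (\<zeta> - w)" using A q1 by (simp add: field_simps)
    moreover have "g w = (\<Sum>k<n. q ^ k) / (\<zeta> - w)"
      unfolding g_def q_def by (simp add: sum_divide_distrib power_divide field_simps)
    ultimately have "g w * (\<zeta>' - w) = 1 - q ^ n" using A(2) by simp
    then have "g w = (1 - q ^ n) / (\<zeta>' - w)" using A'(2) by (simp only: eq_divide_eq) simp
    then have "1 / (\<zeta>' - w) - g w = q ^ n / (\<zeta>' - w)" by (simp add: diff_divide_distrib)
    then have "cmod (1 / (\<zeta>' - w) - g w) = cmod q ^ n / cmod (\<zeta>' - w)" by (simp add: norm_divide norm_power)
    also have "\<dots> \<le> (1/2) ^ n / r" using q A' r by (intro frac_le power_mono) auto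
    also have "\<dots> \<le> \<eta>" using n r by (simp add: field_simps)
    finally show ?thesis using \<eta> \<epsilon> by (intro le_exp_weight) auto
  qed
  ultimately show "\<exists>g. exp_approximable \<Omega> \<epsilon> g \<and> (\<forall>w\<in>\<Omega>. cmod (1 / (\<zeta>' - w) - g w) \<le> \<eta> * exp (\<epsilon> * \<bar>Re w\<bar>))"
    by blast
qed

text \<open>Runge's pole pushing. The set \<open>G\<close> of good poles asks for approximability on
  a whole disc of poles, which makes it open; the expansion lemmas show that it is also relatively
  closed off \<open>closure \<Omega>\<close>, so it contains every component that it meets.\<close>

lemma exp_approximable_kernel_component:
  assumes \<epsilon>: "0 < \<epsilon>" and C: "C \<in> components (- closure \<Omega>)"
    and z0: "\<zeta>0 \<in> C" "0 < r0" "\<And>\<zeta>. cmod (\<zeta> - \<zeta>0) < r0 \<Longrightarrow> exp_approximable \<Omega> \<epsilon> (\<lambda>w. 1 / (\<zeta> - w))"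
    and \<zeta>: "\<zeta> \<in> C"
  shows "exp_approximable \<Omega> \<epsilon> (\<lambda>w. 1 / (\<zeta> - w))"
proof -
  define G where "G = {\<zeta>. \<exists>r>0. \<forall>\<zeta>'. cmod (\<zeta>' - \<zeta>) < r \<longrightarrow> exp_approximable \<Omega> \<epsilon> (\<lambda>w. 1 / (\<zeta>' - w))}"
  have opn: "open G" unfolding open_dist
  proof
    fix x assume "x \<in> G"
    then obtain r where r: "0 < r" "\<And>\<zeta>'. cmod (\<zeta>' - x) < r \<Longrightarrow> exp_approximable \<Omega> \<epsilon> (\<lambda>w. 1 / (\<zeta>' - w))"
      unfolding G_def by blast
    have "y \<in> G" if y: "dist y x < r" for y
    proof -
      have "exp_approximable \<Omega> \<epsilon> (\<lambda>w. 1 / (\<zeta>' - w))" if "cmod (\<zeta>' - y) < r - dist y x" for \<zeta>'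
        using r(2)[of \<zeta>'] that norm_triangle_ineq[of "\<zeta>' - y" "y - x"] by (simp add: dist_norm)
      then show ?thesis using y unfolding G_def by (intro CollectI exI[of _ "r - dist y x"]) auto
    qed
    then show "\<exists>e>0. \<forall>y. dist y x < e \<longrightarrow> y \<in> G" using r(1) by blast
  qed
  have away: "\<exists>e>0. \<forall>w\<in>\<Omega>. e \<le> cmod (x - w)" if x: "x \<in> - closure \<Omega>" for x
  proof -
    obtain e where "0 < e" "\<forall>w\<in>\<Omega>. \<not> dist w x < e" using x by (auto simp: closure_approachable)
    then show ?thesis by (intro exI[of _ e]) (auto simp: dist_norm norm_minus_commute not_less)
  qed
  have opn': "open (- closure \<Omega> - G)" unfolding open_dist
  proof
    fix x assume x: "x \<in> - closure \<Omega> - G"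
    then obtain e where e: "0 < e" "\<And>w. w \<in> \<Omega> \<Longrightarrow> e \<le> cmod (x - w)" using away by blast
    \<comment> \<open>If \<open>y\<close> within \<open>e / 8\<close> of \<open>x\<close> were good,
      an expansion about \<open>y\<close> of radius \<open>e / 4\<close> would cover the disc of
      radius \<open>e / 8\<close> about \<open>x\<close> and make \<open>x\<close> good.\<close>
    have "y \<in> - closure \<Omega> - G" if y: "dist y x < e / 8" for y
    proof -
      have yw: "7 * e / 8 \<le> cmod (y - w)" if "w \<in> \<Omega>" for w
        using e(2)[OF that] norm_triangle_ineq[of "x - y" "y - w"] y by (simp add: dist_norm norm_minus_commute)
      have "y \<notin> closure \<Omega>"
      proof
        assume "y \<in> closure \<Omega>"
        then obtain w where "w \<in> \<Omega>" "dist w y < 7 * e / 8" using e(1) unfolding closure_approachable by (metis mult_pos_pos divide_pos_pos zero_less_numeral)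
        then show False using yw[of w] by (simp add: dist_norm norm_minus_commute)
      qed
      moreover have "y \<notin> G"
      proof
        assume "y \<in> G"
        then obtain r where r: "0 < r" "\<And>\<zeta>'. cmod (\<zeta>' - y) < r \<Longrightarrow> exp_approximable \<Omega> \<epsilon> (\<lambda>w. 1 / (\<zeta>' - w))"
          unfolding G_def by blast
        have pow: "exp_approximable \<Omega> \<epsilon> (\<lambda>w. 1 / (y - w) ^ Suc k)" for k
        proof (rule exp_approximable_kernel_power[OF \<epsilon>])
          show "0 < min r (e / 4)" using r e by simp
          show "2 * min r (e / 4) \<le> cmod (y - w)" if "w \<in> \<Omega>" for w using yw[OF that] e(1) by simp
        qed (use r in auto)
        have "exp_approximable \<Omega> \<epsilon> (\<lambda>w. 1 / (\<zeta>' - w))" if "cmod (\<zeta>' - x) < e / 8" for \<zeta>'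
        proof (rule exp_approximable_kernel_near[OF \<epsilon> _ _ pow])
          show "0 < e / 4" using e by simp
          show "2 * (e / 4) \<le> cmod (y - w)" if "w \<in> \<Omega>" for w using yw[OF that] e(1) by simp
          show "cmod (\<zeta>' - y) \<le> e / 4"
            using norm_triangle_ineq[of "\<zeta>' - x" "x - y"] that y by (simp add: dist_norm norm_minus_commute)
        qed
        then have "x \<in> G" using e(1) unfolding G_def by (intro CollectI exI[of _ "e / 8"]) auto
        then show False using x by blast
      qed
      ultimately show ?thesis by blast
    qed
    then show "\<exists>d>0. \<forall>y. dist y x < d \<longrightarrow> y \<in> - closure \<Omega> - G" using e(1) by (intro exI[of _ "e / 8"]) auto
  qed
  have "\<zeta>0 \<in> G" using z0 unfolding G_def by blast
  have "C \<subseteq> G \<union> (- closure \<Omega> - G)" using in_components_subset[OF C] by blast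
  then have "G \<inter> C = {} \<or> (- closure \<Omega> - G) \<inter> C = {}"
    using connectedD[OF in_components_connected[OF C] opn opn'] by blast
  then have "\<zeta> \<in> G" using \<open>\<zeta>0 \<in> G\<close> z0(1) \<zeta> in_components_subset[OF C] by blast
  then obtain r where r: "0 < r" "\<forall>\<zeta>'. cmod (\<zeta>' - \<zeta>) < r \<longrightarrow> exp_approximable \<Omega> \<epsilon> (\<lambda>w. 1 / (\<zeta>' - w))"
    unfolding G_def by blast
  have "cmod (\<zeta> - \<zeta>) < r" using r(1) by simp
  then show ?thesis by (rule r(2)[rule_format])
qed

text \<open>Regroups a sum over squares as a sum over edges: an edge carries the difference of the
  values of \<open>c\<close> on its two sides. The zeros of \<open>c\<close> at both ends leave no
  boundary terms.\<close>

lemma sum_by_parts_int: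
  fixes c g :: "int \<Rightarrow> complex"
  assumes "a \<le> b" "c b = 0" "c (a - 1) = 0"
  shows "(\<Sum>l\<in>{a..<b}. c l * (g l - g (l + 1))) = (\<Sum>l\<in>{a..b}. (c l - c (l - 1)) * g l)"
proof -
  have "(\<Sum>l\<in>{a..<b}. c l * g (l + 1)) = (\<Sum>l\<in>{a + 1..b}. c (l - 1) * g l)"
    by (rule sum.reindex_bij_witness[of _ "\<lambda>l. l - 1" "\<lambda>l. l + 1"]) auto
  also have "\<dots> = (\<Sum>l\<in>{a..b}. c (l - 1) * g l)"
  proof (rule sum.mono_neutral_left)
    show "\<forall>i\<in>{a..b} - {a + 1..b}. c (i - 1) * g i = 0"
    proof
      fix i assume "i \<in> {a..b} - {a + 1..b}"
      then have "i = a" by auto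
      then show "c (i - 1) * g i = 0" using assms(3) by simp
    qed
  qed auto
  finally have 1: "(\<Sum>l\<in>{a..<b}. c l * g (l + 1)) = (\<Sum>l\<in>{a..b}. c (l - 1) * g l)" .
  have 2: "(\<Sum>l\<in>{a..<b}. c l * g l) = (\<Sum>l\<in>{a..b}. c l * g l)"
    using assms by (intro sum.mono_neutral_left) (auto simp: order.order_iff_strict)
  show ?thesis using 1 2 by (simp add: right_diff_distrib left_diff_distrib sum_subtractf)
qed

text \<open>Opposite edges are paired with a common orientation, the form in which summation by
  parts applies to neighbouring squares.\<close>

lemma contour_integral_rectangle:
  fixes F :: "complex \<Rightarrow> complex"
  assumes "continuous_on (path_image (rectpath (Complex x0 y0) (Complex x1 y1))) F" "x0 \<le> x1" "y0 \<le> y1"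
  shows "contour_integral (rectpath (Complex x0 y0) (Complex x1 y1)) F =
    (contour_integral (linepath (Complex x0 y0) (Complex x1 y0)) F - contour_integral (linepath (Complex x0 y1) (Complex x1 y1)) F)
    + (contour_integral (linepath (Complex x1 y0) (Complex x1 y1)) F - contour_integral (linepath (Complex x0 y0) (Complex x0 y1)) F)"
proof -
  let ?a = "Complex x0 y0" and ?b = "Complex x1 y0" and ?c = "Complex x1 y1" and ?d = "Complex x0 y1"
  have path: "rectpath ?a ?c = linepath ?a ?b +++ linepath ?b ?c +++ linepath ?c ?d +++ linepath ?d ?a"
    by (simp add: rectpath_def Let_def)
  have cont: "continuous_on (closed_segment ?a ?b) F" "continuous_on (closed_segment ?b ?c) F"
    "continuous_on (closed_segment ?c ?d) F" "continuous_on (closed_segment ?d ?a) F"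
    using assms(1) unfolding path by (auto simp: path_image_join elim!: continuous_on_subset)
  note int = contour_integrable_continuous_linepath[OF cont(1)] contour_integrable_continuous_linepath[OF cont(2)]
    contour_integrable_continuous_linepath[OF cont(3)] contour_integrable_continuous_linepath[OF cont(4)]
  have "contour_integral (rectpath ?a ?c) F = contour_integral (linepath ?a ?b) F + (contour_integral (linepath ?b ?c) F
    + (contour_integral (linepath ?c ?d) F + contour_integral (linepath ?d ?a) F))"
    unfolding path by (simp add: contour_integral_join int)
  moreover have "contour_integral (linepath ?c ?d) F = - contour_integral (linepath ?d ?c) F"
    by (rule contour_integral_reverse_linepath[OF cont(3)])
  moreover have "contour_integral (linepath ?d ?a) F = - contour_integral (linepath ?a ?d) F"
    by (rule contour_integral_reverse_linepath[OF cont(4)])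
  ultimately show ?thesis by simp
qed

text \<open>After parametrisation this is an integral of kernels with a continuous density; the
  distance \<open>d\<close> from \<open>\<Omega>\<close> makes the integrand equicontinuous in the
  parameter, uniformly over \<open>\<Omega>\<close>.\<close>

lemma exp_approximable_linepath_integral:
  assumes \<epsilon>: "0 < \<epsilon>" and f: "continuous_on (closed_segment a b) f" and d: "0 < d"
    and far: "\<And>\<zeta> w. \<zeta> \<in> closed_segment a b \<Longrightarrow> w \<in> \<Omega> \<Longrightarrow> d \<le> cmod (\<zeta> - w)"
    and ker: "\<And>\<zeta>. \<zeta> \<in> closed_segment a b \<Longrightarrow> exp_approximable \<Omega> \<epsilon> (\<lambda>w. 1 / (\<zeta> - w))"
  shows "exp_approximable \<Omega> \<epsilon> (\<lambda>w. contour_integral (linepath a b) (\<lambda>\<zeta>. f \<zeta> / (\<zeta> - w)))"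
proof -
  define \<gamma> where "\<gamma> = linepath a b"
  define \<phi> where "\<phi> t = f (\<gamma> t) * (b - a)" for t
  have \<gamma>: "\<gamma> t \<in> closed_segment a b" if "t \<in> {0..1}" for t
    using linepath_in_path[of t a b] that by (simp add: \<gamma>_def)
  have \<gamma>c: "continuous_on {0..1} \<gamma>" unfolding \<gamma>_def by (rule continuous_on_linepath)
  have \<phi>c: "continuous_on {0..1} \<phi>" unfolding \<phi>_def
    by (intro continuous_intros continuous_on_compose2[OF f \<gamma>c]) (use \<gamma> in auto)
  have eq: "contour_integral (linepath a b) (\<lambda>\<zeta>. f \<zeta> / (\<zeta> - w)) = integral {0..1} (\<lambda>t. \<phi> t * (1 / (\<gamma> t - w)))" for w
    by (simp add: contour_integral_integral \<gamma>_def \<phi>_def vector_derivative_linepath_at mult_ac)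
  obtain B where B: "0 < B" "\<And>t. t \<in> {0..1} \<Longrightarrow> cmod (\<phi> t) \<le> B"
  proof -
    have "bounded (\<phi> ` {0..1})" by (intro compact_imp_bounded compact_continuous_image \<phi>c compact_Icc)
    then show ?thesis using that unfolding bounded_pos by blast
  qed
  have "exp_approximable \<Omega> \<epsilon> (\<lambda>w. integral {0..1} (\<lambda>t. \<phi> t * (1 / (\<gamma> t - w))))"
  proof (rule exp_approximable_integral)
    show "exp_approximable \<Omega> \<epsilon> (\<lambda>w. \<phi> t * (1 / (\<gamma> t - w)))" if "0 \<le> t" "t \<le> 1" for t
      by (intro exp_approximable_scale ker \<gamma>) (use that in auto)
    show "continuous_on {0..1} (\<lambda>t. \<phi> t * (1 / (\<gamma> t - w)))" if w: "w \<in> \<Omega>" for w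
    proof -
      have "\<gamma> t - w \<noteq> 0" if "t \<in> {0..1}" for t using far[OF \<gamma>[OF that] w] d by auto
      then show ?thesis by (intro continuous_intros \<phi>c \<gamma>c) auto
    qed
    fix \<eta> :: real assume \<eta>: "0 < \<eta>"
    \<comment> \<open>\<open>e1\<close> and \<open>e2\<close> let the variation of
      \<open>\<phi>\<close> and that of \<open>\<gamma>\<close> contribute \<open>\<eta> / 2\<close>
      each.\<close>
    define e1 where "e1 = \<eta> * d / 2"
    define e2 where "e2 = \<eta> * d\<^sup>2 / (2 * B)"
    have e: "0 < e1" "0 < e2" using \<eta> d B by (auto simp: e1_def e2_def)
    have uc: "uniformly_continuous_on {0..1} \<phi>" "uniformly_continuous_on {0..1} \<gamma>"
      by (intro compact_uniformly_continuous \<phi>c \<gamma>c compact_Icc)+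
    obtain d1 where d1: "0 < d1" "\<And>t t'. t \<in> {0..1} \<Longrightarrow> t' \<in> {0..1} \<Longrightarrow> dist t' t < d1 \<Longrightarrow> dist (\<phi> t') (\<phi> t) < e1"
      using uc(1) e(1) unfolding uniformly_continuous_on_def by metis
    obtain d2 where d2: "0 < d2" "\<And>t t'. t \<in> {0..1} \<Longrightarrow> t' \<in> {0..1} \<Longrightarrow> dist t' t < d2 \<Longrightarrow> dist (\<gamma> t') (\<gamma> t) < e2"
      using uc(2) e(2) unfolding uniformly_continuous_on_def by metis
    have "cmod (\<phi> t * (1 / (\<gamma> t - w)) - \<phi> t' * (1 / (\<gamma> t' - w))) \<le> \<eta> * exp (\<epsilon> * \<bar>Re w\<bar>)"
      if t: "t \<in> {0..1}" "t' \<in> {0..1}" "\<bar>t - t'\<bar> < min d1 d2" and w: "w \<in> \<Omega>" for t t' w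
    proof -
      have D: "d \<le> cmod (\<gamma> t - w)" "d \<le> cmod (\<gamma> t' - w)" by (rule far[OF \<gamma>[OF t(1)] w] far[OF \<gamma>[OF t(2)] w])+
      then have nz: "\<gamma> t - w \<noteq> 0" "\<gamma> t' - w \<noteq> 0" using d by auto
      have c1: "cmod (\<phi> t - \<phi> t') \<le> e1" "cmod (\<gamma> t' - \<gamma> t) \<le> e2"
        using d1(2)[of t' t] d2(2)[of t t'] t by (auto simp: dist_norm abs_minus_commute)
      have "\<phi> t * (1 / (\<gamma> t - w)) - \<phi> t' * (1 / (\<gamma> t' - w)) = (\<phi> t - \<phi> t') / (\<gamma> t - w) + \<phi> t' * (\<gamma> t' - \<gamma> t) / ((\<gamma> t - w) * (\<gamma> t' - w))"
        using nz by (simp add: divide_simps) (simp add: algebra_simps)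
      also have "cmod \<dots> \<le> e1 / d + B * e2 / (d * d)"
      proof (rule norm_triangle_mono)
        show "cmod ((\<phi> t - \<phi> t') / (\<gamma> t - w)) \<le> e1 / d"
          unfolding norm_divide using c1 D d e by (intro frac_le) auto
        show "cmod (\<phi> t' * (\<gamma> t' - \<gamma> t) / ((\<gamma> t - w) * (\<gamma> t' - w))) \<le> B * e2 / (d * d)"
          unfolding norm_divide norm_mult using c1 D d e B t by (intro frac_le mult_mono) auto
      qed
      also have "\<dots> = \<eta>" using d B by (simp add: e1_def e2_def power2_eq_square field_simps)
      finally show ?thesis using \<eta> \<epsilon> by (intro le_exp_weight) auto
    qed
    then show "\<exists>\<delta>>0. \<forall>t\<in>{0..1}. \<forall>t'\<in>{0..1}. \<bar>t - t'\<bar> < \<delta> \<longrightarrow>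
        (\<forall>w\<in>\<Omega>. cmod (\<phi> t * (1 / (\<gamma> t - w)) - \<phi> t' * (1 / (\<gamma> t' - w))) \<le> \<eta> * exp (\<epsilon> * \<bar>Re w\<bar>))"
      using d1(1) d2(1) by (intro exI[of _ "min d1 d2"]) auto
  qed simp
  then show ?thesis unfolding eq .
qed

lemma linepath_cauchy_bound:
  assumes "continuous_on (closed_segment a b) f" "\<And>\<zeta>. \<zeta> \<in> closed_segment a b \<Longrightarrow> cmod (f \<zeta>) \<le> B" "0 \<le> B" "0 < d"
    "\<And>\<zeta>. \<zeta> \<in> closed_segment a b \<Longrightarrow> d \<le> cmod (\<zeta> - w)"
  shows "cmod (contour_integral (linepath a b) (\<lambda>\<zeta>. f \<zeta> / (\<zeta> - w))) \<le> B / d * cmod (b - a)"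
proof (rule contour_integral_bound_linepath)
  have "\<zeta> - w \<noteq> 0" if "\<zeta> \<in> closed_segment a b" for \<zeta> using assms(4) assms(5)[OF that] by auto
  then show "(\<lambda>\<zeta>. f \<zeta> / (\<zeta> - w)) contour_integrable_on linepath a b"
    by (intro contour_integrable_continuous_linepath continuous_intros assms(1)) auto
  show "cmod (f \<zeta> / (\<zeta> - w)) \<le> B / d" if "\<zeta> \<in> closed_segment a b" for \<zeta>
    unfolding norm_divide using assms(2)[OF that] assms(5)[OF that] assms(3,4) by (intro frac_le) auto
qed (use assms in auto)

lemma axis_segment_in_cbox:
  assumes "x0 \<le> x1" "y0 \<le> y1"
  shows "closed_segment (Complex x0 y0) (Complex x1 y0) \<subseteq> cbox (Complex x0 y0) (Complex x1 y1)"
    "closed_segment (Complex x0 y1) (Complex x1 y1) \<subseteq> cbox (Complex x0 y0) (Complex x1 y1)"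
    "closed_segment (Complex x0 y0) (Complex x0 y1) \<subseteq> cbox (Complex x0 y0) (Complex x1 y1)"
    "closed_segment (Complex x1 y0) (Complex x1 y1) \<subseteq> cbox (Complex x0 y0) (Complex x1 y1)"
  by (intro closed_segment_subset convex_box; use assms in \<open>simp add: in_cbox_complex_iff\<close>)+

text \<open>Cauchy's formula over a square grid: the edges that do not cancel are far from \<open>\<Omega>\<close>, except for the
  vertical ones at the truncation \<open>Re = \<plusminus> m h\<close>. Dropping these costs \<open>O(1/m)\<close> where \<open>\<bar>Re w\<bar> \<le> m h / 2\<close>, and
  elsewhere the weight beats the linear growth in \<open>m\<close> of the remaining sum.\<close>

lemma exp_approximable_holomorphic_nbhd:
  assumes \<epsilon>: "0 < \<epsilon>" and \<Omega>: "open \<Omega>" and b: "\<And>w. w \<in> \<Omega> \<Longrightarrow> \<bar>Im w\<bar> \<le> b" and \<delta>: "0 < \<delta>"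
    and f: "f holomorphic_on (\<Union>v\<in>\<Omega>. ball v \<delta>)" and B: "\<And>w. w \<in> (\<Union>v\<in>\<Omega>. ball v \<delta>) \<Longrightarrow> cmod (f w) \<le> B" "0 \<le> B"
    and ker: "\<And>\<zeta>. \<zeta> \<notin> closure \<Omega> \<Longrightarrow> exp_approximable \<Omega> \<epsilon> (\<lambda>w. 1 / (\<zeta> - w))"
  shows "exp_approximable \<Omega> \<epsilon> f"
proof -
  \<comment> \<open>A square of side \<open>h\<close> with a point within \<open>2 * h\<close> of
    some \<open>v\<close> in \<open>\<Omega>\<close> lies within \<open>4 * h\<close> of
    \<open>v\<close>, hence in the domain of \<open>f\<close>.\<close>
  define h where "h = \<delta> / 8"
  have h: "0 < h" "4 * h < \<delta>" using \<delta> by (auto simp: h_def)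
  let ?N = "\<Union>v\<in>\<Omega>. ball v \<delta>"
  define pt where "pt k l = Complex (of_int k * h) (of_int l * h)" for k l :: int
  define Q where "Q k l = cbox (pt k l) (pt (k + 1) (l + 1))" for k l
  have Q_iff: "x \<in> Q k l \<longleftrightarrow> of_int k * h \<le> Re x \<and> Re x \<le> of_int (k + 1) * h \<and> of_int l * h \<le> Im x \<and> Im x \<le> of_int (l + 1) * h" for x k l
    by (simp add: Q_def pt_def in_cbox_complex_iff)
  have seg: "closed_segment (pt k l) (pt (k + 1) l) \<subseteq> Q k l" "closed_segment (pt k (l + 1)) (pt (k + 1) (l + 1)) \<subseteq> Q k l"
    "closed_segment (pt k l) (pt k (l + 1)) \<subseteq> Q k l" "closed_segment (pt (k + 1) l) (pt (k + 1) (l + 1)) \<subseteq> Q k l" for k l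
    unfolding Q_def pt_def using h by (intro axis_segment_in_cbox; simp)+
  define S where "S k l \<longleftrightarrow> (\<exists>v\<in>\<Omega>. \<exists>x\<in>Q k l. dist v x \<le> 2 * h)" for k l
  have diam: "cmod (x - y) \<le> 2 * h" if "x \<in> Q k l" "y \<in> Q k l" for x y k l
  proof -
    have "\<bar>Re (x - y)\<bar> \<le> h" "\<bar>Im (x - y)\<bar> \<le> h" using that unfolding Q_iff by (auto simp: algebra_simps)
    then show ?thesis using cmod_le[of "x - y"] by linarith
  qed
  have S_ball: "\<exists>v\<in>\<Omega>. Q k l \<subseteq> ball v \<delta>" if Skl: "S k l" for k l
  proof -
    obtain v x where vx: "v \<in> \<Omega>" "x \<in> Q k l" "dist v x \<le> 2 * h" using Skl unfolding S_def by blast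
    have "y \<in> ball v \<delta>" if "y \<in> Q k l" for y
      using dist_triangle[of v y x] diam[OF vx(2) that] vx(3) h by (simp add: dist_norm)
    then show ?thesis using vx(1) by blast
  qed
  then have S_N: "Q k l \<subseteq> ?N" if "S k l" for k l using that by blast
  have notS: "2 * h \<le> cmod (\<zeta> - w)" if "\<not> S k l" "\<zeta> \<in> Q k l" "w \<in> \<Omega>" for k l \<zeta> w
  proof -
    have "\<not> dist w \<zeta> \<le> 2 * h" using that unfolding S_def by blast
    then show ?thesis by (simp add: dist_norm norm_minus_commute)
  qed
  have fc: "continuous_on ?N f" using f by (rule holomorphic_on_imp_continuous_on)
  \<comment> \<open>An edge shared by a selected and an unselected square lies in the domain of
    \<open>f\<close> because of the one and at distance at least \<open>2 * h\<close> from
    \<open>\<Omega>\<close> because of the other.\<close>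
  have edge: "exp_approximable \<Omega> \<epsilon> (\<lambda>w. contour_integral (linepath x y) (\<lambda>\<zeta>. f \<zeta> / (\<zeta> - w)))"
    "\<And>w. w \<in> \<Omega> \<Longrightarrow> cmod (contour_integral (linepath x y) (\<lambda>\<zeta>. f \<zeta> / (\<zeta> - w))) \<le> B / (2 * h) * cmod (y - x)"
    if xy: "closed_segment x y \<subseteq> Q k l" "closed_segment x y \<subseteq> Q k' l'" and SS: "S k l" "\<not> S k' l'" for x y k l k' l'
  proof -
    have c: "continuous_on (closed_segment x y) f"
      by (rule continuous_on_subset[OF fc]) (use xy(1) S_N[OF SS(1)] in blast)
    have far: "2 * h \<le> cmod (\<zeta> - w)" if "\<zeta> \<in> closed_segment x y" "w \<in> \<Omega>" for \<zeta> w
      using notS[OF SS(2) _ that(2)] xy(2) that(1) by blast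
    have "\<zeta> \<notin> closure \<Omega>" if "\<zeta> \<in> closed_segment x y" for \<zeta>
    proof
      assume "\<zeta> \<in> closure \<Omega>"
      moreover have "0 < 2 * h" using h by simp
      ultimately obtain w where "w \<in> \<Omega>" "dist w \<zeta> < 2 * h" unfolding closure_approachable by blast
      then show False using far[OF that, of w] by (simp add: dist_norm norm_minus_commute)
    qed
    then show "exp_approximable \<Omega> \<epsilon> (\<lambda>w. contour_integral (linepath x y) (\<lambda>\<zeta>. f \<zeta> / (\<zeta> - w)))"
      using h far by (intro exp_approximable_linepath_integral[OF \<epsilon> c, of "2 * h"] ker) auto
    have fB: "cmod (f \<zeta>) \<le> B" if "\<zeta> \<in> closed_segment x y" for \<zeta>
      by (rule B(1)) (use that xy(1) S_N[OF SS(1)] in blast)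
    show "cmod (contour_integral (linepath x y) (\<lambda>\<zeta>. f \<zeta> / (\<zeta> - w))) \<le> B / (2 * h) * cmod (y - x)"
      if "w \<in> \<Omega>" for w
      by (rule linepath_cauchy_bound[OF c fB B(2) _ far[OF _ that]]) (use h in auto)
  qed
  have pt_dist: "cmod (pt (k + 1) l - pt k l) = h" "cmod (pt k (l + 1) - pt k l) = h" for k l
  proof -
    have "pt (k + 1) l - pt k l = of_real h" "pt k (l + 1) - pt k l = \<i> * of_real h"
      by (auto simp: pt_def complex_eq_iff algebra_simps)
    then show "cmod (pt (k + 1) l - pt k l) = h" "cmod (pt k (l + 1) - pt k l) = h"
      using h by (simp_all add: norm_mult)
  qed
  \<comment> \<open>The margin 4 covers the distance \<open>2 * h\<close> allowed in
    \<open>S\<close>, the height of a square and the rounding.\<close>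
  define L where "L = \<lceil>b / h\<rceil> + 4"
  have S_range: "- L \<le> l \<and> l < L" if Skl: "S k l" for k l
  proof -
    obtain v x where vx: "v \<in> \<Omega>" "x \<in> Q k l" "dist v x \<le> 2 * h" using Skl unfolding S_def by blast
    have "\<bar>Im (v - x)\<bar> \<le> 2 * h" using abs_Im_le_cmod[of "v - x"] vx(3) by (simp add: dist_norm)
    then have "\<bar>Im x\<bar> \<le> b + 2 * h" using b[OF vx(1)] by simp
    then have "of_int l * h \<le> b + 2 * h" "- (b + 2 * h) \<le> of_int (l + 1) * h" using vx(2) unfolding Q_iff by linarith+
    then have "of_int l \<le> b / h + 2" "- (b / h) - 3 \<le> of_int l" using h by (auto simp: field_simps)
    then show ?thesis unfolding L_def by linarith
  qed
  define H where "H k l w = contour_integral (linepath (pt k l) (pt (k + 1) l)) (\<lambda>\<zeta>. f \<zeta> / (\<zeta> - w))" for k l w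
  define V where "V k l w = contour_integral (linepath (pt k l) (pt k (l + 1))) (\<lambda>\<zeta>. f \<zeta> / (\<zeta> - w))" for k l w
  \<comment> \<open>Off the grid lines each point is interior to exactly one square, and no contour
    passes through it.\<close>
  define \<Omega>' where "\<Omega>' = {w \<in> \<Omega>. \<forall>k::int. Re w \<noteq> of_int k * h \<and> Im w \<noteq> of_int k * h}"
  have box: "contour_integral (rectpath (pt k l) (pt (k + 1) (l + 1))) (\<lambda>\<zeta>. f \<zeta> / (\<zeta> - w)) = (H k l w - H k (l + 1) w) + (V (k + 1) l w - V k l w)"
    "(w \<in> Q k l \<longrightarrow> contour_integral (rectpath (pt k l) (pt (k + 1) (l + 1))) (\<lambda>\<zeta>. f \<zeta> / (\<zeta> - w)) = 2 * of_real pi * \<i> * f w) \<and>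
     (w \<notin> Q k l \<longrightarrow> contour_integral (rectpath (pt k l) (pt (k + 1) (l + 1))) (\<lambda>\<zeta>. f \<zeta> / (\<zeta> - w)) = 0)"
    if w: "w \<in> \<Omega>'" and Skl: "S k l" for w k l
  proof -
    let ?R = "rectpath (pt k l) (pt (k + 1) (l + 1))"
    have le: "Re (pt k l) \<le> Re (pt (k + 1) (l + 1))" "Im (pt k l) \<le> Im (pt (k + 1) (l + 1))"
      using h by (auto simp: pt_def)
    have imgQ: "path_image ?R \<subseteq> Q k l" unfolding Q_def by (rule path_image_rectpath_subset_cbox[OF le])
    have img: "path_image ?R \<subseteq> Q k l - {w}"
    proof -
      have "z \<noteq> w" if "z \<in> path_image ?R" for z
      proof -
        have "Re z \<in> {of_int k * h, of_int (k + 1) * h} \<or> Im z \<in> {of_int l * h, of_int (l + 1) * h}"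
          using that le by (auto simp: path_image_rectpath pt_def)
        moreover have "Re w \<noteq> of_int j * h" "Im w \<noteq> of_int j * h" for j :: int using w by (auto simp: \<Omega>'_def)
        ultimately show ?thesis by blast
      qed
      then show ?thesis using imgQ by blast
    qed
    obtain v where v: "v \<in> \<Omega>" "Q k l \<subseteq> ball v \<delta>" using S_ball[OF Skl] by blast
    have fv: "f holomorphic_on ball v \<delta>" by (rule holomorphic_on_subset[OF f]) (use v in blast)
    have "continuous_on (path_image ?R) (\<lambda>\<zeta>. f \<zeta> / (\<zeta> - w))"
      using img v by (intro continuous_intros holomorphic_on_imp_continuous_on[OF holomorphic_on_subset[OF fv]]) auto
    then show "contour_integral ?R (\<lambda>\<zeta>. f \<zeta> / (\<zeta> - w)) = (H k l w - H k (l + 1) w) + (V (k + 1) l w - V k l w)"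
      unfolding H_def V_def pt_def using h by (intro contour_integral_rectangle) auto
    have "contour_integral ?R (\<lambda>\<zeta>. f \<zeta> / (\<zeta> - w)) = 2 * of_real pi * \<i> * f w" if wQ: "w \<in> Q k l"
    proof -
      have ne: "Re w \<noteq> of_int j * h" "Im w \<noteq> of_int j * h" for j :: int using w by (auto simp: \<Omega>'_def)
      have "w \<in> box (pt k l) (pt (k + 1) (l + 1))"
        unfolding in_box_complex_iff pt_def complex.sel greaterThanLessThan_iff
        using wQ[unfolded Q_iff] ne(1)[of k] ne(1)[of "k + 1"] ne(2)[of l] ne(2)[of "l + 1"]
        by (auto intro!: order.not_eq_order_implies_strict simp del: of_int_add)
      then have wn: "winding_number ?R w = 1" by (rule winding_number_rectpath)
      have "w \<in> ball v \<delta>" using v(2) wQ by blast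
      have "contour_integral ?R (\<lambda>\<zeta>. f \<zeta> / (\<zeta> - w)) = 2 * of_real pi * \<i> * winding_number ?R w * f w"
        using Cauchy_integral_formula_convex_simple[OF convex_ball fv, of w ?R] \<open>w \<in> ball v \<delta>\<close> img v(2)
        by (intro contour_integral_unique) (auto simp: mult_ac interior_open)
      then show ?thesis unfolding wn by simp
    qed
    moreover have "contour_integral ?R (\<lambda>\<zeta>. f \<zeta> / (\<zeta> - w)) = 0" if wQ: "w \<notin> Q k l"
    proof (rule contour_integral_unique[OF Cauchy_theorem_convex_simple])
      show "(\<lambda>\<zeta>. f \<zeta> / (\<zeta> - w)) holomorphic_on Q k l"
        using wQ by (intro holomorphic_intros holomorphic_on_subset[OF fv v(2)]) auto
      show "convex (Q k l)" unfolding Q_def by (rule convex_box)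
    qed (use imgQ in auto)
    ultimately show "(w \<in> Q k l \<longrightarrow> contour_integral ?R (\<lambda>\<zeta>. f \<zeta> / (\<zeta> - w)) = 2 * of_real pi * \<i> * f w) \<and>
      (w \<notin> Q k l \<longrightarrow> contour_integral ?R (\<lambda>\<zeta>. f \<zeta> / (\<zeta> - w)) = 0)" by blast
  qed
  have dense: "\<Omega> \<subseteq> closure \<Omega>'"
  proof
    fix w assume w: "w \<in> \<Omega>"
    obtain r where r: "0 < r" "ball w r \<subseteq> \<Omega>" using \<Omega> w openE by blast
    have "\<exists>y\<in>\<Omega>'. dist y w < e" if e: "0 < e" for e
    proof -
      \<comment> \<open>Each grid line excludes one parameter of a diagonal shift, countably many in
        all.\<close>
      let ?bad = "(\<lambda>k. of_int k * h - Re w) ` (UNIV :: int set) \<union> (\<lambda>k. of_int k * h - Im w) ` (UNIV :: int set)"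
      have "countable ?bad" by (intro countable_Un countable_image) auto
      moreover have "uncountable {0<..<min e r / 2}" using e r(1) by (simp add: uncountable_open_interval)
      ultimately obtain t where t: "t \<in> {0<..<min e r / 2}" "t \<notin> ?bad"
        by (meson countable_subset subsetI)
      let ?y = "w + Complex t t"
      have "cmod (Complex t t) < min e r" using cmod_le[of "Complex t t"] t(1) by simp
      then have "dist ?y w < e" "?y \<in> \<Omega>" using r(2) by (auto simp: dist_norm subset_iff)
      moreover have "Re ?y \<noteq> of_int k * h \<and> Im ?y \<noteq> of_int k * h" for k :: int
        using t(2) by (auto simp: algebra_simps)
      ultimately show ?thesis unfolding \<Omega>'_def by blast
    qed
    then show "w \<in> closure \<Omega>'" unfolding closure_approachable by blast
  qed
  have "exp_approximable \<Omega>' \<epsilon> f"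
  proof (rule exp_approximable_limit)
    fix \<eta> :: real assume \<eta>: "0 < \<eta>"
    \<comment> \<open>\<open>C1\<close> bounds, generously, \<open>B\<close> times the number of
      edges per column; \<open>C2\<close> accounts for the end edges that are dropped.\<close>
    define C1 where "C1 = (8 * \<bar>real_of_int L\<bar> + 2) * B"
    define C2 where "C2 = 4 * \<bar>real_of_int L\<bar> * B"
    \<comment> \<open>At \<open>\<bar>Re w\<bar> = m h / 2\<close> the weight equals
      \<open>exp (\<kappa> m)\<close>.\<close>
    define \<kappa> where "\<kappa> = \<epsilon> * h / 2"
    have \<kappa>: "0 < \<kappa>" using \<epsilon> h by (simp add: \<kappa>_def)
    have C: "0 \<le> C1" "0 \<le> C2" using B(2) by (auto simp: C1_def C2_def)
    have "(\<lambda>m. (B + real m * C1) * exp (- (\<kappa> * real m))) \<longlonglongrightarrow> 0" using \<kappa> by real_asymp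
    then have "\<forall>\<^sub>F m in sequentially. (B + real m * C1) * exp (- (\<kappa> * real m)) < \<eta>"
      using \<eta> by (intro order_tendstoD)
    moreover have "(\<lambda>m. C2 / real m) \<longlonglongrightarrow> 0" by real_asymp
    then have "\<forall>\<^sub>F m in sequentially. C2 / real m < \<eta>" using \<eta> by (intro order_tendstoD)
    moreover have "\<forall>\<^sub>F m in sequentially. (1::nat) \<le> m" by (rule eventually_ge_at_top)
    ultimately have "\<forall>\<^sub>F m in sequentially. (B + real m * C1) * exp (- (\<kappa> * real m)) < \<eta> \<and> C2 / real m < \<eta> \<and> (1::nat) \<le> m"
      by (intro eventually_conj)
    then obtain m0 :: nat where m0: "(B + real m0 * C1) * exp (- (\<kappa> * real m0)) < \<eta>" "C2 / real m0 < \<eta>" "1 \<le> m0"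
      using eventually_happens'[OF sequentially_bot] by blast
    define m where "m = int m0"
    have m: "1 \<le> m" "real_of_int m = real m0" using m0(3) by (auto simp: m_def)
    have far_bound: "B + real m0 * C1 \<le> \<eta> * exp (\<kappa> * real m0)"
      using m0(1) by (simp add: exp_minus field_simps)
    \<comment> \<open>Indicator of the selected squares in the columns from \<open>-m\<close> to
      \<open>m - 1\<close>; its zeros outside make the ends of both summations by parts
      vanish.\<close>
    define \<theta> where "\<theta> k l = (if S k l \<and> - m \<le> k \<and> k < m then 1 else 0 :: complex)" for k l
    define cH where "cH k l = \<theta> k l - \<theta> k (l - 1)" for k l
    define cV where "cV k l = \<theta> k l - \<theta> (k - 1) l" for k l
    define FH where "FH w = (\<Sum>k\<in>{-m..<m}. \<Sum>l\<in>{-L..L}. cH k l * H k l w)" for w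
    \<comment> \<open>The range omits \<open>k = -m\<close> and \<open>k = m\<close>: there a
      coefficient can be nonzero because of the truncation alone, and the edge may pass through
      \<open>\<Omega>\<close>.\<close>
    define FV where "FV w = (\<Sum>l\<in>{-L..<L}. \<Sum>k\<in>{-m<..<m}. cV k l * V k l w)" for w
    define F where "F w = 1 / (2 * of_real pi * \<i>) * (FH w - FV w)" for w
    have H_cases: "cH k l = 0 \<or> cmod (cH k l) = 1 \<and> (S k l \<and> \<not> S k (l - 1) \<or> S k (l - 1) \<and> \<not> S k l)" for k l
      unfolding cH_def \<theta>_def by auto
    have V_cases: "cV k l = 0 \<or> cmod (cV k l) = 1 \<and> (S k l \<and> \<not> S (k - 1) l \<or> S (k - 1) l \<and> \<not> S k l)"
      if "k \<in> {-m<..<m}" for k l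
      using that unfolding cV_def \<theta>_def by auto
    have edge_term: "exp_approximable \<Omega> \<epsilon> (\<lambda>w. c * contour_integral (linepath x y) (\<lambda>\<zeta>. f \<zeta> / (\<zeta> - w)))"
      "\<And>w. w \<in> \<Omega> \<Longrightarrow> cmod (c * contour_integral (linepath x y) (\<lambda>\<zeta>. f \<zeta> / (\<zeta> - w))) \<le> B / 2"
      if "c = 0 \<or> cmod c = 1 \<and> (S k l \<and> \<not> S k' l' \<or> S k' l' \<and> \<not> S k l)"
        and xy: "closed_segment x y \<subseteq> Q k l" "closed_segment x y \<subseteq> Q k' l'" "cmod (y - x) = h" for c x y k l k' l'
    proof -
      have cases: "c = 0 \<or> cmod c = 1 \<and> S k l \<and> \<not> S k' l' \<or> cmod c = 1 \<and> S k' l' \<and> \<not> S k l" using that(1) by blast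
      then show "exp_approximable \<Omega> \<epsilon> (\<lambda>w. c * contour_integral (linepath x y) (\<lambda>\<zeta>. f \<zeta> / (\<zeta> - w)))"
      proof (elim disjE conjE)
        assume "c = 0" then show ?thesis by (simp add: exp_approximable_zero)
      next
        assume "S k l" "\<not> S k' l'"
        then show ?thesis by (intro exp_approximable_scale edge(1)[OF xy(1,2)])
      next
        assume "S k' l'" "\<not> S k l"
        then show ?thesis by (intro exp_approximable_scale edge(1)[OF xy(2,1)])
      qed
      have hB: "B / (2 * h) * cmod (y - x) = B / 2" unfolding xy(3) using h by simp
      fix w assume w: "w \<in> \<Omega>"
      from cases show "cmod (c * contour_integral (linepath x y) (\<lambda>\<zeta>. f \<zeta> / (\<zeta> - w))) \<le> B / 2"
      proof (elim disjE conjE)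
        assume "c = 0" then show ?thesis using B(2) by simp
      next
        assume "cmod c = 1" "S k l" "\<not> S k' l'"
        then show ?thesis using edge(2)[OF xy(1,2) _ _ w] hB by (simp add: norm_mult)
      next
        assume "cmod c = 1" "S k' l'" "\<not> S k l"
        then show ?thesis using edge(2)[OF xy(2,1) _ _ w] hB by (simp add: norm_mult)
      qed
    qed
    have segH: "closed_segment (pt k l) (pt (k + 1) l) \<subseteq> Q k (l - 1)" for k l using seg(2)[of k "l - 1"] by simp
    have segV: "closed_segment (pt k l) (pt k (l + 1)) \<subseteq> Q (k - 1) l" for k l using seg(4)[of "k - 1" l] by simp
    have H_term: "exp_approximable \<Omega> \<epsilon> (\<lambda>w. cH k l * H k l w)" for k l
      unfolding H_def by (rule edge_term(1)[OF H_cases seg(1) segH pt_dist(1)])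
    have H_bound: "cmod (cH k l * H k l w) \<le> B / 2" if "w \<in> \<Omega>" for k l w
      unfolding H_def by (rule edge_term(2)[OF H_cases seg(1) segH pt_dist(1) that])
    have V_term: "exp_approximable \<Omega> \<epsilon> (\<lambda>w. cV k l * V k l w)" if "k \<in> {-m<..<m}" for k l
      unfolding V_def by (rule edge_term(1)[OF V_cases[OF that] seg(3) segV pt_dist(2)])
    have V_bound: "cmod (cV k l * V k l w) \<le> B / 2" if "k \<in> {-m<..<m}" "w \<in> \<Omega>" for k l w
      unfolding V_def by (rule edge_term(2)[OF V_cases[OF that(1)] seg(3) segV pt_dist(2) that(2)])
    have "exp_approximable \<Omega> \<epsilon> F"
      unfolding F_def FH_def FV_def
      by (intro exp_approximable_scale exp_approximable_diff exp_approximable_sum H_term V_term)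
    then have FE: "exp_approximable \<Omega>' \<epsilon> F" by (rule exp_approximable_subset) (auto simp: \<Omega>'_def)
    have cards: "real (card {-L..L}) \<le> 2 * \<bar>real_of_int L\<bar> + 1" "real (card {-L..<L}) \<le> 2 * \<bar>real_of_int L\<bar>"
      "real (card {-m..<m}) = 2 * real m0" "real (card {-m<..<m}) \<le> 2 * real m0"
      by (auto simp: m_def)
    have F_bound: "cmod (F w) \<le> real m0 * C1" if w: "w \<in> \<Omega>" for w
    proof -
      have "cmod (FH w) \<le> real (card {-m..<m}) * (real (card {-L..L}) * (B / 2))"
        unfolding FH_def by (intro sum_norm_bound H_bound w)
      also have "\<dots> \<le> (2 * real m0) * ((2 * \<bar>real_of_int L\<bar> + 1) * (B / 2))"
        using cards B(2) by (intro mult_mono) auto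
      finally have 1: "cmod (FH w) \<le> (2 * real m0) * ((2 * \<bar>real_of_int L\<bar> + 1) * (B / 2))" .
      have "cmod (FV w) \<le> real (card {-L..<L}) * (real (card {-m<..<m}) * (B / 2))"
        unfolding FV_def by (intro sum_norm_bound V_bound w)
      also have "\<dots> \<le> (2 * \<bar>real_of_int L\<bar>) * ((2 * real m0) * (B / 2))"
        using cards B(2) by (intro mult_mono) auto
      finally have 2: "cmod (FV w) \<le> (2 * \<bar>real_of_int L\<bar>) * ((2 * real m0) * (B / 2))" .
      have "cmod (F w) = cmod (FH w - FV w) / (2 * pi)" by (simp add: F_def norm_mult norm_divide)
      also have "\<dots> \<le> cmod (FH w - FV w) / 1" using pi_ge_two by (intro divide_left_mono) auto
      also have "\<dots> \<le> cmod (FH w) + cmod (FV w)" using norm_triangle_ineq4 by simp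
      also have "\<dots> \<le> (2 * real m0) * ((2 * \<bar>real_of_int L\<bar> + 1) * (B / 2)) + (2 * \<bar>real_of_int L\<bar>) * ((2 * real m0) * (B / 2))"
        using 1 2 by (rule add_mono)
      also have "\<dots> = real m0 * ((4 * \<bar>real_of_int L\<bar> + 1) * B)" by (simp add: field_simps)
      also have "\<dots> \<le> real m0 * C1" unfolding C1_def using B(2) by (intro mult_left_mono mult_right_mono) auto
      finally show ?thesis .
    qed
    have near: "cmod (f w - F w) \<le> C2 / real m0" if w: "w \<in> \<Omega>'" "\<bar>Re w\<bar> \<le> real m0 * h / 2" for w
    proof -
      have w\<Omega>: "w \<in> \<Omega>" using w(1) by (simp add: \<Omega>'_def)
      have wm: "\<bar>Re w\<bar> < real_of_int m * h"
      proof -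
        have "0 < real m0 * h" using h m0(3) by simp
        then show ?thesis using w(2) unfolding m(2) by linarith
      qed
      define k0 l0 where "k0 = \<lfloor>Re w / h\<rfloor>" and "l0 = \<lfloor>Im w / h\<rfloor>"
      have kl0: "of_int k0 * h \<le> Re w" "Re w < of_int (k0 + 1) * h" "of_int l0 * h \<le> Im w" "Im w < of_int (l0 + 1) * h"
        using h by (auto simp: k0_def l0_def pos_le_divide_eq[symmetric] pos_divide_less_eq[symmetric] simp del: of_int_add)
          linarith+
      have wQ: "w \<in> Q k0 l0" using kl0 unfolding Q_iff by linarith
      have S0: "S k0 l0" unfolding S_def using w\<Omega> wQ h by (intro bexI[of _ w]) auto
      have Q_unique: "k = k0 \<and> l = l0" if wQ': "w \<in> Q k l" for k l
      proof -
        have ne: "Re w \<noteq> of_int j * h" "Im w \<noteq> of_int j * h" for j :: int using w(1) by (auto simp: \<Omega>'_def)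
        have "of_int k * h \<le> Re w" "Re w < of_int (k + 1) * h" "of_int l * h \<le> Im w" "Im w < of_int (l + 1) * h"
          using wQ'[unfolded Q_iff] ne(1)[of "k + 1"] ne(2)[of "l + 1"]
          by (auto intro!: order.not_eq_order_implies_strict simp del: of_int_add)
        then have "of_int k \<le> Re w / h" "Re w / h < of_int k + 1" "of_int l \<le> Im w / h" "Im w / h < of_int l + 1"
          using h by (auto simp: field_simps)
        then show ?thesis unfolding k0_def l0_def by (metis floor_unique)
      qed
      have k0m: "- m \<le> k0" "k0 < m"
      proof -
        have "of_int k0 * h < of_int m * h" "of_int (-m) * h < of_int (k0 + 1) * h" using kl0 wm by auto
        then have "real_of_int k0 < real_of_int m" "real_of_int (-m) < real_of_int (k0 + 1)"
          using h by (simp_all only: mult_less_cancel_right_pos)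
        then show "- m \<le> k0" "k0 < m" by linarith+
      qed
      note l0L = S_range[OF S0]
      \<comment> \<open>Of all selected squares only the one containing \<open>w\<close>
        contributes, by Cauchy's formula.\<close>
      have "(\<Sum>k\<in>{-m..<m}. \<Sum>l\<in>{-L..<L}. \<theta> k l * ((H k l w - H k (l + 1) w) + (V (k + 1) l w - V k l w)))
        = (\<Sum>k\<in>{-m..<m}. \<Sum>l\<in>{-L..<L}. if k = k0 then (if l = l0 then 2 * of_real pi * \<i> * f w else 0) else 0)"
      proof (intro sum.cong refl)
        fix k l assume k: "k \<in> {-m..<m}"
        show "\<theta> k l * ((H k l w - H k (l + 1) w) + (V (k + 1) l w - V k l w)) = (if k = k0 then (if l = l0 then 2 * of_real pi * \<i> * f w else 0) else 0)"
        proof (cases "S k l")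
          case True
          show ?thesis
          proof (cases "w \<in> Q k l")
            case True
            then have "k = k0" "l = l0" using Q_unique by auto
            then show ?thesis using box[OF w(1) \<open>S k l\<close>] k True \<open>S k l\<close> by (simp add: \<theta>_def)
          next
            case False
            then have "\<not> (k = k0 \<and> l = l0)" using wQ by blast
            then show ?thesis using box[OF w(1) \<open>S k l\<close>] False by auto
          qed
        next
          case False
          then have "\<not> (k = k0 \<and> l = l0)" using S0 by blast
          then show ?thesis using False by (auto simp: \<theta>_def)
        qed
      qed
      also have "\<dots> = (\<Sum>k\<in>{-m..<m}. if k = k0 then 2 * of_real pi * \<i> * f w else 0)"
        using l0L by (intro sum.cong refl) (simp add: sum.delta)
      also have "\<dots> = 2 * of_real pi * \<i> * f w" using k0m by (simp add: sum.delta)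
      finally have tot: "(\<Sum>k\<in>{-m..<m}. \<Sum>l\<in>{-L..<L}. \<theta> k l * ((H k l w - H k (l + 1) w) + (V (k + 1) l w - V k l w))) = 2 * of_real pi * \<i> * f w" .
      have \<theta>L: "\<theta> k L = 0" "\<theta> k (- L - 1) = 0" for k using S_range[of k L] S_range[of k "- L - 1"] by (auto simp: \<theta>_def)
      have \<theta>m: "\<theta> m l = 0" "\<theta> (- m - 1) l = 0" for l by (auto simp: \<theta>_def)
      have sH: "(\<Sum>l\<in>{-L..<L}. \<theta> k l * (H k l w - H k (l + 1) w)) = (\<Sum>l\<in>{-L..L}. cH k l * H k l w)" for k
        unfolding cH_def using l0L \<theta>L by (intro sum_by_parts_int) auto
      have sV: "(\<Sum>k\<in>{-m..<m}. \<theta> k l * (V k l w - V (k + 1) l w)) = (\<Sum>k\<in>{-m..m}. cV k l * V k l w)" for l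
        unfolding cV_def using m(1) \<theta>m by (intro sum_by_parts_int[where c = "\<lambda>k. \<theta> k l" and g = "\<lambda>k. V k l w"]) auto
      have split: "(\<Sum>k\<in>{-m..m}. cV k l * V k l w) = (\<Sum>k\<in>{-m<..<m}. cV k l * V k l w) + (cV m l * V m l w + cV (-m) l * V (-m) l w)" for l
      proof -
        have "{-m..m} = insert m (insert (-m) {-m<..<m})" using m(1) by auto
        then show ?thesis using m(1) by (simp add: add_ac)
      qed
      define E where "E = (\<Sum>l\<in>{-L..<L}. cV m l * V m l w + cV (-m) l * V (-m) l w)"
      have "2 * of_real pi * \<i> * f w = (\<Sum>k\<in>{-m..<m}. \<Sum>l\<in>{-L..<L}. \<theta> k l * (H k l w - H k (l + 1) w))
        - (\<Sum>k\<in>{-m..<m}. \<Sum>l\<in>{-L..<L}. \<theta> k l * (V k l w - V (k + 1) l w))"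
        unfolding tot[symmetric] sum_subtractf[symmetric] by (simp add: algebra_simps)
      also have "(\<Sum>k\<in>{-m..<m}. \<Sum>l\<in>{-L..<L}. \<theta> k l * (V k l w - V (k + 1) l w))
        = (\<Sum>l\<in>{-L..<L}. \<Sum>k\<in>{-m..<m}. \<theta> k l * (V k l w - V (k + 1) l w))" by (rule sum.swap)
      also have "\<dots> = FV w + E" unfolding sV split FV_def E_def sum.distrib ..
      also have "(\<Sum>k\<in>{-m..<m}. \<Sum>l\<in>{-L..<L}. \<theta> k l * (H k l w - H k (l + 1) w)) = FH w" unfolding sH FH_def ..
      finally have "2 * of_real pi * \<i> * f w = FH w - FV w - E" by simp
      then have "f w = 1 / (2 * of_real pi * \<i>) * (FH w - FV w - E)" by (simp add: field_simps)
      then have "f w - F w = - E / (2 * of_real pi * \<i>)" unfolding F_def by (simp add: diff_divide_distrib)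
      then have fF: "cmod (f w - F w) = cmod E / (2 * pi)" by (simp add: norm_divide norm_mult)
      \<comment> \<open>Such an edge has length \<open>h\<close> and, since
        \<open>\<bar>Re w\<bar> \<le> m h / 2\<close>, distance at least \<open>m h / 2\<close> from
        \<open>w\<close>.\<close>
      have end_bound: "cmod (c * V k l w) \<le> 2 * B / real m0"
        if c: "c = 0 \<or> cmod c = 1 \<and> closed_segment (pt k l) (pt k (l + 1)) \<subseteq> ?N" and k: "\<bar>k\<bar> = m" for c k l
      proof (cases "c = 0")
        case False
        let ?s = "closed_segment (pt k l) (pt k (l + 1))"
        have c1: "cmod c = 1" "?s \<subseteq> ?N" using c False by auto
        have Re\<zeta>: "Re \<zeta> = of_int k * h" if \<zeta>: "\<zeta> \<in> ?s" for \<zeta>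
        proof -
          obtain u where u: "\<zeta> = (1 - u) *\<^sub>R pt k l + u *\<^sub>R pt k (l + 1)" using \<zeta> by (auto simp: in_segment)
          show ?thesis unfolding u by (simp add: pt_def algebra_simps)
        qed
        have d: "real m0 * h / 2 \<le> cmod (\<zeta> - w)" if "\<zeta> \<in> ?s" for \<zeta>
        proof -
          have "\<bar>of_int k * h\<bar> = real m0 * h" using k h m(2) by (simp add: abs_mult flip: of_int_abs)
          then have "real m0 * h / 2 \<le> \<bar>Re (\<zeta> - w)\<bar>"
            using w(2) Re\<zeta>[OF that] abs_triangle_ineq2[of "of_int k * h" "Re w"] by simp
          then show ?thesis using abs_Re_le_cmod order_trans by blast
        qed
        have fB: "cmod (f \<zeta>) \<le> B" if "\<zeta> \<in> ?s" for \<zeta> by (rule B(1)) (use c1(2) that in blast)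
        have "cmod (V k l w) \<le> B / (real m0 * h / 2) * cmod (pt k (l + 1) - pt k l)"
          unfolding V_def
          by (rule linepath_cauchy_bound[OF continuous_on_subset[OF fc c1(2)] fB B(2) _ d]) (use h m0(3) in auto)
        also have "\<dots> = 2 * B / real m0" unfolding pt_dist using h by simp
        finally show ?thesis using c1 by (simp add: norm_mult)
      qed (use B(2) in simp)
      have "cmod (cV m l * V m l w + cV (-m) l * V (-m) l w) \<le> 2 * B / real m0 + 2 * B / real m0" for l
      proof (intro norm_triangle_mono end_bound)
        show "cV m l = 0 \<or> cmod (cV m l) = 1 \<and> closed_segment (pt m l) (pt m (l + 1)) \<subseteq> ?N"
          using segV[of m l] S_N[of "m - 1" l] unfolding cV_def \<theta>_def by auto
        show "cV (-m) l = 0 \<or> cmod (cV (-m) l) = 1 \<and> closed_segment (pt (-m) l) (pt (-m) (l + 1)) \<subseteq> ?N"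
          using seg(3)[of "-m" l] S_N[of "-m" l] unfolding cV_def \<theta>_def by auto
      qed (use m in auto)
      then have "cmod E \<le> real (card {-L..<L}) * (2 * B / real m0 + 2 * B / real m0)"
        unfolding E_def by (intro sum_norm_bound)
      also have "\<dots> \<le> (2 * \<bar>real_of_int L\<bar>) * (2 * B / real m0 + 2 * B / real m0)"
        using cards B(2) by (intro mult_right_mono) auto
      also have "\<dots> = 2 * (C2 / real m0)" by (simp add: C2_def field_simps)
      finally have "cmod E / (2 * pi) \<le> 2 * (C2 / real m0) / 2"
        using pi_ge_two C(2) by (intro frac_le) auto
      then show ?thesis using fF by simp
    qed
    have "cmod (f w - F w) \<le> \<eta> * exp (\<epsilon> * \<bar>Re w\<bar>)" if w: "w \<in> \<Omega>'" for w
    proof (cases "\<bar>Re w\<bar> \<le> real m0 * h / 2")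
      case True
      then show ?thesis using near[OF w] m0(2) \<eta> \<epsilon> by (intro le_exp_weight) auto
    next
      case False
      have w\<Omega>: "w \<in> \<Omega>" using w by (simp add: \<Omega>'_def)
      then have "w \<in> ?N" by (rule UN_I) (use \<delta> in simp)
      have "cmod (f w - F w) \<le> B + real m0 * C1"
        using norm_triangle_ineq4[of "f w" "F w"] B(1)[OF \<open>w \<in> ?N\<close>] F_bound[OF w\<Omega>] by linarith
      also have "\<dots> \<le> \<eta> * exp (\<kappa> * real m0)" by (rule far_bound)
      also have "\<dots> \<le> \<eta> * exp (\<epsilon> * \<bar>Re w\<bar>)"
      proof -
        have "\<epsilon> * (real m0 * h / 2) \<le> \<epsilon> * \<bar>Re w\<bar>" using False \<epsilon> by (intro mult_left_mono) auto
        then show ?thesis using \<eta> by (simp add: \<kappa>_def mult_ac)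
      qed
      finally show ?thesis .
    qed
    then show "\<exists>g. exp_approximable \<Omega>' \<epsilon> g \<and> (\<forall>w\<in>\<Omega>'. cmod (f w - g w) \<le> \<eta> * exp (\<epsilon> * \<bar>Re w\<bar>))"
      using FE by blast
  qed
  then show ?thesis
    by (rule exp_approximable_closure[OF _ continuous_on_subset[OF fc] _ dense]) (use \<delta> in \<open>auto simp: \<Omega>'_def\<close>)
qed

section \<open>Proof of the theorem\<close>

text \<open>A half plane beyond the strip is convex and misses \<open>closure \<Omega>\<close>; the
  sign \<open>\<sigma>\<close> treats the upper and the lower one together.\<close>

lemma half_plane_component:
  fixes \<Omega> :: "complex set"
  assumes b: "\<And>w. w \<in> \<Omega> \<Longrightarrow> \<bar>Im w\<bar> \<le> b" and \<sigma>: "\<sigma> = 1 \<or> \<sigma> = (-1::real)"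
  shows "\<exists>C\<in>components (- closure \<Omega>). \<forall>z. b < \<sigma> * Im z \<longrightarrow> z \<in> C"
proof -
  define P where "P = {z. b < \<sigma> * Im z}"
  have cl: "closure \<Omega> \<subseteq> {z. \<sigma> * Im z \<le> b}"
  proof (rule closure_minimal)
    show "\<Omega> \<subseteq> {z. \<sigma> * Im z \<le> b}" using b \<sigma> by force
    show "closed {z. \<sigma> * Im z \<le> b}" by (intro closed_Collect_le continuous_intros)
  qed
  have "convex P"
  proof (rule convexI)
    fix x y :: complex and u v :: real
    assume xy: "x \<in> P" "y \<in> P" and uv: "0 \<le> u" "0 \<le> v" "u + v = 1"
    have "b = u * b + v * b" using uv by (simp flip: distrib_right)
    also have "\<dots> < u * (\<sigma> * Im x) + v * (\<sigma> * Im y)"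
    proof (cases "u = 0")
      case True then show ?thesis using xy uv by (simp add: P_def)
    next
      case False
      then show ?thesis using xy uv unfolding P_def
        by (intro add_less_le_mono mult_strict_left_mono mult_left_mono) auto
    qed
    also have "\<dots> = \<sigma> * Im (u *\<^sub>R x + v *\<^sub>R y)" by (simp add: algebra_simps)
    finally show "u *\<^sub>R x + v *\<^sub>R y \<in> P" by (simp add: P_def)
  qed
  then have conn: "connected P" by (rule convex_connected)
  define p where "p = Complex 0 (\<sigma> * (\<bar>b\<bar> + 1))"
  have p: "p \<in> P" using \<sigma> by (auto simp: P_def p_def)
  have PU: "P \<subseteq> - closure \<Omega>" using cl by (auto simp: P_def)
  define C where "C = connected_component_set (- closure \<Omega>) p"
  have "C \<in> components (- closure \<Omega>)" unfolding C_def using p PU by (intro componentsI) auto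
  moreover have "P \<subseteq> C" unfolding C_def by (intro connected_component_maximal p conn PU)
  ultimately show ?thesis by (auto simp: P_def)
qed

text \<open>If both half planes lie in one component, that component meets every horizontal line, and leftward
  rays starting in the complement of \<open>closure \<Omega>\<close> stay in it.\<close>

lemma component_upper_or_lower:
  fixes \<Omega> :: "complex set"
  assumes b: "\<And>w. w \<in> \<Omega> \<Longrightarrow> \<bar>Im w\<bar> \<le> b"
    and shift: "\<And>w t. w \<in> \<Omega> \<Longrightarrow> 0 \<le> t \<Longrightarrow> w + of_real t \<in> \<Omega>"
    and fin: "finite (components (- closure \<Omega>))" and card: "card (components (- closure \<Omega>)) \<le> 2"
    and C: "C \<in> components (- closure \<Omega>)"
  shows "(\<forall>z. b < Im z \<longrightarrow> z \<in> C) \<or> (\<forall>z. b < - Im z \<longrightarrow> z \<in> C)"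
proof -
  obtain U where U: "U \<in> components (- closure \<Omega>)" "\<And>z. b < Im z \<Longrightarrow> z \<in> U"
    using half_plane_component[of \<Omega> b 1, OF b] by auto
  obtain D where D: "D \<in> components (- closure \<Omega>)" "\<And>z. b < - Im z \<Longrightarrow> z \<in> D"
    using half_plane_component[of \<Omega> b "-1", OF b] by auto
  show ?thesis
  proof (cases "C = U \<or> C = D")
    case True then show ?thesis using U(2) D(2) by auto
  next
    case False
    have "U = D"
    proof (rule ccontr)
      assume "U \<noteq> D"
      \<comment> \<open>Here the bound of two components is used: \<open>C\<close>, \<open>U\<close>
        and \<open>D\<close> would be three.\<close>
      then have "card {C, U, D} = 3" using False by auto
      moreover have "card {C, U, D} \<le> card (components (- closure \<Omega>))"
        using C U(1) D(1) fin by (intro card_mono) auto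
      ultimately show False using card by simp
    qed
    have clshift: "w + of_real t \<in> closure \<Omega>" if "w \<in> closure \<Omega>" "0 \<le> t" for w t
    proof -
      have "(\<lambda>w. w + of_real t) ` closure \<Omega> \<subseteq> closure ((\<lambda>w. w + of_real t) ` \<Omega>)"
        by (intro image_closure_subset continuous_intros closed_closure closure_subset)
      also have "\<dots> \<subseteq> closure \<Omega>" using shift that(2) by (intro closure_mono) auto
      finally show ?thesis using that(1) by blast
    qed
    obtain c where c: "c \<in> C" using C in_components_nonempty by blast
    have conU: "connected U" using U(1) by (rule in_components_connected)
    \<comment> \<open>One point above and one below the strip whose heights enclose
      \<open>Im c\<close>.\<close>
    define top bot where "top = Complex 0 (max (\<bar>b\<bar> + 1) (Im c))" and "bot = Complex 0 (- max (\<bar>b\<bar> + 1) (- Im c))"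
    have "top \<in> U" by (rule U(2)) (simp add: top_def)
    have "bot \<in> U" unfolding \<open>U = D\<close> by (rule D(2)) (simp add: bot_def)
    have "\<exists>x\<in>U. Im x = Im c"
    proof -
      have "connected (Im ` U)" by (intro connected_continuous_image conU continuous_intros)
      moreover have "Im top \<in> Im ` U" "Im bot \<in> Im ` U" using \<open>top \<in> U\<close> \<open>bot \<in> U\<close> by auto
      moreover have "Im bot \<le> Im c" "Im c \<le> Im top" by (auto simp: top_def bot_def)
      ultimately have "Im c \<in> Im ` U" unfolding connected_iff_interval by blast
      then show ?thesis by auto
    qed
    then obtain x where x: "x \<in> U" "Im x = Im c" by blast
    \<comment> \<open>The point \<open>y\<close> at this abscissa lies on the leftward rays from
      both \<open>x\<close> and \<open>c\<close>, so it joins their components.\<close>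
    define m where "m = min (Re x) (Re c)"
    define y where "y = Complex m (Im c)"
    have ray: "closed_segment y z \<subseteq> - closure \<Omega>" if z: "z \<in> - closure \<Omega>" "Im z = Im c" "m \<le> Re z" for z
    proof
      fix u assume "u \<in> closed_segment y z"
      then obtain v where v: "0 \<le> v" "v \<le> 1" "u = (1 - v) *\<^sub>R y + v *\<^sub>R z" by (auto simp: in_segment)
      have "z = u + of_real ((1 - v) * (Re z - m))"
        using z(2) by (simp add: v(3) y_def complex_eq_iff algebra_simps)
      moreover have "0 \<le> (1 - v) * (Re z - m)" using v z by simp
      ultimately show "u \<in> - closure \<Omega>" using clshift[of u] z(1) by (metis Compl_iff)
    qed
    have "x \<in> - closure \<Omega>" "c \<in> - closure \<Omega>"
      using x(1) c in_components_subset[OF U(1)] in_components_subset[OF C] by blast+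
    then have cx: "closed_segment y x \<subseteq> - closure \<Omega>" "closed_segment y c \<subseteq> - closure \<Omega>"
      using x(2) by (intro ray; simp add: m_def)+
    have "closed_segment y x \<subseteq> U"
      by (rule components_maximal[OF U(1) connected_segment cx(1)]) (use x(1) in auto)
    moreover have "closed_segment y c \<subseteq> C"
      by (rule components_maximal[OF C connected_segment cx(2)]) (use c in auto)
    ultimately have "y \<in> U \<inter> C" by auto
    then have "C = U" using components_eq[OF C U(1)] by blast
    then show ?thesis using False by blast
  qed
qed

text \<open>Each component contains one of the two half planes, where kernels are superpositions of
  exponentials; pole pushing carries this over to the whole component.\<close>

lemma exp_approximable_kernel:
  fixes \<Omega> :: "complex set"
  assumes \<epsilon>: "0 < \<epsilon>" and b: "\<And>w. w \<in> \<Omega> \<Longrightarrow> \<bar>Im w\<bar> \<le> b"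
    and shift: "\<And>w t. w \<in> \<Omega> \<Longrightarrow> 0 \<le> t \<Longrightarrow> w + of_real t \<in> \<Omega>"
    and fin: "finite (components (- closure \<Omega>))" and card: "card (components (- closure \<Omega>)) \<le> 2"
    and \<zeta>: "\<zeta> \<notin> closure \<Omega>"
  shows "exp_approximable \<Omega> \<epsilon> (\<lambda>w. 1 / (\<zeta> - w))"
proof -
  obtain C where C: "C \<in> components (- closure \<Omega>)" "\<zeta> \<in> C"
    using \<zeta> componentsI[of \<zeta> "- closure \<Omega>"] connected_component_refl[of \<zeta> "- closure \<Omega>"] by auto
  have "\<exists>\<sigma>. (\<sigma> = 1 \<or> \<sigma> = (-1::real)) \<and> (\<forall>z. b < \<sigma> * Im z \<longrightarrow> z \<in> C)"
    using component_upper_or_lower[OF b shift fin card C(1)]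
  proof
    assume "\<forall>z. b < Im z \<longrightarrow> z \<in> C" then show ?thesis by (intro exI[of _ 1]) simp
  next
    assume "\<forall>z. b < - Im z \<longrightarrow> z \<in> C" then show ?thesis by (intro exI[of _ "-1"]) simp
  qed
  then obtain \<sigma> where \<sigma>: "\<sigma> = 1 \<or> \<sigma> = (-1::real)" "\<And>z. b < \<sigma> * Im z \<Longrightarrow> z \<in> C" by blast
  \<comment> \<open>At height \<open>\<bar>b\<bar> + 2\<close> the disc of radius 1 about
    \<open>p\<close> keeps distance 1 from the strip.\<close>
  define p where "p = Complex 0 (\<sigma> * (\<bar>b\<bar> + 2))"
  have Imp: "\<sigma> * Im p = \<bar>b\<bar> + 2" using \<sigma>(1) by (auto simp: p_def)
  show ?thesis
  proof (rule exp_approximable_kernel_component[OF \<epsilon> C(1) _ _ _ C(2)])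
    show "p \<in> C" by (rule \<sigma>(2)) (simp add: Imp)
    show "(0::real) < 1" by simp
    fix \<xi> assume "cmod (\<xi> - p) < 1"
    then have "\<bar>Im (\<xi> - p)\<bar> < 1" using abs_Im_le_cmod[of "\<xi> - p"] by linarith
    then have "\<bar>b\<bar> + 1 \<le> \<sigma> * Im \<xi>" using Imp \<sigma>(1) by auto
    then have "1 \<le> \<sigma> * Im (\<xi> - w)" if "w \<in> \<Omega>" for w using b[OF that] \<sigma>(1) by auto
    then show "exp_approximable \<Omega> \<epsilon> (\<lambda>w. 1 / (\<xi> - w))"
      by (rule exp_approximable_outer_kernel[OF \<sigma>(1) zero_less_one _ b \<epsilon>])
  qed
qed

text \<open>For small \<open>\<epsilon>\<close> the function \<open>exp (\<plusminus> p \<epsilon> h)\<close> takes values in a sector about the positive axis, where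
  the modulus is bounded by a multiple of the real part, whose circular means are constant.\<close>

lemma exp_weight_in_hardy_space:
  assumes h: "h holomorphic_on unit_disc" and b: "\<And>z. z \<in> unit_disc \<Longrightarrow> \<bar>Im (h z)\<bar> \<le> b"
    and p: "1 \<le> p" and \<epsilon>: "\<bar>\<epsilon>\<bar> * p * b \<le> 1"
  shows "(\<lambda>z. if z \<in> unit_disc then exp (of_real \<epsilon> * h z) else 0) \<in> hardy_space p"
proof -
  \<comment> \<open>The modulus of \<open>F\<close> is the \<open>p\<close>-th power in question,
    and its argument \<open>p \<epsilon> Im (h z)\<close> is at most 1 in absolute value.\<close>
  define F where "F z = exp (of_real (p * \<epsilon>) * h z)" for z
  have F: "F holomorphic_on unit_disc" unfolding F_def by (intro holomorphic_intros h)
  have c1: "0 < cos (1::real)" by (rule cos_gt_zero_pi) (use pi_gt3 in auto)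
  have cmodF: "cos 1 * cmod (F z) \<le> Re (F z)" if z: "z \<in> unit_disc" for z
  proof -
    have "\<bar>p * \<epsilon> * Im (h z)\<bar> \<le> 1"
    proof -
      have "\<bar>p * \<epsilon> * Im (h z)\<bar> = (\<bar>\<epsilon>\<bar> * p) * \<bar>Im (h z)\<bar>" using p by (simp add: abs_mult)
      also have "\<dots> \<le> (\<bar>\<epsilon>\<bar> * p) * b" using p b[OF z] by (intro mult_left_mono) auto
      finally show ?thesis using \<epsilon> by simp
    qed
    then have "cos 1 \<le> cos \<bar>p * \<epsilon> * Im (h z)\<bar>" using pi_gt3 by (intro cos_monotone_0_pi_le) auto
    then have "cos 1 \<le> cos (p * \<epsilon> * Im (h z))" by (simp only: cos_abs_real)
    then have "cos 1 * exp (p * \<epsilon> * Re (h z)) \<le> cos (p * \<epsilon> * Im (h z)) * exp (p * \<epsilon> * Re (h z))"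
      by (intro mult_right_mono) auto
    moreover have "cmod (F z) = exp (p * \<epsilon> * Re (h z))" by (simp add: F_def)
    moreover have "Re (F z) = exp (p * \<epsilon> * Re (h z)) * cos (p * \<epsilon> * Im (h z))" by (simp add: F_def Re_exp)
    ultimately show ?thesis by (simp add: mult.commute)
  qed
  have "(\<lambda>z. exp (of_real \<epsilon> * h z)) holomorphic_on unit_disc" by (intro holomorphic_intros h)
  then have hol: "(\<lambda>z. if z \<in> unit_disc then exp (of_real \<epsilon> * h z) else 0) holomorphic_on unit_disc"
    by (rule holomorphic_transform) simp
  show ?thesis
  proof (rule hardy_space_memI[OF hol])
    fix r :: real assume r: "0 < r" "r < 1"
    have "((\<lambda>t. Re (of_real (poisson_kernel r 0 t) * F (of_real r * cis t))) has_integral Re (2 * of_real pi * F 0)) {0..2*pi}"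
      by (rule has_integral_Re[OF poisson_formula[OF F, of 0 r]]) (use r in auto)
    \<comment> \<open>At the centre Poisson's formula is the mean value property.\<close>
    moreover have "poisson_kernel r 0 t = 1" for t using r by (simp add: poisson_kernel_def norm_mult)
    ultimately have "((\<lambda>t. Re (F (of_real r * cis t))) has_integral 2 * pi * Re (F 0)) {0..2*pi}" by simp
    then have I: "((\<lambda>t. 1 / cos 1 * Re (F (of_real r * cis t))) has_integral 1 / cos 1 * (2 * pi * Re (F 0))) {0..2*pi}"
      by (rule has_integral_mult_right)
    show "hardy_mean p (\<lambda>z. if z \<in> unit_disc then exp (of_real \<epsilon> * h z) else 0) r \<le> 1 / cos 1 * (2 * pi * Re (F 0))"
      unfolding hardy_mean_def
    proof (rule has_integral_le[OF integrable_integral I])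
      show "(\<lambda>t. cmod (if of_real r * cis t \<in> unit_disc then exp (of_real \<epsilon> * h (of_real r * cis t)) else 0) powr p) integrable_on {0..2*pi}"
        using hardy_mean_integrable[OF holomorphic_on_imp_continuous_on[OF hol], of r p] r p by simp
      fix t
      have z: "of_real r * cis t \<in> unit_disc" using r by (intro circle_point_in_disc) auto
      have "cmod (exp (of_real \<epsilon> * h (of_real r * cis t))) powr p = cmod (F (of_real r * cis t))"
        by (simp add: F_def powr_def mult.assoc)
      then show "cmod (if of_real r * cis t \<in> unit_disc then exp (of_real \<epsilon> * h (of_real r * cis t)) else 0) powr p
        \<le> 1 / cos 1 * Re (F (of_real r * cis t))"
        using cmodF[OF z] c1 z by (simp only: if_True) (simp add: field_simps)
    qed
  qed auto
qed

section \<open>Norm comparisons and boundedness of composition operators\<close>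

lemma hardy_norm_mono:
  assumes f: "f holomorphic_on unit_disc" and g: "g \<in> hardy_space p" and p: "1 \<le> p"
    and le: "\<And>z. z \<in> unit_disc \<Longrightarrow> cmod (f z) \<le> cmod (g z)"
  shows "hardy_norm p f \<le> hardy_norm p g"
proof (rule hardy_norm_le[OF _ hardy_norm_nonneg p f])
  fix r :: real assume r: "0 < r" "r < 1"
  have "hardy_mean p f r \<le> hardy_mean p g r"
    unfolding hardy_mean_def
    using r p holomorphic_on_imp_continuous_on[OF f] hardy_spaceD(4)[OF g]
    by (intro integral_le hardy_mean_integrable powr_mono2 le circle_point_in_disc) auto
  then show "hardy_mean p f r \<le> hardy_norm p g powr p" using hardy_mean_le_norm[OF g p r] by simp
qed

lemma composition_operator_bounded:
  assumes \<phi>: "\<phi> holomorphic_on unit_disc" "\<phi> \<in> unit_disc \<rightarrow> unit_disc" and p: "1 \<le> p"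
  shows "composition_operator p \<phi> \<in> bounded_operators (hardy_space p) (hardy_norm p)"
proof -
  let ?T = "composition_operator p \<phi>"
  have T: "?T f = (\<lambda>z. if z \<in> unit_disc then f (\<phi> z) else 0)" if "f \<in> hardy_space p" for f
    using that by (simp add: composition_operator_def)
  define a where "a = cmod (\<phi> 0)"
  have a: "0 \<le> a" "a < 1" using \<phi>(2) by (auto simp: a_def Pi_iff)
  define c where "c = 4 / (1 - a)"
  have c: "0 < c" using a by (simp add: c_def)
  have hol: "?T f holomorphic_on unit_disc" if f: "f \<in> hardy_space p" for f
  proof -
    have "f \<circ> \<phi> holomorphic_on unit_disc"
      using \<phi>(2) by (intro holomorphic_on_compose_gen[OF \<phi>(1) hardy_spaceD(1)[OF f]]) auto
    then show ?thesis unfolding T[OF f] by (rule holomorphic_transform) simp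
  qed
  have mean: "hardy_mean p (?T f) r \<le> (c powr (1/p) * hardy_norm p f) powr p"
    if f: "f \<in> hardy_space p" and r: "0 < r" "r < 1" for f r
  proof -
    have cpt: "compact (\<phi> ` cball 0 r)"
      by (intro compact_continuous_image holomorphic_on_imp_continuous_on holomorphic_on_subset[OF \<phi>(1)]) (use r in auto)
    have ne: "\<phi> ` cball 0 r \<noteq> {}" using r by simp
    from continuous_attains_sup[OF cpt ne continuous_on_norm_id]
    obtain y where y: "y \<in> \<phi> ` cball 0 r" and ymax: "\<forall>x\<in>\<phi> ` cball 0 r. cmod x \<le> cmod y"
      by (elim bexE)
    have "cmod y < 1" using y \<phi>(2) r by (auto simp: Pi_iff)
    \<comment> \<open>The first entry exceeds the maximum of \<open>\<bar>\<phi>\<bar>\<close> on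
      the disc of radius \<open>r\<close>; the second keeps \<open>\<rho> - a\<close> at least
      \<open>(1 - a) / 2\<close>, so that the constant \<open>c = 4 / (1 - a)\<close> does not
      depend on \<open>r\<close>.\<close>
    define \<rho> where "\<rho> = max ((1 + cmod y) / 2) ((1 + a) / 2)"
    have \<rho>: "cmod y < \<rho>" "\<rho> < 1" "(1 + a) / 2 \<le> \<rho>" "0 < \<rho>"
      using \<open>cmod y < 1\<close> a by (auto simp: \<rho>_def max_def)
    have "hardy_mean p (?T f) r = hardy_mean p (f \<circ> \<phi>) r"
      unfolding hardy_mean_def T[OF f] using r by (intro integral_cong) (simp add: norm_mult)
    also have "\<dots> \<le> (\<rho> + cmod (\<phi> 0)) / (\<rho> - cmod (\<phi> 0)) * hardy_mean p f \<rho>"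
    proof (rule hardy_mean_comp_le[OF hardy_spaceD(1)[OF f] \<phi>(1) r(1) _ r(2) \<rho>(2) p])
      show "cmod (\<phi> z) < \<rho>" if "cmod z \<le> r" for z
        using bspec[OF ymax, of "\<phi> z"] that \<rho>(1) by simp
    qed
    also have "\<dots> \<le> c * hardy_norm p f powr p"
    proof (rule mult_mono)
      have "(\<rho> + a) / (\<rho> - a) \<le> 2 / ((1 - a) / 2)"
      proof (rule frac_le)
        show "(1 - a) / 2 \<le> \<rho> - a" using \<rho>(3) by (simp add: field_simps)
      qed (use a \<rho> in auto)
      then show "(\<rho> + cmod (\<phi> 0)) / (\<rho> - cmod (\<phi> 0)) \<le> c" by (simp add: c_def a_def)
      show "hardy_mean p f \<rho> \<le> hardy_norm p f powr p" by (rule hardy_mean_le_norm[OF f p \<rho>(4,2)])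
      show "0 \<le> hardy_mean p f \<rho>" using hardy_spaceD(4)[OF f] \<rho> p by (intro hardy_mean_nonneg) auto
    qed (use c in auto)
    also have "\<dots> = (c powr (1/p) * hardy_norm p f) powr p" using c p by (simp add: powr_mult powr_powr)
    finally show ?thesis .
  qed
  have mem: "?T f \<in> hardy_space p" if f: "f \<in> hardy_space p" for f
    by (rule hardy_space_memI[OF hol[OF f] _ order_trans[OF mean[OF f] powr_mono2]]) (use p hardy_norm_nonneg in \<open>auto simp: T[OF f]\<close>)
  have bound: "hardy_norm p (?T f) \<le> c powr (1/p) * hardy_norm p f" if f: "f \<in> hardy_space p" for f
    using hardy_norm_nonneg by (intro hardy_norm_le mean f p hol) auto
  show ?thesis unfolding bounded_operators_def
  proof (intro CollectI conjI ballI allI)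
    show "?T \<in> hardy_space p \<rightarrow>\<^sub>E hardy_space p"
      using mem by (auto simp: PiE_iff composition_operator_def)
    show "?T (\<lambda>x. f x + g x) = (\<lambda>x. ?T f x + ?T g x)" if "f \<in> hardy_space p" "g \<in> hardy_space p" for f g
      unfolding T[OF hardy_add(1)[OF that p]] T[OF that(1)] T[OF that(2)] by auto
    show "?T (\<lambda>x. k * f x) = (\<lambda>x. k * ?T f x)" if "f \<in> hardy_space p" for f k
      unfolding T[OF hardy_scale(1)[OF that p]] T[OF that] by auto
    show "\<exists>K. \<forall>f\<in>hardy_space p. hardy_norm p (?T f) \<le> K * hardy_norm p f" using bound by blast
  qed
qed

lemma hardy_function_banach_space:
  assumes p: "1 \<le> p"
  shows "function_banach_space (hardy_space p) (hardy_norm p)"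
proof -
  interpret Metric_space "hardy_space p" "\<lambda>f g. hardy_norm p (\<lambda>x. f x - g x)"
    by (rule hardy_metric_space[OF p])
  show ?thesis
  proof
    show "mcomplete" by (rule hardy_mcomplete[OF p])
  qed (auto intro: zero_in_hardy_space hardy_add hardy_scale p)
qed

text \<open>Hoelder's inequality with the constant function 1 as second factor.\<close>

lemma hardy_norm_le_double_exponent:
  assumes f: "f \<in> hardy_space (2*p)" and p: "1 \<le> p"
  shows "f \<in> hardy_space p" "hardy_norm p f \<le> (2 * pi) powr (1 / (2*p)) * hardy_norm (2*p) f"
proof -
  define v where "v z = (if z \<in> unit_disc then 1 else 0 :: complex)" for z
  have p2: "1 \<le> 2 * p" using p by simp
  have vh: "v holomorphic_on unit_disc"
    by (rule holomorphic_transform[where f = "\<lambda>_. 1"]) (auto simp: v_def)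
  have v: "v \<in> hardy_space (2*p)" "hardy_norm (2*p) v \<le> (2 * pi) powr (1 / (2*p)) * 1"
    by (rule hardy_bounded[OF vh _ _ p2, where C = 1]; simp add: v_def)+
  have fv: "(\<lambda>z. f z * v z) = f" using hardy_spaceD(2)[OF f] by (auto simp: v_def)
  show "f \<in> hardy_space p" using hardy_mult(1)[OF f v(1) p] unfolding fv .
  have "hardy_norm p f \<le> hardy_norm (2*p) f * hardy_norm (2*p) v"
    using hardy_mult(2)[OF f v(1) p] unfolding fv .
  also have "\<dots> \<le> hardy_norm (2*p) f * ((2 * pi) powr (1 / (2*p)))"
    using v(2) by (intro mult_left_mono hardy_norm_nonneg) simp
  finally show "hardy_norm p f \<le> (2 * pi) powr (1 / (2*p)) * hardy_norm (2*p) f" by (simp add: mult.commute)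
qed

text \<open>Letting the radius tend to 1 shows that a monomial attains the largest norm allowed to a
  function bounded by 1; the uniform convexity argument needs this comparison.\<close>

lemma monomial_in_hardy_space:
  assumes q: "1 \<le> q"
  shows "(\<lambda>z. if z \<in> unit_disc then z ^ k else 0) \<in> hardy_space q"
    "(2 * pi) powr (1/q) \<le> hardy_norm q (\<lambda>z. if z \<in> unit_disc then z ^ k else 0)"
proof -
  let ?m = "\<lambda>z::complex. if z \<in> unit_disc then z ^ k else 0"
  have "(\<lambda>z::complex. z ^ k) holomorphic_on unit_disc" by (intro holomorphic_intros)
  then have hol: "?m holomorphic_on unit_disc" by (rule holomorphic_transform) simp
  show mem: "?m \<in> hardy_space q"
    by (rule hardy_bounded(1)[OF hol _ _ q, where C = 1]) (auto simp: norm_power power_le_one)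
  have mean: "2 * pi * (r ^ k) powr q \<le> hardy_norm q ?m powr q" if r: "0 < r" "r < 1" for r
  proof -
    have "hardy_mean q ?m r = 2 * pi * (r ^ k) powr q"
      using r by (simp add: hardy_mean_def norm_mult norm_power)
    then show ?thesis using hardy_mean_le_norm[OF mem q r] by simp
  qed
  have "2 * pi * (1 ^ k) powr q \<le> hardy_norm q ?m powr q"
  proof (rule LIMSEQ_le_const2)
    show "(\<lambda>n. 2 * pi * ((1 - 1 / (real n + 2)) ^ k) powr q) \<longlonglongrightarrow> 2 * pi * (1 ^ k) powr q"
      by (intro tendsto_intros tendsto_powr dilation_radius_tendsto) simp
    show "\<exists>N. \<forall>n\<ge>N. 2 * pi * ((1 - 1 / (real n + 2)) ^ k) powr q \<le> hardy_norm q ?m powr q"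
      using mean[OF dilation_radius] by blast
  qed
  then have "(2 * pi) powr (1/q) \<le> (hardy_norm q ?m powr q) powr (1/q)"
    using q by (intro powr_mono2) auto
  then show "(2 * pi) powr (1/q) \<le> hardy_norm q ?m"
    using q hardy_norm_nonneg by (simp add: powr_powr)
qed

text \<open>The sum is \<open>2 cosh (\<epsilon> w)\<close>, with real part
  \<open>2 cos (\<epsilon> Im w) cosh (\<epsilon> Re w)\<close>. Two exponentials are combined so
  that both signs of \<open>Re w\<close> are covered.\<close>

lemma cosh_weight_lower_bound:
  assumes "\<bar>\<epsilon> * Im w\<bar> \<le> 1"
  shows "cos 1 * exp (\<epsilon> * \<bar>Re w\<bar>) \<le> cmod (exp (of_real \<epsilon> * w) + exp (of_real (- \<epsilon>) * w))"
proof -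
  have c: "cos 1 \<le> cos (\<epsilon> * Im w)"
  proof -
    have "cos 1 \<le> cos \<bar>\<epsilon> * Im w\<bar>" using assms pi_gt3 by (intro cos_monotone_0_pi_le) auto
    then show ?thesis by (simp only: cos_abs_real)
  qed
  have c1: "0 < cos (1::real)" by (rule cos_gt_zero_pi) (use pi_gt3 in auto)
  have "cos 1 * exp (\<epsilon> * \<bar>Re w\<bar>) \<le> cos (\<epsilon> * Im w) * (exp (\<epsilon> * Re w) + exp (- (\<epsilon> * Re w)))"
    using c c1 by (intro mult_mono) (auto simp: abs_if add_increasing add_increasing2)
  also have "\<dots> = Re (exp (of_real \<epsilon> * w) + exp (of_real (- \<epsilon>) * w))"
    by (simp add: Re_exp algebra_simps)
  also have "\<dots> \<le> cmod (exp (of_real \<epsilon> * w) + exp (of_real (- \<epsilon>) * w))" by (rule complex_Re_le_cmod)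
  finally show ?thesis .
qed

theorem theorem3p11:
  fixes \<phi> h :: "complex \<Rightarrow> complex"
    and \<Phi> :: "real \<Rightarrow> complex \<Rightarrow> complex"
    and \<Omega> :: "complex set"
    and p :: real
  assumes "\<phi> holomorphic_on unit_disc" and "\<phi> \<in> unit_disc \<rightarrow> unit_disc"
    and "hyperbolic_semiflow \<Phi>" and "\<forall>z\<in>unit_disc. \<phi> z = \<Phi> 1 z"
    and "koenigs_function \<Phi> h" and "\<Omega> = h ` unit_disc"
    and "interior (closure \<Omega>) = \<Omega>"
    and "finite (components (- closure \<Omega>))" and "card (components (- closure \<Omega>)) \<le> 2"
    and "1 \<le> p"
  shows "composition_operator p \<phi> \<in> bounded_operators (hardy_space p) (hardy_norm p) \<and>
    strongly_compact_operator (hardy_space p) (hardy_norm p) (composition_operator p \<phi>)"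
proof -
  note p = \<open>1 \<le> p\<close>
  let ?X = "hardy_space p" and ?T = "composition_operator p \<phi>"
  interpret function_banach_space ?X "hardy_norm p" by (rule hardy_function_banach_space[OF p])
  have T: "?T \<in> bounded_operators ?X (hardy_norm p)"
    by (rule composition_operator_bounded[OF assms(1,2) p])
  have h: "h holomorphic_on unit_disc" "inj_on h unit_disc"
    using assms(5) by (auto simp: koenigs_function_def)
  have opn: "open \<Omega>" unfolding assms(6) by (rule open_mapping_thm3[OF h(1) open_ball h(2)])
  have conn: "connected \<Omega>" unfolding assms(6)
    by (intro connected_continuous_image holomorphic_on_imp_continuous_on h connected_ball)
  have shift: "w + of_real t \<in> \<Omega>" if "w \<in> \<Omega>" "0 \<le> t" for w t
    using that assms(5) unfolding assms(6) koenigs_function_def by blast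
  obtain R where R: "0 < R" "\<And>w. \<not> ball w R \<subseteq> \<Omega>"
    using koenigs_domain_no_large_disc[OF assms(3,5)] unfolding assms(6) by blast
  obtain b where b: "\<And>w. w \<in> \<Omega> \<Longrightarrow> \<bar>Im w\<bar> \<le> b"
    using right_invariant_domain_in_strip[OF opn conn shift R] by blast
  have hb: "\<bar>Im (h z)\<bar> \<le> b" if "z \<in> unit_disc" for z using b that by (simp add: assms(6))
  have b0: "0 \<le> b" using hb[of 0] by simp
  \<comment> \<open>Gives \<open>\<epsilon> p b \<le> 1\<close>, for membership of the weight
    functions in the space, and \<open>\<epsilon> b \<le> 1\<close>, for the lower bound on their
    sum; \<open>b + 1\<close> allows \<open>b = 0\<close>.\<close>
  define \<epsilon> where "\<epsilon> = 1 / (p * (b + 1))"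
  have \<epsilon>: "0 < \<epsilon>" "\<epsilon> * p * b \<le> 1" "\<epsilon> * b \<le> 1"
  proof -
    show "0 < \<epsilon>" using p b0 by (simp add: \<epsilon>_def)
    show eb: "\<epsilon> * p * b \<le> 1" using p b0 by (simp add: \<epsilon>_def)
    have "\<epsilon> * b * 1 \<le> \<epsilon> * b * p" using p b0 \<open>0 < \<epsilon>\<close> by (intro mult_left_mono) auto
    then show "\<epsilon> * b \<le> 1" using eb by (simp add: mult_ac)
  qed
  define e where "e s z = (if z \<in> unit_disc then exp (\<i> * of_real s * h z) else 0)" for s :: real and z
  define S where "S = range e"
  have eX: "e s \<in> ?X" for s
  proof (rule hardy_bounded(1)[OF _ _ _ p])
    have "(\<lambda>z. exp (\<i> * of_real s * h z)) holomorphic_on unit_disc" by (intro holomorphic_intros h)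
    then show "e s holomorphic_on unit_disc" by (rule holomorphic_transform) (simp add: e_def)
    show "cmod (e s z) \<le> exp (\<bar>s\<bar> * b)" if "z \<in> unit_disc" for z
    proof -
      have "- (s * Im (h z)) \<le> \<bar>s\<bar> * \<bar>Im (h z)\<bar>" by (metis abs_ge_minus_self abs_mult)
      also have "\<dots> \<le> \<bar>s\<bar> * b" by (intro mult_left_mono hb that) auto
      finally show ?thesis using that by (simp add: e_def)
    qed
  qed (simp add: e_def)
  then have SX: "S \<subseteq> ?X" by (auto simp: S_def)
  have eig: "?T (e s) = (\<lambda>z. exp (\<i> * of_real s) * e s z)" for s
  proof
    fix z
    show "?T (e s) z = exp (\<i> * of_real s) * e s z"
    proof (cases "z \<in> unit_disc")
      case True
      have "\<phi> z \<in> unit_disc" using assms(2) True by blast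
      \<comment> \<open>\<open>\<phi>\<close> is the time-one map, which \<open>h\<close> conjugates
        to the translation by 1.\<close>
      moreover have "h (\<phi> z) = h z + 1" using koenigs_shift(2)[OF assms(5), of 1 z] True assms(4) by simp
      ultimately show ?thesis using True eX[of s]
        by (simp add: composition_operator_def e_def exp_add[symmetric] algebra_simps)
    qed (use eX in \<open>simp add: composition_operator_def e_def\<close>)
  qed
  define E where "E = {f \<in> ?X. approximable_by S f}"
  have E: "closed_subspace p E"
    unfolding closed_subspace_def E_def
  proof (intro conjI ballI allI impI)
    show "(\<lambda>_. 0) \<in> {f \<in> ?X. approximable_by S f}" using zero_mem approximable_by_zero by simp
    show "(\<lambda>z. f z + g z) \<in> {f \<in> ?X. approximable_by S f}"
      if "f \<in> {f \<in> ?X. approximable_by S f}" "g \<in> {f \<in> ?X. approximable_by S f}" for f g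
      using that approximable_by_add[OF SX] add_mem by simp
    show "(\<lambda>z. c * f z) \<in> {f \<in> ?X. approximable_by S f}" if "f \<in> {f \<in> ?X. approximable_by S f}" for c f
      using that approximable_by_scale[OF SX] scale_mem by simp
    show "f \<in> {f \<in> ?X. approximable_by S f}"
      if "f \<in> ?X" "\<forall>\<epsilon>>0. \<exists>g\<in>{f \<in> ?X. approximable_by S f}. hardy_norm p (\<lambda>z. g z - f z) < \<epsilon>" for f
      using approximable_by_limit[OF SX that(1)] that by blast
  qed auto
  have eE: "e s \<in> E" for s using eX approximable_by_mem[of "e s" S] by (auto simp: E_def S_def)
  \<comment> \<open>A single element of the space that dominates, up to \<open>cos 1\<close>, the
    weight composed with \<open>h\<close>.\<close>
  define W where "W z = (if z \<in> unit_disc then exp (of_real \<epsilon> * h z) else 0) + (if z \<in> unit_disc then exp (of_real (- \<epsilon>) * h z) else 0)" for z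
  have WX: "W \<in> ?X" unfolding W_def
    using \<epsilon> by (intro add_mem exp_weight_in_hardy_space[OF h(1) hb p]) auto
  have c1: "0 < cos (1::real)" by (rule cos_gt_zero_pi) (use pi_gt3 in auto)
  have Wlow: "exp (\<epsilon> * \<bar>Re (h z)\<bar>) \<le> cmod (W z) / cos 1" if z: "z \<in> unit_disc" for z
  proof -
    have "\<bar>\<epsilon> * Im (h z)\<bar> \<le> 1"
      using order_trans[OF mult_left_mono[OF hb[OF z], of \<epsilon>] \<epsilon>(3)] \<epsilon>(1) by (simp add: abs_mult)
    from cosh_weight_lower_bound[OF this] show ?thesis using c1 z by (simp add: W_def field_simps)
  qed
  \<comment> \<open>Weighted approximation on \<open>\<Omega>\<close> becomes norm approximation
    after composition with \<open>h\<close>, the error being at most a small multiple of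
    \<open>\<bar>W\<bar>\<close>.\<close>
  have approx_E: "f \<in> E" if f: "f \<in> ?X" "\<And>z. z \<in> unit_disc \<Longrightarrow> f z = g (h z)" and g: "exp_approximable \<Omega> \<epsilon> g" for f g
  proof (rule closed_subspace_approx[OF E f(1)])
    fix \<delta> :: real assume \<delta>: "0 < \<delta>"
    define C where "C = hardy_norm p W / cos 1"
    have C: "0 \<le> C" using c1 hardy_norm_nonneg by (simp add: C_def)
    define \<eta> where "\<eta> = \<delta> / (C + 1)"
    have \<eta>: "0 < \<eta>" using \<delta> C by (simp add: \<eta>_def)
    from exp_approximableD[OF g \<eta>] obtain I c where I: "finite (I :: real set)"
      and Ic: "\<forall>w\<in>\<Omega>. cmod (g w - (\<Sum>s\<in>I. c s * exp (\<i> * of_real s * w))) \<le> \<eta> * exp (\<epsilon> * \<bar>Re w\<bar>)"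
      by (elim exE conjE)
    let ?s = "\<lambda>z. \<Sum>s\<in>I. c s * e s z"
    have sE: "?s \<in> E" by (rule closed_subspace_sum[OF E eE])
    then have sX: "?s \<in> ?X" by (simp add: E_def)
    have k: "(\<lambda>z. of_real (\<eta> / cos 1) * W z) \<in> ?X" by (rule scale_mem[OF WX])
    have "hardy_norm p (\<lambda>z. ?s z - f z) \<le> hardy_norm p (\<lambda>z. of_real (\<eta> / cos 1) * W z)"
    proof (rule hardy_norm_mono[OF hardy_spaceD(1)[OF diff_mem[OF sX f(1)]] k p])
      fix z assume z: "z \<in> unit_disc"
      have "h z \<in> \<Omega>" using z by (simp add: assms(6))
      then have "cmod (g (h z) - (\<Sum>s\<in>I. c s * exp (\<i> * of_real s * h z))) \<le> \<eta> * exp (\<epsilon> * \<bar>Re (h z)\<bar>)" using Ic by blast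
      also have "\<dots> \<le> \<eta> * (cmod (W z) / cos 1)" by (intro mult_left_mono Wlow z) (use \<eta> in simp)
      finally show "cmod (?s z - f z) \<le> cmod (of_real (\<eta> / cos 1) * W z)"
        using z f(2)[OF z] \<eta> c1 by (simp add: e_def norm_mult norm_divide norm_minus_commute del: of_real_divide)
    qed
    also have "\<dots> = \<eta> * C" using norm_scale[OF WX, of "of_real (\<eta> / cos 1)"] \<eta> c1
      by (simp add: C_def norm_divide)
    also have "\<dots> < \<delta>" using C \<delta> by (simp add: \<eta>_def field_simps)
    finally show "\<exists>g\<in>E. hardy_norm p (\<lambda>z. g z - f z) < \<delta>" by (rule bexI[OF _ sE])
  qed
  obtain u :: "nat \<Rightarrow> complex \<Rightarrow> complex" and d :: "nat \<Rightarrow> real"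
    where d: "\<And>j. 0 < d j" and u: "\<And>j. u j holomorphic_on (\<Union>v\<in>\<Omega>. ball v (d j))"
      "\<And>j w. w \<in> (\<Union>v\<in>\<Omega>. ball v (d j)) \<Longrightarrow> cmod (u j w) \<le> 1"
    and ulim: "\<And>z. z \<in> unit_disc \<Longrightarrow> (\<lambda>j. u j (h z)) \<longlonglongrightarrow> z"
  proof (rule kernel_approximation[OF h assms(6) shift b assms(7)])
    fix u :: "nat \<Rightarrow> complex \<Rightarrow> complex" and d :: "nat \<Rightarrow> real"
    assume *: "\<And>j. 0 < d j" "\<And>j. u j holomorphic_on (\<Union>v\<in>\<Omega>. ball v (d j))"
      "\<And>j w. w \<in> (\<Union>v\<in>\<Omega>. ball v (d j)) \<Longrightarrow> cmod (u j w) \<le> 1"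
      "\<And>z. z \<in> unit_disc \<Longrightarrow> (\<lambda>j. u j (h z)) \<longlonglongrightarrow> z"
    show thesis by (rule that[OF *])
  qed
  have mono: "(\<lambda>z. if z \<in> unit_disc then z ^ k else 0) \<in> E" for k
  proof -
    let ?m = "\<lambda>z::complex. if z \<in> unit_disc then z ^ k else 0"
    define G where "G j z = (if z \<in> unit_disc then u j (h z) ^ k else 0)" for j z
    \<comment> \<open>The convergence argument requires an exponent at least 2; the result is
      brought back to \<open>p\<close> by the inclusion of the spaces.\<close>
    have q: "2 \<le> 2 * p" "1 \<le> 2 * p" using p by auto
    have sub: "\<Omega> \<subseteq> (\<Union>v\<in>\<Omega>. ball v (d j))" for j using nbhd_properties(3)[OF conn d] .
    have hN: "h z \<in> (\<Union>v\<in>\<Omega>. ball v (d j))" if "z \<in> unit_disc" for z j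
      using sub[of j] that assms(6) by blast
    have Ghol: "G j holomorphic_on unit_disc" for j
    proof -
      have "u j \<circ> h holomorphic_on unit_disc" using hN by (intro holomorphic_on_compose_gen[OF h(1) u(1)]) auto
      then have "(\<lambda>z. (u j \<circ> h) z ^ k) holomorphic_on unit_disc" by (intro holomorphic_intros)
      then show ?thesis by (rule holomorphic_transform) (simp add: G_def)
    qed
    have Gb: "cmod (G j z) \<le> 1" if "z \<in> unit_disc" for j z
      using u(2)[OF hN[OF that]] that by (simp add: G_def norm_power power_le_one)
    have G2: "G j \<in> hardy_space (2*p)" "hardy_norm (2*p) (G j) \<le> (2 * pi) powr (1 / (2*p)) * 1" for j
      by (rule hardy_bounded[OF Ghol _ Gb q(2)]; simp add: G_def)+
    have "(\<lambda>j. hardy_norm (2*p) (\<lambda>z. G j z - ?m z)) \<longlonglongrightarrow> 0"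
    proof (rule hardy_norm_convergence[OF G2(1) monomial_in_hardy_space(1)[OF q(2)] q(1)])
      \<comment> \<open>The functions \<open>G j\<close> are bounded by 1, so they cannot exceed the
        norm of a monomial.\<close>
      show "hardy_norm (2*p) (G j) \<le> hardy_norm (2*p) ?m" for j
        using G2(2)[of j] monomial_in_hardy_space(2)[OF q(2), of k] by simp
      show "(\<lambda>j. G j z) \<longlonglongrightarrow> ?m z" if "z \<in> unit_disc" for z
        using tendsto_power[OF ulim[OF that], of k] that by (simp add: G_def)
    qed
    then have lim: "(\<lambda>j. (2 * pi) powr (1 / (2*p)) * hardy_norm (2*p) (\<lambda>z. G j z - ?m z)) \<longlonglongrightarrow> 0"
      by (rule tendsto_mult_right_zero)
    have bound: "hardy_norm p (\<lambda>z. G j z - ?m z) \<le> (2 * pi) powr (1 / (2*p)) * hardy_norm (2*p) (\<lambda>z. G j z - ?m z)" for j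
      by (rule hardy_norm_le_double_exponent(2)[OF hardy_diff(1)[OF G2(1) monomial_in_hardy_space(1)[OF q(2)] q(2)] p])
    have "(\<lambda>j. hardy_norm p (\<lambda>z. G j z - ?m z)) \<longlonglongrightarrow> 0"
      by (rule tendsto_sandwich[OF always_eventually[OF allI[OF hardy_norm_nonneg]] always_eventually[OF allI[OF bound]] tendsto_const lim])
    moreover have "G j \<in> E" for j
    proof (rule approx_E)
      show "G j \<in> ?X" by (rule hardy_norm_le_double_exponent(1)[OF G2(1) p])
      show "G j z = (\<lambda>w. u j w ^ k) (h z)" if "z \<in> unit_disc" for z using that by (simp add: G_def)
      show "exp_approximable \<Omega> \<epsilon> (\<lambda>w. u j w ^ k)"
      proof (rule exp_approximable_holomorphic_nbhd[OF \<epsilon>(1) opn b d, where B = 1])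
        show "(\<lambda>w. u j w ^ k) holomorphic_on (\<Union>v\<in>\<Omega>. ball v (d j))" by (intro holomorphic_intros u)
        show "cmod (u j w ^ k) \<le> 1" if "w \<in> (\<Union>v\<in>\<Omega>. ball v (d j))" for w
          using u(2)[OF that] by (simp add: norm_power power_le_one)
        show "exp_approximable \<Omega> \<epsilon> (\<lambda>w. 1 / (\<zeta> - w))" if "\<zeta> \<notin> closure \<Omega>" for \<zeta>
          by (rule exp_approximable_kernel[OF \<epsilon>(1) b shift assms(8,9) that])
      qed auto
    qed
    ultimately show ?thesis
      by (intro closed_subspace_limit[OF E _ monomial_in_hardy_space(1)[OF p]])
  qed
  have dense: "approximable_by S f" if "f \<in> ?X" for f
    using hardy_dense_if_monomials[OF E p mono that] by (simp add: E_def)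
  have "strongly_compact_operator ?X (hardy_norm p) ?T"
    by (rule strongly_compact_if_eigenvectors_dense[OF T SX _ dense]) (use eig in \<open>auto simp: S_def\<close>)
  with T show ?thesis ..
qed

end
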